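(* Let $X=(X_t)_{t\ge0}$ be a real Lévy process with characteristics $(a,0,\nu)$ and index $\beta$ such that $\beta>0$ and $\mathbb{E}\,|X_1|^p<+\infty$ for some $p\in(0,\beta)$; if $\beta=1$, assume in addition that $\nu$ is symmetric. Assume that there is $c\in(0,1]$ such that the Lévy measure satisfies $$\mathbf{1}_{\{0<|x|\le c\}}\,\nu(dx)\le\varphi(|x|)\,\mathbf{1}_{\{0<|x|\le c\}}\,dx ,$$ where $\varphi:(0,c]\to(0,\infty)$ is a regularly varying function at zero of index $-(\beta+1)$. Let $l(x)=x^{\beta+1}\varphi(x)$, $x\in(0,c]$, and assume that the function $x\mapsto l(1/x)$, $x\ge1/c$, is locally bounded. Let $\underline{l}(x)=l(x^{1/\beta})$. Let $U$ denote the process $$U_t=X_t\ \text{ if }\beta>1,\qquad U_t=X_t-t\left(a-\int_{\{|x|\le1\}}x\,d\nu(x)\right)\ \text{ if }\beta<1,\qquad U_t=X_t-at\ \text{ if }\beta=1 .$$ (a) Assume that $l$ is decreasing and unbounded on $(0,c]$. Then as $t\to0$, for every $\varepsilon\in(0,\beta)$, $$\mathbb{E}\,\sup_{s\le t}|U_s|^p=O\left(t^{p/\beta}\,\underline{l}(t)^{p/(\beta-\varepsilon)}\right).$$ (b) Assume that $l$ is increasing on $(0,c]$ with $l(0+)=0$, and that $\beta\in(0,2)$. Then as $t\to0$, for every $\varepsilon>0$, $$\mathbb{E}\,\sup_{s\le t}|U_s|^p=O\left(t^{p/\beta}\,\underline{l}(t)^{p/(\beta+\varepsilon)}\right).$$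
   Context: A (càdlàg) real Lévy process $X=(X_t)_{t\ge0}$ has characteristics $(a,\sigma^2,\nu)$ if $\mathbb{E}\,e^{iuX_t}=e^{-t\Psi(u)}$ for all $u\in\mathbb{R}$, $t\ge 0$, with $$\Psi(u)=-iua+\tfrac12\sigma^2u^2-\int\left(e^{iux}-1-iux\mathbf{1}_{\{|x|\le1\}}\right)d\nu(x),$$ where $a\in\mathbb{R}$, $\sigma^2\ge0$, and $\nu$ (the Lévy measure) is a measure on $\mathbb{R}$ with $\nu(\{0\})=0$ and $\int (x^2\wedge1)\,d\nu(x)<+\infty$. Characteristics $(a,0,\nu)$ means $\sigma^2=0$, i.e. $X$ has no Brownian component. The index of $X$ is $\beta=\inf\{p>0:\int_{\{|x|\le1\}}|x|^p\,d\nu(x)<+\infty\}\in[0,2]$. A measurable function $\varphi:(0,c]\to(0,\infty)$ ($c>0$) is regularly varying at zero with index $b\in\mathbb{R}$ if $\lim_{x\to0}\varphi(tx)/\varphi(x)=t^b$ for every $t>0$. An inequality between measures means inequality on every Borel set. $l(0+)=\lim_{x\downarrow0}l(x)$. The suprema $\sup_{s\le t}$ are over $s\in[0,t]$. Implied constants in $O(\cdot)$ may depend on everything except $t$. *)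

theory Defs
  imports "HOL-Probability.Probability" "HOL-Library.Landau_Symbols"
begin

text \<open>Processes are indexed by \<open>real\<close>; only the times \<open>t \<ge> 0\<close> are ever used.\<close>

definition cadlag :: "(real \<Rightarrow> real) \<Rightarrow> bool" where
  "cadlag f \<longleftrightarrow>
     (\<forall>t\<ge>0. (f \<longlongrightarrow> f t) (at_right t)) \<and>
     (\<forall>t>0. \<exists>l. (f \<longlongrightarrow> l) (at_left t))"

definition independent_increments :: "'a measure \<Rightarrow> (real \<Rightarrow> 'a \<Rightarrow> real) \<Rightarrow> bool" where
  "independent_increments M X \<longleftrightarrow>
     (\<forall>(n::nat) (t::nat \<Rightarrow> real). 0 \<le> t 0 \<and> (\<forall>i<n. t i \<le> t (Suc i)) \<longrightarrow>
        prob_space.indep_vars M (\<lambda>_. borel) (\<lambda>i \<omega>. X (t (Suc i)) \<omega> - X (t i) \<omega>) {..<n})"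

definition stationary_increments :: "'a measure \<Rightarrow> (real \<Rightarrow> 'a \<Rightarrow> real) \<Rightarrow> bool" where
  "stationary_increments M X \<longleftrightarrow>
     (\<forall>s\<ge>0. \<forall>t\<ge>0. distr M borel (\<lambda>\<omega>. X (s + t) \<omega> - X s \<omega>) = distr M borel (X t))"

text \<open>Stochastic continuity is not listed: it follows from right-continuity at 0 together with
  stationarity of the increments.\<close>

definition levy_process :: "'a measure \<Rightarrow> (real \<Rightarrow> 'a \<Rightarrow> real) \<Rightarrow> bool" where
  "levy_process M X \<longleftrightarrow>
     prob_space M \<and>
     (\<forall>t\<ge>0. X t \<in> borel_measurable M) \<and>
     (AE \<omega> in M. X 0 \<omega> = 0) \<and>
     independent_increments M X \<and>
     stationary_increments M X \<and>
     (AE \<omega> in M. cadlag (\<lambda>t. X t \<omega>))"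

definition levy_measure :: "real measure \<Rightarrow> bool" where
  "levy_measure \<nu> \<longleftrightarrow>
     sets \<nu> = sets borel \<and> emeasure \<nu> {0} = 0 \<and>
     (\<integral>\<^sup>+x. ennreal (min (x\<^sup>2) 1) \<partial>\<nu>) < \<infinity>"

definition levy_exponent :: "real \<Rightarrow> real \<Rightarrow> real measure \<Rightarrow> real \<Rightarrow> complex" where
  "levy_exponent a \<sigma>2 \<nu> u =
     - (\<i> * of_real (u * a)) + of_real (\<sigma>2 * u\<^sup>2 / 2)
     - (\<integral>x. (exp (\<i> * of_real (u * x)) - 1
              - \<i> * of_real (u * x) * of_real (indicator {-1..1} x)) \<partial>\<nu>)"

text \<open>The second characteristic \<open>\<sigma>2\<close> is the variance, i.e. the square of the Gaussian coefficient.\<close>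

definition has_characteristics ::
  "'a measure \<Rightarrow> (real \<Rightarrow> 'a \<Rightarrow> real) \<Rightarrow> real \<Rightarrow> real \<Rightarrow> real measure \<Rightarrow> bool" where
  "has_characteristics M X a \<sigma>2 \<nu> \<longleftrightarrow>
     0 \<le> \<sigma>2 \<and> levy_measure \<nu> \<and>
     (\<forall>t\<ge>0. \<forall>u. char (distr M borel (X t)) u = exp (- (of_real t * levy_exponent a \<sigma>2 \<nu> u)))"

definition levy_index :: "real measure \<Rightarrow> real" where
  "levy_index \<nu> =
     Inf {p. p > 0 \<and> (\<integral>\<^sup>+x\<in>{-1..1}. ennreal (\<bar>x\<bar> powr p) \<partial>\<nu>) < \<infinity>}"

definition symmetric_measure :: "real measure \<Rightarrow> bool" where
  "symmetric_measure \<nu> \<longleftrightarrow> distr \<nu> borel uminus = \<nu>"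

text \<open>Only the values of \<open>\<phi>\<close> on \<open>{0<..c}\<close> matter here and below.\<close>

definition regularly_varying_at_0 :: "real \<Rightarrow> (real \<Rightarrow> real) \<Rightarrow> real \<Rightarrow> bool" where
  "regularly_varying_at_0 c \<phi> b \<longleftrightarrow>
     \<phi> \<in> borel_measurable (restrict_space borel {0<..c}) \<and>
     (\<forall>x\<in>{0<..c}. \<phi> x > 0) \<and>
     (\<forall>t>0. ((\<lambda>x. \<phi> (t * x) / \<phi> x) \<longlongrightarrow> t powr b) (at_right 0))"

definition locally_bounded_on :: "real set \<Rightarrow> (real \<Rightarrow> real) \<Rightarrow> bool" where
  "locally_bounded_on S f \<longleftrightarrow>
     (\<forall>x\<in>S. \<exists>V. open V \<and> x \<in> V \<and> bounded (f ` (V \<inter> S)))"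

definition levy_measure_dominated :: "real measure \<Rightarrow> real \<Rightarrow> (real \<Rightarrow> real) \<Rightarrow> bool" where
  "levy_measure_dominated \<nu> c \<phi> \<longleftrightarrow>
     (\<forall>A\<in>sets borel.
        emeasure (density \<nu> (indicator {x. 0 < \<bar>x\<bar> \<and> \<bar>x\<bar> \<le> c})) A
        \<le> emeasure (density lborel
             (\<lambda>x. ennreal (\<phi> \<bar>x\<bar>) * indicator {x. 0 < \<bar>x\<bar> \<and> \<bar>x\<bar> \<le> c} x)) A)"

definition compensated_process ::
  "real \<Rightarrow> real measure \<Rightarrow> (real \<Rightarrow> 'a \<Rightarrow> real) \<Rightarrow> real \<Rightarrow> 'a \<Rightarrow> real" where
  "compensated_process a \<nu> X t \<omega> =
     (if levy_index \<nu> > 1 then X t \<omega>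
      else if levy_index \<nu> < 1 then X t \<omega> - t * (a - (LINT x:{-1..1}|\<nu>. x))
      else X t \<omega> - a * t)"

text \<open>The expectation is taken in \<open>ennreal\<close>, so that finiteness is a genuine assertion and not
  a consequence of the convention that non-integrable functions have integral 0.\<close>

definition sup_moment :: "'a measure \<Rightarrow> (real \<Rightarrow> 'a \<Rightarrow> real) \<Rightarrow> real \<Rightarrow> real \<Rightarrow> ennreal" where
  "sup_moment M U p t = (\<integral>\<^sup>+\<omega>. (SUP s\<in>{0..t}. ennreal (\<bar>U s \<omega>\<bar> powr p)) \<partial>M)"

definition bigo_at_0 :: "(real \<Rightarrow> ennreal) \<Rightarrow> (real \<Rightarrow> real) \<Rightarrow> bool" where
  "bigo_at_0 F g \<longleftrightarrow>
     (\<forall>\<^sub>F t in at_right 0. F t < \<infinity>) \<and> (\<lambda>t. enn2real (F t)) \<in> O[at_right 0](g)"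

end

theory Submission
  imports Defs
begin

text \<open>
  Write \<open>U\<^sub>t = X\<^sub>t - t d\<close>, where \<open>d\<close> is the drift that the definition of \<open>U\<close> removes. The
  characteristic function of \<open>U\<^sub>t\<close> at \<open>v\<close> is \<open>exp (- t (A v + \<i> B v))\<close> with
  \<open>A v = \<integral> 1 - cos (v x) d\<nu>\<close>, which is \<open>levy_re\<close>, and a real \<open>B v\<close>, which is \<open>levy_im\<close>. The whole
  estimate is read off from this function.

  By right continuity the supremum over \<open>[0, t]\<close> is a limit of maxima over dyadic times, that is, of
  maxima of partial sums of independent increments. Etemadi's inequality (\<open>etemadi\<close>) controls the tail
  of such a maximum by the tails of single increments, and the truncation inequality
  (\<open>tail_le_char_integral\<close>) controls those by an average of \<open>1 - Re char\<close> near zero. Integrating the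
  tail against \<open>p r powr (p - 1)\<close> gives (\<open>sup_moment_le_char_integral\<close>): if
  \<open>1 - Re char (U\<^sub>h) v \<le> G v\<close> for all \<open>h \<le> t\<close>, then the \<open>p\<close>-th moment of the supremum is at most a
  constant times the integral of \<open>v powr (-1 - p) * G v\<close> over \<open>v > 0\<close>.

  The frequencies are cut at \<open>1 / c\<close> and at \<open>1 / y\<close>, where \<open>y\<close> is a parameter in \<open>(0, c]\<close>.

  \<^item> For \<open>v \<le> 1 / c\<close>, Cauchy--Schwarz bounds \<open>(B v)\<^sup>2\<close> by \<open>A v + v\<^sup>2\<close> up to a constant
    (\<open>levy_im_le_near_0\<close>), so that for \<open>t \<le> 1\<close> the
    quantity \<open>1 - Re char\<close> is at most of order \<open>t (A v + v\<^sup>2)\<close>. The moment assumption on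
    \<open>X\<^sub>1\<close> makes \<open>A\<close> integrable at zero against \<open>v powr (-1 - p)\<close>
    (\<open>levy_re_integrable_near_0\<close>). This range contributes \<open>O(t)\<close>.
  \<^item> For \<open>1 / c \<le> v \<le> 1 / y\<close>, the domination of \<open>\<nu>\<close> by \<open>\<phi>\<close> yields
    \<open>A v + \<bar>B v\<bar> = O(v powr \<beta> * l (1 / v))\<close> (\<open>levy_exponent_le_near_infinity\<close>);
    for \<open>\<beta> = 2\<close> the integrability of \<open>x\<^sup>2\<close> near zero gives the same
    (\<open>levy_exponent_le_square\<close>). As \<open>p < \<beta>\<close>, the
    integral is dominated by its upper end and contributes \<open>O(t * l y * y powr (p - \<beta>))\<close>.
  \<^item> For \<open>v \<ge> 1 / y\<close> the trivial bound \<open>2\<close> contributes \<open>O(y powr p)\<close>.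

  Consequently the moment is \<open>O(y powr p)\<close> whenever \<open>t * l y \<le> y powr \<beta>\<close> (\<open>sup_moment_le_powr\<close>); under
  this condition \<open>t\<close> itself is \<open>O(y powr p)\<close>. Both parts of the theorem come from one choice: with
  \<open>L = l (t powr (1 / \<beta>))\<close> take \<open>y = t powr (1 / \<beta>) * L powr (1 / q)\<close>, where \<open>q = \<beta> - \<epsilon>\<close> in (a) and
  \<open>q = \<beta> + \<epsilon>\<close> in (b). In (a) \<open>L\<close> is large and \<open>l\<close> decreases, in (b) \<open>L\<close> is small and \<open>l\<close> increases;
  in both cases \<open>l y \<le> L \<le> L powr (\<beta> / q)\<close>, and the last term times \<open>t\<close> equals \<open>y powr \<beta>\<close>.

  All comparisons of values of \<open>l\<close> at different points go through two-sided Potter bounds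
  (\<open>potter_bounds\<close>), which a monotone \<open>l\<close> satisfies as soon as \<open>l (2 x) / l x\<close> tends to \<open>1\<close>.
\<close>

section \<open>Elementary integrals and trigonometric inequalities\<close>

lemma nn_integral_powr_Ioc:
  fixes e y :: real
  assumes "e > 0" and "y \<ge> 0"
  shows "(\<integral>\<^sup>+x\<in>{0<..y}. ennreal (x powr (e - 1)) \<partial>lborel) = ennreal (y powr e / e)"
proof -
  have "((\<lambda>x. x powr (e - 1)) has_integral (y powr (e - 1 + 1) / (e - 1 + 1))) {0..y}"
    by (rule has_integral_powr_from_0) (use assms in auto)
  then have "((\<lambda>x. x powr (e - 1)) has_integral (y powr e / e)) {0..y}"
    by simp
  then have "(\<integral>\<^sup>+x. ennreal (x powr (e - 1)) * indicator {0..y} x \<partial>lborel) = ennreal (y powr e / e)"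
    by (intro nn_integral_has_integral_lebesgue') auto
  moreover have "(\<integral>\<^sup>+x. ennreal (x powr (e - 1)) * indicator {0..y} x \<partial>lborel)
      = (\<integral>\<^sup>+x. ennreal (x powr (e - 1)) * indicator {0<..y} x \<partial>lborel)"
    by (intro nn_integral_cong) (auto simp: indicator_def)
  ultimately show ?thesis by simp
qed

lemma nn_integral_powr_Ici:
  fixes e y :: real
  assumes "e > 0" and "y > 0"
  shows "(\<integral>\<^sup>+x\<in>{y..}. ennreal (x powr (- e - 1)) \<partial>lborel) = ennreal (y powr (- e) / e)"
proof -
  have "((\<lambda>x. x powr (- e - 1)) has_integral (-(y powr (- e - 1 + 1)) / (- e - 1 + 1))) {y..}"
    by (rule has_integral_powr_to_inf) (use assms in auto)
  then have "((\<lambda>x. x powr (- e - 1)) has_integral (y powr (- e) / e)) {y..}"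
    by simp
  then show ?thesis
    by (intro nn_integral_has_integral_lebesgue') auto
qed

lemma one_minus_cos_le: "1 - cos x \<le> x\<^sup>2 / 2" for x :: real
proof -
  have "1 - cos x = 2 * (sin (x / 2))\<^sup>2"
    using cos_double_sin[of "x / 2"] by simp
  also have "\<dots> \<le> 2 * (x / 2)\<^sup>2"
    using abs_sin_x_le_abs_x[of "x / 2"] by (subst (asm) abs_le_square_iff) simp
  finally show ?thesis by (simp add: power2_eq_square)
qed

lemma one_minus_cos_le_abs: "1 - cos x \<le> \<bar>x\<bar>" for x :: real
proof (cases "\<bar>x\<bar> \<le> 2")
  case True
  then have "x\<^sup>2 \<le> 2 * \<bar>x\<bar>" by (metis abs_ge_zero mult_right_mono power2_abs power2_eq_square)
  then show ?thesis using one_minus_cos_le[of x] by linarith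
qed (use cos_ge_minus_one[of x] in linarith)

lemma abs_sin_minus_le: "\<bar>sin x - x\<bar> \<le> x\<^sup>2" for x :: real
proof -
  have "\<bar>Im (iexp x - (\<Sum>k\<le>1. (\<i> * x) ^ k / fact k))\<bar> \<le> cmod (iexp x - (\<Sum>k\<le>1. (\<i> * x) ^ k / fact k))"
    by (rule abs_Im_le_cmod)
  also have "\<dots> \<le> \<bar>x\<bar> ^ Suc 1 / fact (Suc 1)" by (rule iexp_approx1)
  finally have "\<bar>sin x - x\<bar> \<le> x\<^sup>2 / 2"
    by (simp add: Im_exp power2_eq_square)
  then show ?thesis by (smt (verit) zero_le_power2 field_sum_of_halves)
qed

text \<open>The left-hand side is \<open>1 - Re (exp (- a - \<i> b))\<close>. The error term \<open>e\<close> is left open because both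
  \<open>b\<^sup>2\<close> (for small frequencies) and \<open>\<bar>b\<bar>\<close> (for large ones) are used for it.\<close>

lemma one_minus_exp_cos_le:
  fixes a b :: real
  assumes a: "0 \<le> a" and e: "1 - cos b \<le> e"
  shows "1 - exp (- a) * cos b \<le> a + e"
proof -
  have "1 - exp (- a) * cos b = (1 - exp (- a)) + exp (- a) * (1 - cos b)" by (simp add: algebra_simps)
  also have "\<dots> \<le> a + 1 * (1 - cos b)"
  proof (intro add_mono mult_right_mono)
    show "1 - exp (- a) \<le> a" using exp_ge_add_one_self[of "- a"] by linarith
  qed (use a in auto)
  also have "\<dots> \<le> a + e" using e by simp
  finally show ?thesis .
qed

lemma abs_integral_le:
  fixes f g :: "'a \<Rightarrow> real"
  assumes f: "integrable M f" and g: "integrable M g" and le: "\<And>x. \<bar>f x\<bar> \<le> g x"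
  shows "\<bar>\<integral>x. f x \<partial>M\<bar> \<le> (\<integral>x. g x \<partial>M)"
proof -
  have "(\<integral>x. f x \<partial>M) \<le> (\<integral>x. g x \<partial>M)"
    using f g le by (intro integral_mono) (auto simp: abs_le_iff)
  moreover have "(\<integral>x. - f x \<partial>M) \<le> (\<integral>x. g x \<partial>M)"
    using f g le by (intro integral_mono) (auto simp: abs_le_iff)
  ultimately show ?thesis by (simp add: abs_le_iff)
qed

text \<open>The three combinations are the integrands of \<open>A v + \<bar>B v\<bar>\<close> for \<open>\<beta> > 1\<close>, \<open>\<beta> < 1\<close> and \<open>\<beta> = 1\<close>.
  In each case the two exponents on the right lie strictly on both sides of \<open>\<beta>\<close> when \<open>0 < \<beta> < 2\<close>, which
  makes the integral against \<open>x powr (- \<beta> - 1)\<close> converge at zero and at infinity.\<close>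

lemma kernel_bounds:
  fixes z :: real
  assumes z: "z > 0"
  shows "1 - cos z + \<bar>sin z - z\<bar> \<le> 4 * min (z powr 1) (z powr 2)"
    and "1 - cos z + \<bar>sin z\<bar> \<le> 4 * min (z powr 0) (z powr 1)"
    and "1 - cos z \<le> 4 * min (z powr 0) (z powr 2)"
proof -
  have s: "\<bar>sin z\<bar> \<le> z" "\<bar>sin z\<bar> \<le> 1" using abs_sin_x_le_abs_x[of z] z by auto
  have c: "1 - cos z \<le> z" "1 - cos z \<le> z\<^sup>2 / 2" "1 - cos z \<le> 2"
  proof -
    show "1 - cos z \<le> z" using one_minus_cos_le_abs[of z] z by simp
    show "1 - cos z \<le> z\<^sup>2 / 2" by (rule one_minus_cos_le)
    show "1 - cos z \<le> 2" using cos_ge_minus_one[of z] by linarith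
  qed
  have d: "\<bar>sin z - z\<bar> \<le> z\<^sup>2" "\<bar>sin z - z\<bar> \<le> 2 * z" using abs_sin_minus_le[of z] s z by auto
  have z2: "z powr 2 = z\<^sup>2" "z powr 1 = z" "z powr 0 = 1" using z by (auto simp: powr_numeral)
  have zz: "z\<^sup>2 \<ge> 0" by simp
  show "1 - cos z + \<bar>sin z - z\<bar> \<le> 4 * min (z powr 1) (z powr 2)"
  proof -
    have "1 - cos z + \<bar>sin z - z\<bar> \<le> 4 * z" using c(1) d(2) z by linarith
    moreover have "1 - cos z + \<bar>sin z - z\<bar> \<le> 4 * z\<^sup>2" using c(2) d(1) zz by linarith
    ultimately show ?thesis unfolding z2 by (simp add: min_def)
  qed
  show "1 - cos z + \<bar>sin z\<bar> \<le> 4 * min (z powr 0) (z powr 1)"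
  proof -
    have "1 - cos z + \<bar>sin z\<bar> \<le> 4 * z" using c(1) s(1) z by linarith
    moreover have "1 - cos z + \<bar>sin z\<bar> \<le> 4" using c(3) s(2) by linarith
    ultimately show ?thesis unfolding z2 by (simp add: min_def)
  qed
  show "1 - cos z \<le> 4 * min (z powr 0) (z powr 2)"
  proof -
    have "1 - cos z \<le> 4 * z\<^sup>2" using c(2) zz by linarith
    moreover have "1 - cos z \<le> 4" using c(3) by linarith
    ultimately show ?thesis unfolding z2 by (simp add: min_def)
  qed
qed

section \<open>From characteristic functions to moments of maxima\<close>

lemma (in prob_space) one_minus_Re_char:
  fixes Y :: "'a \<Rightarrow> real"
  assumes Y [measurable]: "random_variable borel Y"
  shows "ennreal (1 - Re (char (distr M borel Y) v)) = (\<integral>\<^sup>+\<omega>. ennreal (1 - cos (v * Y \<omega>)) \<partial>M)"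
proof -
  have bound: "\<bar>1 - cos x\<bar> \<le> 2" for x :: real
    using cos_ge_minus_one[of x] cos_le_one[of x] by linarith
  have int: "integrable M (\<lambda>\<omega>. iexp (v * Y \<omega>))"
    by (intro integrable_const_bound[where B = 1]) auto
  have "char (distr M borel Y) v = (\<integral>\<omega>. iexp (v * Y \<omega>) \<partial>M)"
    by (simp add: char_def integral_distr)
  then have "Re (char (distr M borel Y) v) = (\<integral>\<omega>. Re (iexp (v * Y \<omega>)) \<partial>M)"
    using int by simp
  then have "1 - Re (char (distr M borel Y) v) = (\<integral>\<omega>. 1 - cos (v * Y \<omega>) \<partial>M)"
    using integrable_Re[OF int] by (simp add: Re_exp prob_space)
  moreover have "(\<integral>\<^sup>+\<omega>. ennreal (1 - cos (v * Y \<omega>)) \<partial>M) = ennreal (\<integral>\<omega>. 1 - cos (v * Y \<omega>) \<partial>M)"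
    by (intro nn_integral_eq_integral integrable_const_bound[where B = 2]) (auto simp: bound)
  ultimately show ?thesis by simp
qed

text \<open>By Tonelli the integral on the right is the expectation of
  \<open>\<integral> 1 - cos (v Y) dv = u - sin (u Y) / Y\<close> over \<open>(0, u]\<close> with \<open>u = 2 / r\<close>, and this is at least \<open>u / 2 = 1 / r\<close>
  wherever \<open>\<bar>Y\<bar> \<ge> r\<close>.\<close>

lemma (in prob_space) tail_le_char_integral:
  fixes Y :: "'a \<Rightarrow> real"
  assumes Y [measurable]: "random_variable borel Y" and r: "r > 0"
  shows "emeasure M {\<omega> \<in> space M. r \<le> \<bar>Y \<omega>\<bar>}
    \<le> ennreal r * (\<integral>\<^sup>+v\<in>{0<..2 / r}. ennreal (1 - Re (char (distr M borel Y) v)) \<partial>lborel)"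
proof -
  note char = one_minus_Re_char[OF Y]
  have inner: "ennreal (1 / r) \<le> (\<integral>\<^sup>+v\<in>{0<..2 / r}. ennreal (1 - cos (v * y)) \<partial>lborel)" if y: "r \<le> \<bar>y\<bar>" for y
  proof -
    have y0: "y \<noteq> 0" using y r by auto
    have "(\<integral>\<^sup>+v. ennreal (1 - cos (v * y)) * indicator {0..2 / r} v \<partial>lborel)
       = (2 / r - sin (2 / r * y) / y) - (0 - sin (0 * y) / y)"
      using r y0
      by (intro nn_integral_FTC_Icc[where F = "\<lambda>v. v - sin (v * y) / y"])
         (auto intro!: derivative_eq_intros)
    moreover have "(\<integral>\<^sup>+v. ennreal (1 - cos (v * y)) * indicator {0..2 / r} v \<partial>lborel)
        = (\<integral>\<^sup>+v. ennreal (1 - cos (v * y)) * indicator {0<..2 / r} v \<partial>lborel)"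
      by (intro nn_integral_cong) (auto simp: indicator_def)
    moreover have "sin (2 / r * y) / y \<le> 1 / r"
    proof -
      have "sin (2 / r * y) / y \<le> \<bar>sin (2 / r * y)\<bar> / \<bar>y\<bar>"
        by (metis abs_divide abs_ge_self)
      also have "\<dots> \<le> 1 / r" using r y by (intro frac_le) auto
      finally show ?thesis .
    qed
    ultimately show ?thesis by (auto intro!: ennreal_leI simp: field_simps)
  qed
  interpret L: pair_sigma_finite M lborel ..
  have "emeasure M {\<omega> \<in> space M. r \<le> \<bar>Y \<omega>\<bar>}
      = (\<integral>\<^sup>+\<omega>. indicator {\<omega> \<in> space M. r \<le> \<bar>Y \<omega>\<bar>} \<omega> \<partial>M)" by simp
  also have "\<dots> \<le> (\<integral>\<^sup>+\<omega>. ennreal r * (\<integral>\<^sup>+v\<in>{0<..2 / r}. ennreal (1 - cos (v * Y \<omega>)) \<partial>lborel) \<partial>M)"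
  proof (intro nn_integral_mono)
    fix \<omega> show "indicator {\<omega> \<in> space M. r \<le> \<bar>Y \<omega>\<bar>} \<omega>
        \<le> ennreal r * (\<integral>\<^sup>+v\<in>{0<..2 / r}. ennreal (1 - cos (v * Y \<omega>)) \<partial>lborel)"
    proof (cases "r \<le> \<bar>Y \<omega>\<bar>")
      case True
      have "1 = ennreal r * ennreal (1 / r)" using r by (simp flip: ennreal_mult)
      also have "\<dots> \<le> ennreal r * (\<integral>\<^sup>+v\<in>{0<..2 / r}. ennreal (1 - cos (v * Y \<omega>)) \<partial>lborel)"
        by (intro mult_left_mono inner True) auto
      finally show ?thesis by (auto simp: indicator_def)
    qed (auto simp: indicator_def)
  qed
  also have "\<dots> = ennreal r * (\<integral>\<^sup>+\<omega>. (\<integral>\<^sup>+v\<in>{0<..2 / r}. ennreal (1 - cos (v * Y \<omega>)) \<partial>lborel) \<partial>M)"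
    by (intro nn_integral_cmult) measurable
  also have "(\<integral>\<^sup>+\<omega>. (\<integral>\<^sup>+v\<in>{0<..2 / r}. ennreal (1 - cos (v * Y \<omega>)) \<partial>lborel) \<partial>M)
     = (\<integral>\<^sup>+v. (\<integral>\<^sup>+\<omega>. ennreal (1 - cos (v * Y \<omega>)) * indicator {0<..2 / r} v \<partial>M) \<partial>lborel)"
    by (intro L.Fubini'[symmetric]) measurable
  also have "\<dots> = (\<integral>\<^sup>+v\<in>{0<..2 / r}. ennreal (1 - Re (char (distr M borel Y) v)) \<partial>lborel)"
    by (intro nn_integral_cong) (simp add: char nn_integral_multc)
  finally show ?thesis .
qed

lemma first_passage_measurable:
  fixes f :: "nat \<Rightarrow> 'a \<Rightarrow> real"
  assumes f: "\<And>j. j \<le> k \<Longrightarrow> f j \<in> borel_measurable M"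
  shows "{x \<in> space M. r \<le> \<bar>f k x\<bar> \<and> (\<forall>j\<in>{..<k}. \<bar>f j x\<bar> < r)} \<in> sets M"
proof -
  have "(\<lambda>x. \<bar>f j x\<bar>) \<in> borel_measurable M" if "j \<le> k" for j
    using f[OF that] by measurable
  then show ?thesis
    by (intro sets.sets_Collect_conj sets.sets_Collect_finite_All borel_measurable_le borel_measurable_less) auto
qed

text \<open>Etemadi's maximal inequality. Let \<open>k\<close> be the first index at which the partial sum reaches
  \<open>3 r\<close>. Either the full sum has size at least \<open>r\<close>, or the remaining block from \<open>k\<close> to \<open>N\<close> has size at
  least \<open>2 r\<close>. The first passage at \<open>k\<close> is independent of that block, and the first passage events are
  disjoint, so both alternatives have probability at most \<open>H\<close>.\<close>

lemma (in prob_space) etemadi: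
  fixes Y :: "nat \<Rightarrow> 'a \<Rightarrow> real"
  assumes ind: "indep_vars (\<lambda>_. borel) Y {..<N}"
    and tail: "\<And>j k. j \<le> k \<Longrightarrow> k \<le> N \<Longrightarrow>
       emeasure M {\<omega> \<in> space M. r \<le> \<bar>\<Sum>i\<in>{j..<k}. Y i \<omega>\<bar>} \<le> H"
    and r: "r \<ge> 0"
  shows "emeasure M {\<omega> \<in> space M. \<exists>k\<in>{..N}. 3 * r \<le> \<bar>\<Sum>i<k. Y i \<omega>\<bar>} \<le> 2 * H"
proof -
  have Y [measurable]: "i < N \<Longrightarrow> random_variable borel (Y i)" for i
    using ind by (auto simp: indep_vars_def)
  define A where "A k = {\<omega> \<in> space M. 3 * r \<le> \<bar>\<Sum>i<k. Y i \<omega>\<bar> \<and> (\<forall>j\<in>{..<k}. \<bar>\<Sum>i<j. Y i \<omega>\<bar> < 3 * r)}" for k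
  define D where "D k = {\<omega> \<in> space M. r \<le> \<bar>\<Sum>i\<in>{k..<N}. Y i \<omega>\<bar>}" for k
  have A_meas [measurable]: "A k \<in> sets M" if "k \<le> N" for k
    unfolding A_def
    by (rule first_passage_measurable, rule borel_measurable_sum) (use that in auto)
  have D_meas [measurable]: "D k \<in> sets M" for k
  proof -
    have [measurable]: "(\<lambda>\<omega>. \<Sum>i\<in>{k..<N}. Y i \<omega>) \<in> borel_measurable M"
      by (intro borel_measurable_sum) auto
    show ?thesis unfolding D_def by measurable
  qed
  have indep: "emeasure M (A k \<inter> D k) = emeasure M (A k) * emeasure M (D k)" if k: "k \<le> N" for k
  proof -
    let ?P = "\<lambda>B. PiM B (\<lambda>_. borel) :: (nat \<Rightarrow> real) measure"
    define Xa where "Xa = {x \<in> space (?P {..<k}). 3 * r \<le> \<bar>\<Sum>i<k. x i\<bar> \<and> (\<forall>j\<in>{..<k}. \<bar>\<Sum>i<j. x i\<bar> < 3 * r)}"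
    define Xb where "Xb = {x \<in> space (?P {k..<N}). r \<le> \<bar>\<Sum>i\<in>{k..<N}. x i\<bar>}"
    have comp: "(\<lambda>x. x i) \<in> borel_measurable (?P B)" if "i \<in> B" for i B
      using that by (rule measurable_component_singleton)
    have Xa: "Xa \<in> sets (?P {..<k})"
      unfolding Xa_def
      by (rule first_passage_measurable, rule borel_measurable_sum) (auto intro: comp)
    have Xb: "Xb \<in> sets (?P {k..<N})"
    proof -
      have [measurable]: "(\<lambda>x. \<Sum>i\<in>{k..<N}. x i) \<in> borel_measurable (?P {k..<N})"
        by (intro borel_measurable_sum comp)
      show ?thesis unfolding Xb_def by measurable
    qed
    have iv: "indep_var (?P {..<k}) (\<lambda>\<omega>. restrict (\<lambda>i. Y i \<omega>) {..<k})
                (?P {k..<N}) (\<lambda>\<omega>. restrict (\<lambda>i. Y i \<omega>) {k..<N})"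
      by (rule indep_var_restrict[OF ind]) (use k in auto)
    have "prob ((\<lambda>\<omega>. (restrict (\<lambda>i. Y i \<omega>) {..<k}, restrict (\<lambda>i. Y i \<omega>) {k..<N})) -` (Xa \<times> Xb) \<inter> space M)
      = prob ((\<lambda>\<omega>. restrict (\<lambda>i. Y i \<omega>) {..<k}) -` Xa \<inter> space M)
        * prob ((\<lambda>\<omega>. restrict (\<lambda>i. Y i \<omega>) {k..<N}) -` Xb \<inter> space M)"
      by (rule indep_varD[OF iv Xa Xb])
    moreover have a: "(\<lambda>\<omega>. restrict (\<lambda>i. Y i \<omega>) {..<k}) -` Xa \<inter> space M = A k"
      unfolding Xa_def A_def by (auto simp: space_PiM)
    moreover have b: "(\<lambda>\<omega>. restrict (\<lambda>i. Y i \<omega>) {k..<N}) -` Xb \<inter> space M = D k"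
      unfolding Xb_def D_def by (auto simp: space_PiM)
    moreover have "(\<lambda>\<omega>. (restrict (\<lambda>i. Y i \<omega>) {..<k}, restrict (\<lambda>i. Y i \<omega>) {k..<N})) -` (Xa \<times> Xb) \<inter> space M = A k \<inter> D k"
      using a b by auto
    ultimately show ?thesis
      by (simp add: emeasure_eq_measure ennreal_mult)
  qed
  have sub: "{\<omega> \<in> space M. \<exists>k\<in>{..N}. 3 * r \<le> \<bar>\<Sum>i<k. Y i \<omega>\<bar>} \<subseteq> D 0 \<union> (\<Union>k\<in>{..N}. A k \<inter> D k)"
  proof
    fix \<omega> assume "\<omega> \<in> {\<omega> \<in> space M. \<exists>k\<in>{..N}. 3 * r \<le> \<bar>\<Sum>i<k. Y i \<omega>\<bar>}"
    then have sp: "\<omega> \<in> space M" and ex: "\<exists>k. k \<le> N \<and> 3 * r \<le> \<bar>\<Sum>i<k. Y i \<omega>\<bar>" by auto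
    define k where "k = (LEAST k. k \<le> N \<and> 3 * r \<le> \<bar>\<Sum>i<k. Y i \<omega>\<bar>)"
    have k: "k \<le> N" "3 * r \<le> \<bar>\<Sum>i<k. Y i \<omega>\<bar>"
      using LeastI_ex[OF ex] by (auto simp: k_def)
    have "\<bar>\<Sum>i<j. Y i \<omega>\<bar> < 3 * r" if "j < k" for j
      using not_less_Least[of j "\<lambda>k. k \<le> N \<and> 3 * r \<le> \<bar>\<Sum>i<k. Y i \<omega>\<bar>"] that k(1) by (auto simp: k_def)
    then have Ak: "\<omega> \<in> A k" using sp k by (auto simp: A_def)
    \<comment> \<open>If the full sum is smaller than \<open>r\<close>, the block after \<open>k\<close> must exceed \<open>2 r\<close>.\<close>
    have split: "(\<Sum>i\<in>{0..<N}. Y i \<omega>) = (\<Sum>i<k. Y i \<omega>) + (\<Sum>i\<in>{k..<N}. Y i \<omega>)"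
      using sum.atLeastLessThan_concat[of 0 k N "\<lambda>i. Y i \<omega>"] k(1) by (simp add: atLeast0LessThan)
    show "\<omega> \<in> D 0 \<union> (\<Union>k\<in>{..N}. A k \<inter> D k)"
    proof (cases "r \<le> \<bar>\<Sum>i\<in>{0..<N}. Y i \<omega>\<bar>")
      case False
      then have "r \<le> \<bar>\<Sum>i\<in>{k..<N}. Y i \<omega>\<bar>" using split k r by linarith
      then show ?thesis using Ak sp k by (auto simp: D_def)
    qed (use sp in \<open>auto simp: D_def\<close>)
  qed
  have disj: "disjoint_family_on A {..N}"
  proof -
    have "A i \<inter> A j = {}" if "i < j" for i j
    proof (rule equals0I)
      fix \<omega> assume "\<omega> \<in> A i \<inter> A j"
      then have "3 * r \<le> \<bar>\<Sum>i<i. Y i \<omega>\<bar>" and "\<forall>j\<in>{..<j}. \<bar>\<Sum>i<j. Y i \<omega>\<bar> < 3 * r"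
        by (simp_all add: A_def)
      with that show False by (meson lessThan_iff not_less)
    qed
    then show ?thesis
      unfolding disjoint_family_on_def by (metis Int_commute linorder_neqE_nat)
  qed
  have "emeasure M {\<omega> \<in> space M. \<exists>k\<in>{..N}. 3 * r \<le> \<bar>\<Sum>i<k. Y i \<omega>\<bar>}
      \<le> emeasure M (D 0 \<union> (\<Union>k\<in>{..N}. A k \<inter> D k))"
    by (rule emeasure_mono[OF sub]) (auto intro!: sets.Un sets.finite_UN)
  also have "\<dots> \<le> emeasure M (D 0) + emeasure M (\<Union>k\<in>{..N}. A k \<inter> D k)"
    by (intro emeasure_subadditive) auto
  also have "emeasure M (\<Union>k\<in>{..N}. A k \<inter> D k) \<le> (\<Sum>k\<le>N. emeasure M (A k \<inter> D k))"
    by (intro emeasure_subadditive_finite) auto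
  also have "(\<Sum>k\<le>N. emeasure M (A k \<inter> D k)) \<le> (\<Sum>k\<le>N. emeasure M (A k) * H)"
  proof (intro sum_mono)
    fix k assume "k \<in> {..N}"
    then have "emeasure M (D k) \<le> H" unfolding D_def by (intro tail) auto
    then show "emeasure M (A k \<inter> D k) \<le> emeasure M (A k) * H"
      using \<open>k \<in> {..N}\<close> by (simp add: indep mult_left_mono)
  qed
  also have "\<dots> = emeasure M (\<Union>k\<in>{..N}. A k) * H"
    using disj by (subst sum_emeasure[symmetric]) (auto simp: sum_distrib_right)
  also have "\<dots> \<le> 1 * H"
    by (intro mult_right_mono emeasure_le_1) auto
  also have "emeasure M (D 0) \<le> H" unfolding D_def by (rule tail) auto
  finally show ?thesis by (simp add: mult_2 add_mono)
qed

definition max_moment_const :: "real \<Rightarrow> real" where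
  "max_moment_const p = 4 * p * 6 powr p / (p + 1)"

text \<open>The layer cake formula turns the moment into an integral of \<open>p r powr (p - 1)\<close> times the tail of
  the maximum. Inserting \<open>etemadi\<close> and \<open>tail_le_char_integral\<close> at level \<open>r / 3\<close> leaves a double integral
  over \<open>v * r \<le> 6\<close>; carrying out the integral over \<open>r\<close> first produces the weight
  \<open>v powr (-1 - p)\<close> and the constant \<open>max_moment_const p\<close>.\<close>

lemma (in prob_space) max_moment_le:
  fixes Y :: "nat \<Rightarrow> 'a \<Rightarrow> real" and G :: "real \<Rightarrow> ennreal"
  assumes ind: "indep_vars (\<lambda>_. borel) Y {..<N}"
    and G [measurable]: "G \<in> borel_measurable borel"
    and char: "\<And>j k v. j \<le> k \<Longrightarrow> k \<le> N \<Longrightarrow> v > 0 \<Longrightarrow>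
      ennreal (1 - Re (char (distr M borel (\<lambda>\<omega>. \<Sum>i\<in>{j..<k}. Y i \<omega>)) v)) \<le> G v"
    and p: "p > 0"
  shows "(\<integral>\<^sup>+\<omega>. (SUP k\<in>{..N}. ennreal (\<bar>\<Sum>i<k. Y i \<omega>\<bar> powr p)) \<partial>M)
    \<le> ennreal (max_moment_const p) * (\<integral>\<^sup>+v\<in>{0<..}. ennreal (v powr (-1 - p)) * G v \<partial>lborel)"
proof -
  interpret L: pair_sigma_finite M lborel ..
  have Y: "i < N \<Longrightarrow> random_variable borel (Y i)" for i
    using ind by (auto simp: indep_vars_def)
  define T where "T k \<omega> = (if k \<le> N then \<bar>\<Sum>i<k. Y i \<omega>\<bar> else 0)" for k \<omega>
  have T [measurable]: "T k \<in> borel_measurable M" for k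
  proof (cases "k \<le> N")
    case True
    then have [measurable]: "(\<lambda>\<omega>. \<Sum>i<k. Y i \<omega>) \<in> borel_measurable M"
      by (intro borel_measurable_sum Y) auto
    show ?thesis using True by (simp add: T_def[abs_def])
  qed (simp add: T_def[abs_def])
  define g where "g r = ennreal (p * r powr (p - 1))" for r :: real
  have [measurable]: "g \<in> borel_measurable borel" by (simp add: g_def[abs_def])
  define J where "J r = (\<integral>\<^sup>+v\<in>{0<..6 / r}. G v \<partial>lborel)" for r :: real
  have block: "random_variable borel (\<lambda>\<omega>. \<Sum>i\<in>{j..<k}. Y i \<omega>)" if "k \<le> N" for j k
    using that by (intro borel_measurable_sum Y) auto
  have layer: "(SUP k\<in>{..N}. ennreal (\<bar>\<Sum>i<k. Y i \<omega>\<bar> powr p))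
      \<le> (\<integral>\<^sup>+r\<in>{0<..}. g r * indicator {x. \<exists>k\<in>{..N}. x \<le> T k \<omega>} r \<partial>lborel)" for \<omega>
  proof (rule SUP_least)
    fix k assume k: "k \<in> {..N}"
    have "ennreal (\<bar>\<Sum>i<k. Y i \<omega>\<bar> powr p) = ennreal p * ennreal (T k \<omega> powr p / p)"
      using p k by (simp add: T_def flip: ennreal_mult)
    also have "\<dots> = ennreal p * (\<integral>\<^sup>+r\<in>{0<..T k \<omega>}. ennreal (r powr (p - 1)) \<partial>lborel)"
      using p by (subst nn_integral_powr_Ioc) (auto simp: T_def)
    also have "\<dots> = (\<integral>\<^sup>+r\<in>{0<..T k \<omega>}. g r \<partial>lborel)"
      using p by (subst nn_integral_cmult[symmetric]) (auto simp: g_def ennreal_mult mult.assoc)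
    also have "\<dots> \<le> (\<integral>\<^sup>+r\<in>{0<..}. g r * indicator {x. \<exists>k\<in>{..N}. x \<le> T k \<omega>} r \<partial>lborel)"
      using k by (intro nn_integral_mono) (auto simp: indicator_def)
    finally show "ennreal (\<bar>\<Sum>i<k. Y i \<omega>\<bar> powr p)
       \<le> (\<integral>\<^sup>+r\<in>{0<..}. g r * indicator {x. \<exists>k\<in>{..N}. x \<le> T k \<omega>} r \<partial>lborel)" .
  qed
  have tail: "emeasure M {\<omega> \<in> space M. \<exists>k\<in>{..N}. r \<le> T k \<omega>} \<le> ennreal (2 * r / 3) * J r"
    if r: "r > 0" for r
  proof -
    have "{\<omega> \<in> space M. \<exists>k\<in>{..N}. r \<le> T k \<omega>}
       = {\<omega> \<in> space M. \<exists>k\<in>{..N}. 3 * (r / 3) \<le> \<bar>\<Sum>i<k. Y i \<omega>\<bar>}"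
      by (auto simp: T_def)
    also have "emeasure M \<dots> \<le> 2 * (ennreal (r / 3) * J r)"
    proof (rule etemadi[OF ind])
      fix j k assume jk: "j \<le> k" "k \<le> N"
      have "emeasure M {\<omega> \<in> space M. r / 3 \<le> \<bar>\<Sum>i\<in>{j..<k}. Y i \<omega>\<bar>}
         \<le> ennreal (r / 3) * (\<integral>\<^sup>+v\<in>{0<..2 / (r / 3)}.
              ennreal (1 - Re (char (distr M borel (\<lambda>\<omega>. \<Sum>i\<in>{j..<k}. Y i \<omega>)) v)) \<partial>lborel)"
        using r jk by (intro tail_le_char_integral block) auto
      also have "\<dots> \<le> ennreal (r / 3) * J r"
        unfolding J_def using jk
        by (intro mult_left_mono nn_integral_mono) (auto simp: indicator_def intro!: char)
      finally show "emeasure M {\<omega> \<in> space M. r / 3 \<le> \<bar>\<Sum>i\<in>{j..<k}. Y i \<omega>\<bar>} \<le> ennreal (r / 3) * J r" .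
    qed (use r in auto)
    also have "\<dots> = ennreal (2 * r / 3) * J r"
    proof -
      have "ennreal (2 * r / 3) = 2 * ennreal (r / 3)"
        using ennreal_mult[of 2 "r / 3"] r by simp
      then show ?thesis by (simp add: mult.assoc)
    qed
    finally show ?thesis .
  qed
  have "(\<integral>\<^sup>+\<omega>. (SUP k\<in>{..N}. ennreal (\<bar>\<Sum>i<k. Y i \<omega>\<bar> powr p)) \<partial>M)
     \<le> (\<integral>\<^sup>+\<omega>. (\<integral>\<^sup>+r\<in>{0<..}. g r * indicator {x. \<exists>k\<in>{..N}. x \<le> T k \<omega>} r \<partial>lborel) \<partial>M)"
    by (intro nn_integral_mono layer)
  also have "\<dots> = (\<integral>\<^sup>+r. (\<integral>\<^sup>+\<omega>. g r * indicator {x. \<exists>k\<in>{..N}. x \<le> T k \<omega>} r * indicator {0<..} r \<partial>M) \<partial>lborel)"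
  proof (intro L.Fubini'[symmetric])
    have [measurable]: "(\<lambda>z. indicator {x. \<exists>k\<in>{..N}. x \<le> T k (fst z)} (snd z) :: ennreal)
        \<in> borel_measurable (M \<Otimes>\<^sub>M lborel)"
    proof -
      have "{z \<in> space (M \<Otimes>\<^sub>M lborel). \<exists>k\<in>{..N}. snd z \<le> T k (fst z)} \<in> sets (M \<Otimes>\<^sub>M lborel)"
        by (intro sets.sets_Collect_finite_Ex) measurable
      then have "(indicator {z \<in> space (M \<Otimes>\<^sub>M lborel). \<exists>k\<in>{..N}. snd z \<le> T k (fst z)} :: _ \<Rightarrow> ennreal)
        \<in> borel_measurable (M \<Otimes>\<^sub>M lborel)" by simp
      then show ?thesis
        by (rule measurable_cong[THEN iffD1, rotated]) (auto simp: indicator_def)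
    qed
    show "(\<lambda>(x, y). g y * indicator {xa. \<exists>k\<in>{..N}. xa \<le> T k x} y * indicator {0<..} y)
      \<in> borel_measurable (M \<Otimes>\<^sub>M lborel)"
      unfolding case_prod_beta by measurable
  qed
  also have "\<dots> = (\<integral>\<^sup>+r\<in>{0<..}. g r * emeasure M {\<omega> \<in> space M. \<exists>k\<in>{..N}. r \<le> T k \<omega>} \<partial>lborel)"
  proof (intro nn_integral_cong)
    fix r :: real
    have meas: "{\<omega> \<in> space M. \<exists>k\<in>{..N}. r \<le> T k \<omega>} \<in> sets M"
      by (intro sets.sets_Collect_finite_Ex) measurable
    have "(\<integral>\<^sup>+\<omega>. g r * indicator {x. \<exists>k\<in>{..N}. x \<le> T k \<omega>} r * indicator {0<..} r \<partial>M)
       = (\<integral>\<^sup>+\<omega>. (g r * indicator {0<..} r) * indicator {\<omega> \<in> space M. \<exists>k\<in>{..N}. r \<le> T k \<omega>} \<omega> \<partial>M)"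
      by (intro nn_integral_cong) (auto simp: indicator_def)
    also have "\<dots> = (g r * indicator {0<..} r) * emeasure M {\<omega> \<in> space M. \<exists>k\<in>{..N}. r \<le> T k \<omega>}"
      using meas by (rule nn_integral_cmult_indicator)
    finally show "(\<integral>\<^sup>+\<omega>. g r * indicator {x. \<exists>k\<in>{..N}. x \<le> T k \<omega>} r * indicator {0<..} r \<partial>M)
       = g r * emeasure M {\<omega> \<in> space M. \<exists>k\<in>{..N}. r \<le> T k \<omega>} * indicator {0<..} r"
      by (simp add: ac_simps)
  qed
  also have "\<dots> \<le> (\<integral>\<^sup>+r\<in>{0<..}. g r * (ennreal (2 * r / 3) * J r) \<partial>lborel)"
    by (intro nn_integral_mono) (auto simp: indicator_def intro!: mult_left_mono tail)
  also have "\<dots> = (\<integral>\<^sup>+r. (\<integral>\<^sup>+v. ennreal (2 * p / 3 * r powr p) * G v * indicator {v. 0 < v \<and> v * r \<le> 6 \<and> 0 < r} v \<partial>lborel) \<partial>lborel)"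
  proof (intro nn_integral_cong)
    fix r :: real
    show "g r * (ennreal (2 * r / 3) * J r) * indicator {0<..} r
      = (\<integral>\<^sup>+v. ennreal (2 * p / 3 * r powr p) * G v * indicator {v. 0 < v \<and> v * r \<le> 6 \<and> 0 < r} v \<partial>lborel)"
    proof (cases "r > 0")
      case True
      have gr: "g r * ennreal (2 * r / 3) = ennreal (2 * p / 3 * r powr p)"
        using True p unfolding g_def
        by (subst ennreal_mult[symmetric]) (auto simp: powr_diff field_simps)
      have "(\<integral>\<^sup>+v. ennreal (2 * p / 3 * r powr p) * G v * indicator {v. 0 < v \<and> v * r \<le> 6 \<and> 0 < r} v \<partial>lborel)
        = (\<integral>\<^sup>+v. ennreal (2 * p / 3 * r powr p) * (G v * indicator {0<..6 / r} v) \<partial>lborel)"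
        using True by (intro nn_integral_cong) (auto simp: indicator_def field_simps)
      also have "\<dots> = ennreal (2 * p / 3 * r powr p) * J r"
        unfolding J_def by (intro nn_integral_cmult) measurable
      finally show ?thesis using True gr by (simp add: mult.assoc[symmetric])
    qed simp
  qed
  also have "\<dots> = (\<integral>\<^sup>+v. (\<integral>\<^sup>+r. ennreal (2 * p / 3 * r powr p) * G v * indicator {v. 0 < v \<and> v * r \<le> 6 \<and> 0 < r} v \<partial>lborel) \<partial>lborel)"
  proof (intro lborel_pair.Fubini')
    have "{z \<in> space (lborel \<Otimes>\<^sub>M lborel). 0 < fst z \<and> fst z * snd z \<le> 6 \<and> 0 < snd z} \<in> sets (lborel \<Otimes>\<^sub>M lborel :: (real \<times> real) measure)"
      by measurable
    then have "(indicator {z. 0 < fst z \<and> fst z * snd z \<le> 6 \<and> 0 < snd z} :: real \<times> real \<Rightarrow> ennreal)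
        \<in> borel_measurable (lborel \<Otimes>\<^sub>M lborel)" by (simp add: space_pair_measure)
    then have [measurable]: "(\<lambda>z :: real \<times> real. indicator {v. 0 < v \<and> v * snd z \<le> 6 \<and> 0 < snd z} (fst z) :: ennreal)
        \<in> borel_measurable (lborel \<Otimes>\<^sub>M lborel)"
      by (rule measurable_cong[THEN iffD1, rotated]) (auto simp: indicator_def)
    show "(\<lambda>(x, y). ennreal (2 * p / 3 * y powr p) * G x * indicator {v. 0 < v \<and> v * y \<le> 6 \<and> 0 < y} x)
        \<in> borel_measurable (lborel \<Otimes>\<^sub>M lborel)"
      unfolding case_prod_beta by measurable
  qed
  also have "\<dots> = (\<integral>\<^sup>+v. ennreal (max_moment_const p) * (ennreal (v powr (-1 - p)) * G v * indicator {0<..} v) \<partial>lborel)"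
  proof (intro nn_integral_cong)
    fix v :: real
    show "(\<integral>\<^sup>+r. ennreal (2 * p / 3 * r powr p) * G v * indicator {v. 0 < v \<and> v * r \<le> 6 \<and> 0 < r} v \<partial>lborel)
      = ennreal (max_moment_const p) * (ennreal (v powr (-1 - p)) * G v * indicator {0<..} v)"
    proof (cases "v > 0")
      case True
      have "(\<integral>\<^sup>+r. ennreal (2 * p / 3 * r powr p) * G v * indicator {v. 0 < v \<and> v * r \<le> 6 \<and> 0 < r} v \<partial>lborel)
        = (\<integral>\<^sup>+r. (ennreal (2 * p / 3) * G v) * (ennreal (r powr (p + 1 - 1)) * indicator {0<..6 / v} r) \<partial>lborel)"
        using True p by (intro nn_integral_cong) (auto simp: indicator_def field_simps ennreal_mult[symmetric] ac_simps)
      also have "\<dots> = (ennreal (2 * p / 3) * G v) * ennreal ((6 / v) powr (p + 1) / (p + 1))"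
        using True p by (subst nn_integral_cmult) (use nn_integral_powr_Ioc[of "p + 1" "6 / v"] in auto)
      also have "\<dots> = ennreal (2 * p / 3 * ((6 / v) powr (p + 1) / (p + 1))) * G v"
        using p by (subst ennreal_mult) (auto simp: ac_simps)
      also have "2 * p / 3 * ((6 / v) powr (p + 1) / (p + 1)) = max_moment_const p * v powr (-1 - p)"
        using True p unfolding max_moment_const_def
        by (simp add: powr_divide powr_add powr_diff powr_minus field_simps)
      also have "ennreal (max_moment_const p * v powr (-1 - p)) * G v
          = ennreal (max_moment_const p) * (ennreal (v powr (-1 - p)) * G v)"
        using p by (subst ennreal_mult) (auto simp: max_moment_const_def mult.assoc)
      finally show ?thesis
        using True by simp
    qed simp
  qed
  also have "\<dots> = ennreal (max_moment_const p) * (\<integral>\<^sup>+v\<in>{0<..}. ennreal (v powr (-1 - p)) * G v \<partial>lborel)"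
    by (intro nn_integral_cmult) measurable
  finally show ?thesis .
qed

section \<open>From maxima to suprema of Levy paths\<close>

text \<open>Every \<open>s < t\<close> is approached strictly from the right by the dyadic points
  \<open>k t / 2 ^ n\<close> with \<open>k = \<lfloor>s 2 ^ n / t\<rfloor> + 1\<close>; the end point \<open>t\<close> is itself a dyadic point.\<close>

lemma SUP_le_SUP_dyadic:
  fixes f :: "real \<Rightarrow> real"
  assumes p: "p > 0" and t: "t > 0"
    and f: "\<And>s. 0 \<le> s \<Longrightarrow> (f \<longlongrightarrow> f s) (at_right s)"
  shows "(SUP s\<in>{0..t}. ennreal (\<bar>f s\<bar> powr p))
    \<le> (SUP n. SUP k\<in>{..2 ^ n}. ennreal (\<bar>f (real k * t / 2 ^ n)\<bar> powr p))"
    (is "_ \<le> ?R")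
proof (rule SUP_least)
  have le: "ennreal (\<bar>f (real k * t / 2 ^ n)\<bar> powr p) \<le> ?R" if "k \<le> 2 ^ n" for k n
    using that by (intro SUP_upper2[of n] SUP_upper2[of k]) auto
  fix s assume s: "s \<in> {0..t}"
  show "ennreal (\<bar>f s\<bar> powr p) \<le> ?R"
  proof (cases "s = t")
    case True
    then show ?thesis using le[of 1 0] by simp
  next
    case False
    define k where "k n = nat \<lfloor>s * 2 ^ n / t\<rfloor> + 1" for n
    define u where "u n = real (k n) * t / 2 ^ n" for n
    have kr: "real (k n) = of_int \<lfloor>s * 2 ^ n / t\<rfloor> + 1" for n
      using s t by (simp add: k_def)
    have "k n \<le> 2 ^ n" for n
    proof -
      have "s * 2 ^ n / t < 2 ^ n" using s t False by (simp add: field_simps)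
      then have "\<lfloor>s * 2 ^ n / t\<rfloor> < 2 ^ n" by (simp add: floor_less_iff)
      then show ?thesis unfolding k_def using s t by (simp add: nat_less_iff Suc_le_eq)
    qed
    then have ule: "ennreal (\<bar>f (u n)\<bar> powr p) \<le> ?R" for n unfolding u_def by (rule le)
    have lower: "s < u n" for n
    proof -
      have "s * 2 ^ n / t < real (k n)" unfolding kr by linarith
      then show ?thesis using t by (simp add: u_def field_simps)
    qed
    have upper: "u n \<le> s + t * (1 / 2) ^ n" for n
    proof -
      have "real (k n) \<le> s * 2 ^ n / t + 1" unfolding kr by linarith
      then have "real (k n) * t \<le> (s * 2 ^ n / t + 1) * t" using t by (intro mult_right_mono) auto
      also have "\<dots> = s * 2 ^ n + t" using t by (simp add: field_simps)
      finally show ?thesis by (simp add: u_def field_simps)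
    qed
    have "(\<lambda>n. s + t * (1 / 2) ^ n) \<longlonglongrightarrow> s + t * 0"
      by (intro tendsto_intros LIMSEQ_realpow_zero) auto
    then have lim: "(\<lambda>n. s + t * (1 / 2) ^ n) \<longlonglongrightarrow> s" by simp
    have "\<forall>n. s \<le> u n" "\<forall>n. u n \<le> s + t * (1 / 2) ^ n"
      using lower upper by (auto intro: less_imp_le)
    then have "u \<longlonglongrightarrow> s"
      by (intro tendsto_sandwich[OF _ _ tendsto_const lim] always_eventually)
    moreover have "u n \<noteq> s" for n using lower[of n] by simp
    ultimately have "filterlim u (at_right s) sequentially"
      using lower by (auto simp: filterlim_at)
    then have "(\<lambda>n. f (u n)) \<longlonglongrightarrow> f s"
      using f[of s] s by (auto intro: filterlim_compose)
    then have "(\<lambda>n. \<bar>f (u n)\<bar> powr p) \<longlonglongrightarrow> \<bar>f s\<bar> powr p"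
      using p by (intro tendsto_powr2 tendsto_rabs) auto
    then have "(\<lambda>n. ennreal (\<bar>f (u n)\<bar> powr p)) \<longlonglongrightarrow> ennreal (\<bar>f s\<bar> powr p)"
      by (rule tendsto_ennrealI)
    then show ?thesis
      by (rule LIMSEQ_le_const2) (use ule in auto)
  qed
qed

lemma incseq_SUP_dyadic:
  fixes g :: "real \<Rightarrow> ennreal"
  shows "incseq (\<lambda>n. SUP k\<in>{..2 ^ n}. g (real k * t / 2 ^ n))"
proof (rule incseq_SucI, rule SUP_least)
  fix n k :: nat assume "k \<in> {..2 ^ n}"
  then show "g (real k * t / 2 ^ n) \<le> (SUP k\<in>{..2 ^ Suc n}. g (real k * t / 2 ^ Suc n))"
    by (intro SUP_upper2[of "2 * k"]) (auto simp: field_simps)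
qed

lemma distr_increment_drift:
  assumes levy: "levy_process M X" and "0 \<le> s" and "s \<le> u"
  shows "distr M borel (\<lambda>\<omega>. (X u \<omega> - u * d) - (X s \<omega> - s * d))
    = distr M borel (\<lambda>\<omega>. X (u - s) \<omega> - (u - s) * d)"
proof -
  have X [measurable]: "0 \<le> r \<Longrightarrow> X r \<in> borel_measurable M" for r
    using levy by (auto simp: levy_process_def)
  have [measurable]: "X u \<in> borel_measurable M" "X s \<in> borel_measurable M" "X (u - s) \<in> borel_measurable M"
    using assms by auto
  have "distr M borel (\<lambda>\<omega>. (X u \<omega> - u * d) - (X s \<omega> - s * d))
      = distr (distr M borel (\<lambda>\<omega>. X (s + (u - s)) \<omega> - X s \<omega>)) borel (\<lambda>x. x - (u - s) * d)"
    by (subst distr_distr) (auto simp: comp_def algebra_simps)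
  also have "distr M borel (\<lambda>\<omega>. X (s + (u - s)) \<omega> - X s \<omega>) = distr M borel (X (u - s))"
  proof -
    have "stationary_increments M X" using levy by (simp add: levy_process_def)
    then show ?thesis using assms(2,3) unfolding stationary_increments_def by (metis diff_ge_0_iff_ge)
  qed
  also have "distr (distr M borel (X (u - s))) borel (\<lambda>x. x - (u - s) * d)
      = distr M borel (\<lambda>\<omega>. X (u - s) \<omega> - (u - s) * d)"
    by (subst distr_distr) (auto simp: comp_def)
  finally show ?thesis .
qed

text \<open>The bound of \<open>max_moment_le\<close> does not depend on the number of increments, so it survives the
  passage from dyadic partitions to the whole interval by monotone convergence. By stationarity
  every block of increments has the law of a single \<open>X\<^sub>h - h d\<close> with \<open>h \<le> t\<close>.\<close>

lemma sup_moment_le_char_integral: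
  assumes levy: "levy_process M X" and p: "p > 0" and t: "t > 0"
    and G [measurable]: "G \<in> borel_measurable borel"
    and char: "\<And>h v. 0 \<le> h \<Longrightarrow> h \<le> t \<Longrightarrow> v > 0 \<Longrightarrow>
      ennreal (1 - Re (char (distr M borel (\<lambda>\<omega>. X h \<omega> - h * d)) v)) \<le> G v"
  shows "sup_moment M (\<lambda>s \<omega>. X s \<omega> - s * d) p t
    \<le> ennreal (max_moment_const p) * (\<integral>\<^sup>+v\<in>{0<..}. ennreal (v powr (-1 - p)) * G v \<partial>lborel)"
    (is "_ \<le> ?B")
proof -
  interpret prob_space M using levy by (simp add: levy_process_def)
  have X [measurable]: "0 \<le> s \<Longrightarrow> X s \<in> borel_measurable M" for s
    using levy by (auto simp: levy_process_def)
  define U where "U s \<omega> = X s \<omega> - s * d" for s \<omega>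
  define T where "T n k = real k * t / 2 ^ n" for n k :: nat
  have T0: "0 \<le> T n k" for n k using t by (simp add: T_def)
  have U [measurable]: "U (T n k) \<in> borel_measurable M" for n k
    unfolding U_def using T0[of n k] by measurable
  define F where "F n \<omega> = (SUP k\<in>{..2 ^ n}. ennreal (\<bar>U (T n k) \<omega>\<bar> powr p))" for n :: nat and \<omega>
  have [measurable]: "F n \<in> borel_measurable M" for n
    unfolding F_def by (intro borel_measurable_SUP) auto
  have X0: "AE \<omega> in M. X 0 \<omega> = 0" and cadlag: "AE \<omega> in M. cadlag (\<lambda>t. X t \<omega>)"
    using levy by (auto simp: levy_process_def)
  have "sup_moment M U p t \<le> (\<integral>\<^sup>+\<omega>. (SUP n. F n \<omega>) \<partial>M)"
    unfolding sup_moment_def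
  proof (rule nn_integral_mono_AE)
    show "AE \<omega> in M. (SUP s\<in>{0..t}. ennreal (\<bar>U s \<omega>\<bar> powr p)) \<le> (SUP n. F n \<omega>)"
      using cadlag
    proof eventually_elim
      case (elim \<omega>)
      have "((\<lambda>s. U s \<omega>) \<longlongrightarrow> U s \<omega>) (at_right s)" if "0 \<le> s" for s
        unfolding U_def using elim that by (intro tendsto_intros) (auto simp: cadlag_def)
      then show ?case
        unfolding F_def T_def by (rule SUP_le_SUP_dyadic[OF p t])
    qed
  qed
  also have "\<dots> = (SUP n. \<integral>\<^sup>+\<omega>. F n \<omega> \<partial>M)"
  proof (rule nn_integral_monotone_convergence_SUP)
    show "incseq F"
      using incseq_SUP_dyadic[of "\<lambda>s. ennreal (\<bar>U s \<omega>\<bar> powr p)" t for \<omega>]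
      by (auto simp: F_def T_def incseq_def le_fun_def)
  qed auto
  also have "\<dots> \<le> ?B"
  proof (rule SUP_least)
    fix n :: nat
    define Y where "Y i \<omega> = U (T n (Suc i)) \<omega> - U (T n i) \<omega>" for i \<omega>
    have tele: "(\<Sum>i\<in>{j..<k}. Y i \<omega>) = U (T n k) \<omega> - U (T n j) \<omega>" if "j \<le> k" for j k \<omega>
      unfolding Y_def using that by (rule sum_Suc_diff')
    have "(\<integral>\<^sup>+\<omega>. F n \<omega> \<partial>M) = (\<integral>\<^sup>+\<omega>. (SUP k\<in>{..2 ^ n}. ennreal (\<bar>\<Sum>i<k. Y i \<omega>\<bar> powr p)) \<partial>M)"
    proof (rule nn_integral_cong_AE)
      show "AE \<omega> in M. F n \<omega> = (SUP k\<in>{..2 ^ n}. ennreal (\<bar>\<Sum>i<k. Y i \<omega>\<bar> powr p))"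
        using X0
      proof eventually_elim
        case (elim \<omega>)
        have "(\<Sum>i<k. Y i \<omega>) = U (T n k) \<omega>" for k
          using tele[of 0 k \<omega>] elim by (simp add: atLeast0LessThan T_def U_def)
        then show ?case by (simp add: F_def)
      qed
    qed
    also have "\<dots> \<le> ?B"
    proof (rule max_moment_le)
      have "indep_vars (\<lambda>_. borel) (\<lambda>i \<omega>. X (T n (Suc i)) \<omega> - X (T n i) \<omega>) {..<2 ^ n}"
      proof -
        have "independent_increments M X" using levy by (simp add: levy_process_def)
        moreover have "T n i \<le> T n (Suc i)" for i
          using t by (simp add: T_def divide_right_mono mult_right_mono)
        ultimately show ?thesis
          using T0[of n 0] unfolding independent_increments_def by blast
      qed
      then have "indep_vars (\<lambda>_. borel) (\<lambda>i \<omega>. (X (T n (Suc i)) \<omega> - X (T n i) \<omega>) - (T n (Suc i) - T n i) * d) {..<2 ^ n}"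
        by (rule indep_vars_compose2[where Y = "\<lambda>i x. x - (T n (Suc i) - T n i) * d"]) auto
      moreover have "(\<lambda>i \<omega>. (X (T n (Suc i)) \<omega> - X (T n i) \<omega>) - (T n (Suc i) - T n i) * d) = Y"
        by (auto simp: fun_eq_iff Y_def U_def algebra_simps)
      ultimately show "indep_vars (\<lambda>_. borel) Y {..<2 ^ n}" by simp
    next
      fix j k :: nat and v :: real assume jk: "j \<le> k" "k \<le> 2 ^ n" and v: "v > 0"
      have "T n j \<le> T n k" using jk t by (simp add: T_def divide_right_mono mult_right_mono)
      moreover have "T n k \<le> t"
      proof -
        have "real k \<le> 2 ^ n" using jk(2) by (metis of_nat_le_iff of_nat_numeral of_nat_power)
        then show ?thesis using t by (simp add: T_def field_simps)
      qed
      moreover have "distr M borel (\<lambda>\<omega>. \<Sum>i\<in>{j..<k}. Y i \<omega>)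
         = distr M borel (\<lambda>\<omega>. X (T n k - T n j) \<omega> - (T n k - T n j) * d)"
        using distr_increment_drift[OF levy T0[of n j] \<open>T n j \<le> T n k\<close>, of d]
        by (simp add: tele[OF jk(1)] U_def)
      ultimately show "ennreal (1 - Re (Characteristic_Functions.char (distr M borel (\<lambda>\<omega>. \<Sum>i\<in>{j..<k}. Y i \<omega>)) v)) \<le> G v"
        using T0[of n j] v by (simp add: char)
    qed (use p in auto)
    finally show "(\<integral>\<^sup>+\<omega>. F n \<omega> \<partial>M) \<le> ?B" .
  qed
  finally show ?thesis by (simp add: U_def[abs_def])
qed

section \<open>Real and imaginary part of the characteristic exponent\<close>

lemma integrable_levy_bounded:
  fixes f :: "real \<Rightarrow> 'b::{banach, second_countable_topology}"
  assumes \<nu>: "levy_measure \<nu>" and f: "f \<in> borel_measurable borel"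
    and le: "\<And>x. norm (f x) \<le> K * min (x\<^sup>2) 1"
  shows "integrable \<nu> f"
proof -
  have sets: "sets \<nu> = sets borel" and fin: "(\<integral>\<^sup>+x. ennreal (min (x\<^sup>2) 1) \<partial>\<nu>) < \<infinity>"
    using \<nu> by (auto simp: levy_measure_def)
  have meas: "g \<in> borel_measurable \<nu> \<longleftrightarrow> g \<in> borel_measurable borel" for g :: "real \<Rightarrow> 'c::topological_space"
    by (simp add: measurable_cong_sets[OF sets refl])
  have "integrable \<nu> (\<lambda>x. min (x\<^sup>2) 1)"
    using fin by (intro integrableI_bounded) (auto simp: meas)
  then have "integrable \<nu> (\<lambda>x. K * min (x\<^sup>2) 1)" by simp
  then show ?thesis
  proof (rule Bochner_Integration.integrable_bound)
    show "AE x in \<nu>. norm (f x) \<le> norm (K * min (x\<^sup>2) 1)"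
      by (intro AE_I2 order_trans[OF le]) simp
  qed (use f in \<open>simp add: meas\<close>)
qed

lemma integrable_levy_min: "levy_measure \<nu> \<Longrightarrow> integrable \<nu> (\<lambda>x. min (x\<^sup>2) 1)"
  by (rule integrable_levy_bounded[where K = 1]) auto

definition levy_re :: "real measure \<Rightarrow> real \<Rightarrow> real" where
  "levy_re \<nu> v = (\<integral>x. 1 - cos (v * x) \<partial>\<nu>)"

text \<open>The imaginary part of the exponent of \<open>X\<^sub>t - t d\<close>.\<close>

definition levy_im :: "real \<Rightarrow> real \<Rightarrow> real measure \<Rightarrow> real \<Rightarrow> real" where
  "levy_im a d \<nu> v = v * (d - a) - (\<integral>x. sin (v * x) - v * x * indicator {-1..1} x \<partial>\<nu>)"

lemma abs_one_minus_cos_le_min: "\<bar>1 - cos (v * x)\<bar> \<le> (v\<^sup>2 + 2) * min (x\<^sup>2) 1" for x v :: real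
proof (cases "x\<^sup>2 \<le> 1")
  case True
  have "1 - cos (v * x) \<le> v\<^sup>2 * x\<^sup>2 / 2" using one_minus_cos_le[of "v * x"] by (simp add: power_mult_distrib)
  also have "\<dots> \<le> (v\<^sup>2 + 2) * x\<^sup>2" by (simp add: field_simps)
  finally show ?thesis using True by simp
next
  case False
  have "1 - cos (v * x) \<le> 2" using cos_ge_minus_one[of "v * x"] by linarith
  also have "\<dots> \<le> v\<^sup>2 + 2" by simp
  finally show ?thesis using False by simp
qed

lemma abs_sin_compensated_le_min:
  "\<bar>sin (v * x) - v * x * indicator {-1..1} x\<bar> \<le> (v\<^sup>2 + 1) * min (x\<^sup>2) 1" for x v :: real
proof (cases "\<bar>x\<bar> \<le> 1")
  case True
  then have x: "x\<^sup>2 \<le> 1" by (simp add: abs_square_le_1)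
  have "\<bar>sin (v * x) - v * x\<bar> \<le> v\<^sup>2 * x\<^sup>2" using abs_sin_minus_le[of "v * x"] by (simp add: power_mult_distrib)
  also have "\<dots> \<le> (v\<^sup>2 + 1) * x\<^sup>2" by (simp add: field_simps)
  finally show ?thesis using True x by (simp add: indicator_def abs_le_iff)
next
  case False
  then have x: "\<not> x\<^sup>2 \<le> 1" by (simp add: abs_square_le_1)
  have "\<bar>sin (v * x)\<bar> \<le> v\<^sup>2 + 1" using abs_sin_le_one[of "v * x"] by (smt (verit) zero_le_power2)
  then show ?thesis using False x by (auto simp: indicator_def abs_le_iff)
qed

lemma integrable_one_minus_cos: "levy_measure \<nu> \<Longrightarrow> integrable \<nu> (\<lambda>x. 1 - cos (v * x))"
  by (rule integrable_levy_bounded[where K = "v\<^sup>2 + 2"]) (use abs_one_minus_cos_le_min in auto)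

lemma integrable_sin_compensated:
  "levy_measure \<nu> \<Longrightarrow> integrable \<nu> (\<lambda>x. sin (v * x) - v * x * indicator {-1..1} x)"
  by (rule integrable_levy_bounded[where K = "v\<^sup>2 + 1"]) (use abs_sin_compensated_le_min in auto)

text \<open>The shift by \<open>\<i> v d\<close> is the effect on the exponent of subtracting the drift \<open>t d\<close> from the
  process.\<close>

lemma levy_exponent_eq:
  assumes \<nu>: "levy_measure \<nu>"
  shows "levy_exponent a 0 \<nu> v + \<i> * of_real (v * d) = Complex (levy_re \<nu> v) (levy_im a d \<nu> v)"
proof -
  let ?f = "\<lambda>x. exp (\<i> * of_real (v * x)) - 1 - \<i> * of_real (v * x) * of_real (indicator {-1..1} x)"
  let ?s = "\<lambda>x. sin (v * x) - v * x * indicator {-1..1} x"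
  have f: "?f = (\<lambda>x. - of_real (1 - cos (v * x)) + \<i> * of_real (?s x))"
    by (intro ext complex_eqI) (simp_all add: Re_exp Im_exp)
  have "integrable \<nu> (\<lambda>x. - complex_of_real (1 - cos (v * x)))"
    and "integrable \<nu> (\<lambda>x. \<i> * complex_of_real (?s x))"
    by (intro integrable_minus integrable_mult_right integrable_of_real
          integrable_one_minus_cos[OF \<nu>] integrable_sin_compensated[OF \<nu>])+
  then have "integral\<^sup>L \<nu> ?f = (\<integral>x. - complex_of_real (1 - cos (v * x)) \<partial>\<nu>) + (\<integral>x. \<i> * complex_of_real (?s x) \<partial>\<nu>)"
    unfolding f by (rule Bochner_Integration.integral_add)
  also have "(\<integral>x. - complex_of_real (1 - cos (v * x)) \<partial>\<nu>) = - complex_of_real (levy_re \<nu> v)"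
    unfolding levy_re_def integral_minus integral_complex_of_real ..
  also have "(\<integral>x. \<i> * complex_of_real (?s x) \<partial>\<nu>) = \<i> * complex_of_real (integral\<^sup>L \<nu> ?s)"
    unfolding integral_mult_right_zero integral_complex_of_real ..
  finally have "integral\<^sup>L \<nu> ?f = - complex_of_real (levy_re \<nu> v) + \<i> * complex_of_real (integral\<^sup>L \<nu> ?s)" .
  then have "levy_exponent a 0 \<nu> v = - (\<i> * of_real (v * a))
     - (- complex_of_real (levy_re \<nu> v) + \<i> * complex_of_real (integral\<^sup>L \<nu> ?s))"
    unfolding levy_exponent_def by simp
  then show ?thesis
    unfolding levy_im_def by (intro complex_eqI) (simp_all add: right_diff_distrib)
qed

lemma char_drift_eq:
  assumes levy: "levy_process M X" and ch: "has_characteristics M X a 0 \<nu>" and h: "h \<ge> 0"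
  shows "Re (char (distr M borel (\<lambda>\<omega>. X h \<omega> - h * d)) v)
    = exp (- (h * levy_re \<nu> v)) * cos (h * levy_im a d \<nu> v)"
proof -
  interpret prob_space M using levy by (simp add: levy_process_def)
  have [measurable]: "X h \<in> borel_measurable M" using levy h by (auto simp: levy_process_def)
  have \<nu>: "levy_measure \<nu>" using ch by (simp add: has_characteristics_def)
  have "char (distr M borel (\<lambda>\<omega>. X h \<omega> - h * d)) v = (\<integral>\<omega>. iexp (v * (X h \<omega> - h * d)) \<partial>M)"
    by (simp add: char_def integral_distr)
  also have "\<dots> = (\<integral>\<omega>. exp (- (of_real h * (\<i> * of_real (v * d)))) * iexp (v * X h \<omega>) \<partial>M)"
    by (intro Bochner_Integration.integral_cong) (simp_all add: mult_exp_exp algebra_simps)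
  also have "\<dots> = exp (- (of_real h * (\<i> * of_real (v * d)))) * (\<integral>\<omega>. iexp (v * X h \<omega>) \<partial>M)"
    by simp
  also have "(\<integral>\<omega>. iexp (v * X h \<omega>) \<partial>M) = char (distr M borel (X h)) v"
    by (simp add: char_def integral_distr)
  also have "\<dots> = exp (- (of_real h * levy_exponent a 0 \<nu> v))"
    using ch h by (simp add: has_characteristics_def)
  also have "exp (- (of_real h * (\<i> * of_real (v * d)))) * \<dots>
     = exp (- (of_real h * (levy_exponent a 0 \<nu> v + \<i> * of_real (v * d))))"
    by (simp add: mult_exp_exp algebra_simps)
  also have "\<dots> = exp (- (of_real h * Complex (levy_re \<nu> v) (levy_im a d \<nu> v)))"
    by (simp only: levy_exponent_eq[OF \<nu>])
  finally show ?thesis by (simp add: Re_exp)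
qed

lemma levy_re_nonneg: "0 \<le> levy_re \<nu> v"
  unfolding levy_re_def by (intro Bochner_Integration.integral_nonneg) simp

lemma levy_re_le:
  assumes \<nu>: "levy_measure \<nu>"
  shows "levy_re \<nu> v \<le> (v\<^sup>2 + 2) * (\<integral>x. min (x\<^sup>2) 1 \<partial>\<nu>)"
proof -
  have "levy_re \<nu> v \<le> (\<integral>x. (v\<^sup>2 + 2) * min (x\<^sup>2) 1 \<partial>\<nu>)"
    unfolding levy_re_def
    using integrable_one_minus_cos[OF \<nu>] integrable_levy_min[OF \<nu>] abs_one_minus_cos_le_min
    by (intro integral_mono) (auto simp: abs_le_iff)
  then show ?thesis by simp
qed

lemma levy_second_moment_finite:
  assumes "levy_measure \<nu>"
  shows "(\<integral>\<^sup>+x\<in>{-1..1}. ennreal (\<bar>x\<bar> powr 2) \<partial>\<nu>) < \<infinity>"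
proof -
  have "(\<integral>\<^sup>+x\<in>{-1..1}. ennreal (\<bar>x\<bar> powr 2) \<partial>\<nu>) \<le> (\<integral>\<^sup>+x. ennreal (min (x\<^sup>2) 1) \<partial>\<nu>)"
    by (intro nn_integral_mono) (auto simp: indicator_def powr_numeral abs_square_le_1 abs_le_iff)
  also have "\<dots> < \<infinity>" using assms by (simp add: levy_measure_def)
  finally show ?thesis .
qed

lemma levy_index_le_2: "levy_measure \<nu> \<Longrightarrow> levy_index \<nu> \<le> 2"
  unfolding levy_index_def using levy_second_moment_finite[of \<nu>]
  by (intro cInf_lower bdd_belowI[of _ 0]) auto

lemma integrable_small_jumps:
  assumes \<nu>: "levy_measure \<nu>" and less: "levy_index \<nu> < 1"
  shows "set_integrable \<nu> {-1..1} (\<lambda>x. x)"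
proof -
  have sets [measurable_cong]: "sets \<nu> = sets borel" using \<nu> by (simp add: levy_measure_def)
  let ?Q = "{p. p > 0 \<and> (\<integral>\<^sup>+x\<in>{-1..1}. ennreal (\<bar>x\<bar> powr p) \<partial>\<nu>) < \<infinity>}"
  have "2 \<in> ?Q" using levy_second_moment_finite[OF \<nu>] by simp
  then have "?Q \<noteq> {}" by blast
  then obtain q where "q \<in> ?Q" "q < 1"
    using cInf_lessD[of ?Q 1] less unfolding levy_index_def by blast
  then have q: "q > 0" "q < 1" and fin: "(\<integral>\<^sup>+x\<in>{-1..1}. ennreal (\<bar>x\<bar> powr q) \<partial>\<nu>) < \<infinity>"
    by auto
  have "(\<integral>\<^sup>+x. ennreal (norm (indicator {-1..1} x *\<^sub>R x)) \<partial>\<nu>) \<le> (\<integral>\<^sup>+x\<in>{-1..1}. ennreal (\<bar>x\<bar> powr q) \<partial>\<nu>)"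
  proof (intro nn_integral_mono)
    fix x :: real
    have "\<bar>x\<bar> \<le> \<bar>x\<bar> powr q" if "\<bar>x\<bar> \<le> 1"
    proof (cases "x = 0")
      case False
      then have "\<bar>x\<bar> powr 1 \<le> \<bar>x\<bar> powr q" using that q by (intro powr_mono') auto
      then show ?thesis using False by simp
    qed simp
    then show "ennreal (norm (indicator {-1..1} x *\<^sub>R x)) \<le> ennreal (\<bar>x\<bar> powr q) * indicator {-1..1} x"
      by (auto simp: indicator_def abs_le_iff)
  qed
  then show ?thesis
    unfolding set_integrable_def using fin by (intro integrableI_bounded) (auto intro: le_less_trans)
qed

text \<open>If the small jumps are summable, the drift \<open>a - \<integral> x d\<nu>\<close> over \<open>[-1, 1]\<close> cancels the compensator
  in the exponent, and only the jumps themselves remain.\<close>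

lemma levy_im_finite_variation:
  assumes \<nu>: "levy_measure \<nu>" and int: "set_integrable \<nu> {-1..1} (\<lambda>x. x)"
  shows "integrable \<nu> (\<lambda>x. sin (v * x))"
    and "levy_im a (a - (LINT x:{-1..1}|\<nu>. x)) \<nu> v = - (\<integral>x. sin (v * x) \<partial>\<nu>)"
proof -
  have s: "integrable \<nu> (\<lambda>x. sin (v * x) - v * x * indicator {-1..1} x)"
    by (rule integrable_sin_compensated[OF \<nu>])
  have i: "integrable \<nu> (\<lambda>x. v * (indicator {-1..1} x *\<^sub>R x))"
    using int unfolding set_integrable_def by (rule integrable_mult_right)
  have "integrable \<nu> (\<lambda>x. (sin (v * x) - v * x * indicator {-1..1} x) + v * (indicator {-1..1} x *\<^sub>R x))"
    by (rule Bochner_Integration.integrable_add[OF s i])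
  then show "integrable \<nu> (\<lambda>x. sin (v * x))" by (simp add: algebra_simps)
  have "(\<integral>x. sin (v * x) \<partial>\<nu>)
      = (\<integral>x. (sin (v * x) - v * x * indicator {-1..1} x) + v * (indicator {-1..1} x *\<^sub>R x) \<partial>\<nu>)"
    by (simp add: algebra_simps)
  also have "\<dots> = (\<integral>x. sin (v * x) - v * x * indicator {-1..1} x \<partial>\<nu>)
      + (\<integral>x. v * (indicator {-1..1} x *\<^sub>R x) \<partial>\<nu>)"
    by (rule Bochner_Integration.integral_add[OF s i])
  also have "(\<integral>x. v * (indicator {-1..1} x *\<^sub>R x) \<partial>\<nu>) = v * (LINT x:{-1..1}|\<nu>. x)"
    unfolding set_lebesgue_integral_def by (rule integral_mult_right_zero)
  finally show "levy_im a (a - (LINT x:{-1..1}|\<nu>. x)) \<nu> v = - (\<integral>x. sin (v * x) \<partial>\<nu>)"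
    by (simp add: levy_im_def)
qed

lemma levy_im_symmetric:
  assumes \<nu>: "levy_measure \<nu>" and sym: "symmetric_measure \<nu>"
  shows "levy_im a a \<nu> v = 0"
proof -
  have [measurable_cong]: "sets \<nu> = sets borel" using \<nu> by (simp add: levy_measure_def)
  let ?f = "\<lambda>x. sin (v * x) - v * x * indicator {-1..1} x"
  have "(\<integral>x. ?f x \<partial>\<nu>) = (\<integral>x. ?f x \<partial>distr \<nu> borel uminus)"
    using sym by (simp add: symmetric_measure_def)
  also have "\<dots> = (\<integral>x. ?f (- x) \<partial>\<nu>)" by (subst integral_distr) auto
  also have "\<dots> = (\<integral>x. - ?f x \<partial>\<nu>)"
    by (intro Bochner_Integration.integral_cong) (auto simp: indicator_def)
  also have "\<dots> = - (\<integral>x. ?f x \<partial>\<nu>)" by (rule integral_minus)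
  finally show ?thesis by (simp add: levy_im_def)
qed

section \<open>The exponent near zero and the moment of the process\<close>

text \<open>The three regimes of the theorem with the drift \<open>d\<close> that is removed in each of them. For \<open>\<beta> < 1\<close>
  the summability of the small jumps is included, because it gives the integral its meaning.\<close>

definition drift_case :: "real \<Rightarrow> real \<Rightarrow> real measure \<Rightarrow> real \<Rightarrow> bool" where
  "drift_case a \<beta> \<nu> d \<longleftrightarrow>
     (\<beta> > 1 \<and> d = 0) \<or>
     (\<beta> < 1 \<and> set_integrable \<nu> {-1..1} (\<lambda>x. x) \<and> d = a - (LINT x:{-1..1}|\<nu>. x)) \<or>
     (\<beta> = 1 \<and> symmetric_measure \<nu> \<and> d = a)"

text \<open>A pointwise substitute for Cauchy--Schwarz: \<open>sin\<^sup>2 \<le> 2 (1 - cos)\<close>, combined with the inequality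
  between arithmetic and geometric mean with weight \<open>w\<close>. After integration the choice \<open>w = sqrt A + v\<close>
  gives the square root of \<open>A\<close>; the summand \<open>v\<close> keeps the weight positive when \<open>A\<close> vanishes. The
  truncation \<open>min (x\<^sup>2) 1\<close> equals \<open>1\<close> here and makes the right-hand side integrable over all jumps.\<close>

lemma abs_sin_le_weighted:
  fixes w x v :: real
  assumes w: "w > 0" and x: "\<bar>x\<bar> > 1"
  shows "\<bar>sin (v * x)\<bar> \<le> w / 2 * min (x\<^sup>2) 1 + (1 - cos (v * x)) / w"
proof -
  let ?s = "\<bar>sin (v * x)\<bar>"
  have x2: "min (x\<^sup>2) 1 = 1" using x by (auto simp: min_def abs_square_le_1)
  have "?s\<^sup>2 = (1 - cos (v * x)) * (1 + cos (v * x))"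
    by (simp add: sin_squared_eq power2_eq_square algebra_simps)
  also have "\<dots> \<le> (1 - cos (v * x)) * 2" by (intro mult_left_mono) auto
  finally have s2: "?s\<^sup>2 \<le> 2 * (1 - cos (v * x))" by simp
  have "0 \<le> (w - ?s)\<^sup>2" by simp
  then have "2 * w * ?s \<le> w\<^sup>2 + ?s\<^sup>2" by (simp add: power2_diff)
  then have "2 * w * ?s \<le> w\<^sup>2 + 2 * (1 - cos (v * x))" using s2 by linarith
  then show ?thesis using w unfolding x2 by (simp add: field_simps power2_eq_square)
qed

lemma sqrt_add_bounds:
  fixes A v :: real
  assumes A: "0 \<le> A" and v: "0 < v"
  shows "0 < sqrt A + v" and "v \<le> sqrt A + v" and "A / (sqrt A + v) \<le> sqrt A + v"
proof -
  show w: "0 < sqrt A + v" and "v \<le> sqrt A + v" using A v by (auto intro: add_nonneg_pos)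
  have "A = (sqrt A)\<^sup>2" using A by simp
  also have "\<dots> \<le> (sqrt A + v)\<^sup>2" using A v by (intro power_mono) auto
  finally show "A / (sqrt A + v) \<le> sqrt A + v"
    using w by (simp add: divide_le_eq power2_eq_square)
qed

text \<open>For bounded frequencies the small jumps and the drift contribute \<open>O(v)\<close> to the imaginary part. The
  large jumps may have no first moment, so their contribution need not be \<open>O(v)\<close>; but it is
  \<open>O(sqrt (A v) + v)\<close> by \<open>abs_sin_le_weighted\<close>, which after squaring is again controlled by the real
  part.\<close>

lemma levy_im_le_near_0:
  assumes \<nu>: "levy_measure \<nu>" and d: "drift_case a \<beta> \<nu> d"
  shows "\<exists>C\<ge>0. \<forall>v\<in>{0<..K}. (levy_im a d \<nu> v)\<^sup>2 \<le> C * (levy_re \<nu> v + v\<^sup>2)"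
proof -
  define m where "m = (\<integral>x. min (x\<^sup>2) 1 \<partial>\<nu>)"
  have m0: "m \<ge> 0" unfolding m_def by (intro Bochner_Integration.integral_nonneg) auto
  have im: "integrable \<nu> (\<lambda>x. min (x\<^sup>2) 1)" by (rule integrable_levy_min[OF \<nu>])
  have ic: "integrable \<nu> (\<lambda>x. 1 - cos (v * x))" for v by (rule integrable_one_minus_cos[OF \<nu>])
  have tail: "(\<integral>x. w / 2 * min (x\<^sup>2) 1 + (1 - cos (v * x)) / w \<partial>\<nu>) = w / 2 * m + levy_re \<nu> v / w" for w v
    using im ic[of v] by (simp add: m_def levy_re_def)
  have "\<exists>C\<ge>0. \<forall>v\<in>{0<..K}. \<bar>levy_im a d \<nu> v\<bar> \<le> C * (sqrt (levy_re \<nu> v) + v)"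
  proof -
    consider (gt) "d = 0" | (lt) "set_integrable \<nu> {-1..1} (\<lambda>x. x)" "d = a - (LINT x:{-1..1}|\<nu>. x)"
      | (eq) "symmetric_measure \<nu>" "d = a"
      using d by (auto simp: drift_case_def)
    then show ?thesis
    proof cases
      case gt
      show ?thesis
      proof (intro exI[of _ "\<bar>a\<bar> + \<bar>K\<bar> * m + m / 2 + 1"] conjI ballI)
        fix v assume v: "v \<in> {0<..K}"
        define w where "w = sqrt (levy_re \<nu> v) + v"
        have w: "w > 0" "v \<le> w" and Aw: "levy_re \<nu> v / w \<le> w"
          using sqrt_add_bounds[OF levy_re_nonneg, of v \<nu> v] v by (auto simp: w_def)
        let ?f = "\<lambda>x. sin (v * x) - v * x * indicator {-1..1} x"
        have pt: "\<bar>?f x\<bar> \<le> v\<^sup>2 * min (x\<^sup>2) 1 + (w / 2 * min (x\<^sup>2) 1 + (1 - cos (v * x)) / w)" for x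
        proof (cases "\<bar>x\<bar> \<le> 1")
          case True
          then have "min (x\<^sup>2) 1 = x\<^sup>2" by (simp add: min_def abs_square_le_1)
          moreover have "\<bar>?f x\<bar> \<le> v\<^sup>2 * x\<^sup>2"
            using abs_sin_minus_le[of "v * x"] True by (auto simp: power_mult_distrib indicator_def abs_le_iff)
          moreover have "0 \<le> w / 2 * min (x\<^sup>2) 1 + (1 - cos (v * x)) / w" using w by simp
          ultimately show ?thesis by linarith
        next
          case False
          then have "\<bar>?f x\<bar> \<le> w / 2 * min (x\<^sup>2) 1 + (1 - cos (v * x)) / w"
            using abs_sin_le_weighted[OF w(1), of x v] by (auto simp: indicator_def)
          moreover have "0 \<le> v\<^sup>2 * min (x\<^sup>2) 1" by simp
          ultimately show ?thesis by linarith
        qed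
        have "\<bar>\<integral>x. ?f x \<partial>\<nu>\<bar> \<le> (\<integral>x. v\<^sup>2 * min (x\<^sup>2) 1 + (w / 2 * min (x\<^sup>2) 1 + (1 - cos (v * x)) / w) \<partial>\<nu>)"
          using im ic[of v] by (intro abs_integral_le integrable_sin_compensated[OF \<nu>] pt) auto
        also have "\<dots> = v\<^sup>2 * m + (w / 2 * m + levy_re \<nu> v / w)"
          using im ic[of v] unfolding tail[symmetric] m_def by (subst Bochner_Integration.integral_add) (auto simp: levy_re_def)
        also have "v\<^sup>2 * m \<le> \<bar>K\<bar> * w * m"
          using v w m0 unfolding power2_eq_square by (intro mult_right_mono mult_mono) auto
        finally have "\<bar>\<integral>x. ?f x \<partial>\<nu>\<bar> \<le> \<bar>K\<bar> * w * m + (w / 2 * m + w)" using Aw by linarith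
        moreover have "\<bar>v * a\<bar> \<le> \<bar>a\<bar> * w" using v w by (simp add: abs_mult mult.commute mult_left_mono mult_right_mono)
        ultimately have "\<bar>levy_im a d \<nu> v\<bar> \<le> \<bar>a\<bar> * w + (\<bar>K\<bar> * w * m + (w / 2 * m + w))"
          using gt by (simp add: levy_im_def)
        also have "\<dots> = (\<bar>a\<bar> + \<bar>K\<bar> * m + m / 2 + 1) * w" by (simp add: algebra_simps)
        finally show "\<bar>levy_im a d \<nu> v\<bar> \<le> (\<bar>a\<bar> + \<bar>K\<bar> * m + m / 2 + 1) * (sqrt (levy_re \<nu> v) + v)"
          by (simp add: w_def)
      qed (use m0 in simp)
    next
      case lt
      define m' where "m' = (\<integral>x. \<bar>indicator {-1..1} x *\<^sub>R x\<bar> \<partial>\<nu>)"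
      have im': "integrable \<nu> (\<lambda>x. \<bar>indicator {-1..1} x *\<^sub>R x :: real\<bar>)"
        using lt(1) unfolding set_integrable_def by (rule integrable_abs)
      have m'0: "m' \<ge> 0" unfolding m'_def by (intro Bochner_Integration.integral_nonneg) auto
      show ?thesis
      proof (intro exI[of _ "m' + m / 2 + 1"] conjI ballI)
        fix v assume v: "v \<in> {0<..K}"
        define w where "w = sqrt (levy_re \<nu> v) + v"
        have w: "w > 0" "v \<le> w" and Aw: "levy_re \<nu> v / w \<le> w"
          using sqrt_add_bounds[OF levy_re_nonneg, of v \<nu> v] v by (auto simp: w_def)
        have pt: "\<bar>sin (v * x)\<bar> \<le> v * \<bar>indicator {-1..1} x *\<^sub>R x\<bar> + (w / 2 * min (x\<^sup>2) 1 + (1 - cos (v * x)) / w)" for x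
        proof (cases "\<bar>x\<bar> \<le> 1")
          case True
          then have "\<bar>sin (v * x)\<bar> \<le> v * \<bar>indicator {-1..1} x *\<^sub>R x\<bar>"
            using abs_sin_x_le_abs_x[of "v * x"] v by (auto simp: abs_mult indicator_def abs_le_iff)
          moreover have "0 \<le> w / 2 * min (x\<^sup>2) 1 + (1 - cos (v * x)) / w" using w by simp
          ultimately show ?thesis by linarith
        next
          case False
          then have "\<bar>sin (v * x)\<bar> \<le> w / 2 * min (x\<^sup>2) 1 + (1 - cos (v * x)) / w"
            using abs_sin_le_weighted[OF w(1), of x v] by auto
          moreover have "0 \<le> v * \<bar>indicator {-1..1} x *\<^sub>R x\<bar>" using v by simp
          ultimately show ?thesis by linarith
        qed
        have "\<bar>\<integral>x. sin (v * x) \<partial>\<nu>\<bar>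
           \<le> (\<integral>x. v * \<bar>indicator {-1..1} x *\<^sub>R x\<bar> + (w / 2 * min (x\<^sup>2) 1 + (1 - cos (v * x)) / w) \<partial>\<nu>)"
          using im im' ic[of v] by (intro abs_integral_le levy_im_finite_variation(1)[OF \<nu> lt(1)] pt) auto
        also have "\<dots> = v * m' + (w / 2 * m + levy_re \<nu> v / w)"
          using im im' ic[of v] unfolding tail[symmetric] m'_def
          by (subst Bochner_Integration.integral_add) (auto simp: levy_re_def)
        also have "v * m' \<le> w * m'" using w m'0 by (intro mult_right_mono) auto
        finally have "\<bar>levy_im a d \<nu> v\<bar> \<le> w * m' + (w / 2 * m + w)"
          using Aw levy_im_finite_variation(2)[OF \<nu> lt(1), of a v] lt(2) by simp
        also have "\<dots> = (m' + m / 2 + 1) * w" by (simp add: algebra_simps)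
        finally show "\<bar>levy_im a d \<nu> v\<bar> \<le> (m' + m / 2 + 1) * (sqrt (levy_re \<nu> v) + v)"
          by (simp add: w_def)
      qed (use m0 m'0 in simp)
    next
      case eq
      then show ?thesis using levy_im_symmetric[OF \<nu>] by (intro exI[of _ 0]) auto
    qed
  qed
  then obtain C where C: "C \<ge> 0" and le: "\<And>v. v \<in> {0<..K} \<Longrightarrow> \<bar>levy_im a d \<nu> v\<bar> \<le> C * (sqrt (levy_re \<nu> v) + v)"
    by blast
  show ?thesis
  proof (intro exI[of _ "2 * C\<^sup>2"] conjI ballI)
    fix v assume v: "v \<in> {0<..K}"
    let ?s = "sqrt (levy_re \<nu> v)"
    have "(levy_im a d \<nu> v)\<^sup>2 \<le> (C * (?s + v))\<^sup>2"
      using le[OF v] by (metis abs_ge_zero power2_abs power_mono)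
    also have "\<dots> = C\<^sup>2 * (?s + v)\<^sup>2" by (simp add: power_mult_distrib)
    also have "\<dots> \<le> C\<^sup>2 * (2 * (?s\<^sup>2 + v\<^sup>2))"
      using sum_squares_bound[of ?s v] by (intro mult_left_mono) (auto simp: power2_sum)
    also have "?s\<^sup>2 = levy_re \<nu> v" by (simp add: levy_re_nonneg)
    finally show "(levy_im a d \<nu> v)\<^sup>2 \<le> 2 * C\<^sup>2 * (levy_re \<nu> v + v\<^sup>2)"
      by (simp add: algebra_simps)
  qed simp
qed

text \<open>By scaling the integral is a constant times \<open>\<bar>x\<bar> powr p\<close>; splitting at \<open>1 / \<bar>x\<bar>\<close> and using
  \<open>1 - cos z \<le> min (z\<^sup>2) 2\<close> shows that the constant is finite for \<open>0 < p < 2\<close>.\<close>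

lemma nn_integral_one_minus_cos_le:
  fixes x p :: real
  assumes p: "0 < p" "p < 2"
  shows "(\<integral>\<^sup>+v\<in>{0<..}. ennreal (v powr (-1 - p)) * ennreal (1 - cos (v * x)) \<partial>lborel)
    \<le> ennreal ((1 / (2 - p) + 2 / p) * \<bar>x\<bar> powr p)"
proof (cases "x = 0")
  case False
  define z where "z = 1 / \<bar>x\<bar>"
  have z: "z > 0" using False by (simp add: z_def)
  have "(\<integral>\<^sup>+v\<in>{0<..}. ennreal (v powr (-1 - p)) * ennreal (1 - cos (v * x)) \<partial>lborel)
    \<le> (\<integral>\<^sup>+v. ennreal (x\<^sup>2) * (ennreal (v powr ((2 - p) - 1)) * indicator {0<..z} v)
          + 2 * (ennreal (v powr (- p - 1)) * indicator {z..} v) \<partial>lborel)"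
  proof (intro nn_integral_mono)
    fix v :: real
    show "ennreal (v powr (-1 - p)) * ennreal (1 - cos (v * x)) * indicator {0<..} v
      \<le> ennreal (x\<^sup>2) * (ennreal (v powr ((2 - p) - 1)) * indicator {0<..z} v)
          + 2 * (ennreal (v powr (- p - 1)) * indicator {z..} v)"
    proof (cases "v > 0")
      case v: True
      show ?thesis
      proof (cases "v \<le> z")
        case True
        have "1 - cos (v * x) \<le> (v * x)\<^sup>2"
          using one_minus_cos_le[of "v * x"] zero_le_power2[of "v * x"] by linarith
        then have "v powr (-1 - p) * (1 - cos (v * x)) \<le> v powr (-1 - p) * (v * x)\<^sup>2"
          by (intro mult_left_mono) auto
        also have "\<dots> = x\<^sup>2 * (v powr (-1 - p) * v powr 2)"
          using v by (simp add: powr_numeral power_mult_distrib)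
        also have "v powr (-1 - p) * v powr 2 = v powr ((2 - p) - 1)"
          by (simp flip: powr_add)
        finally have "ennreal (v powr (-1 - p)) * ennreal (1 - cos (v * x)) \<le> ennreal (x\<^sup>2 * v powr ((2 - p) - 1))"
          by (subst ennreal_mult[symmetric]) (auto intro!: ennreal_leI)
        then show ?thesis
          using v True by (simp add: ennreal_mult add_increasing2)
      next
        case False
        have "1 - cos (v * x) \<le> 2" using cos_ge_minus_one[of "v * x"] by linarith
        then have "ennreal (v powr (-1 - p)) * ennreal (1 - cos (v * x)) \<le> ennreal (v powr (-1 - p)) * ennreal 2"
          by (intro mult_left_mono ennreal_leI) auto
        also have "\<dots> = 2 * ennreal (v powr (- p - 1))"
        proof -
          have "-1 - p = - p - 1" by simp
          then show ?thesis by (simp only: mult.commute ennreal_numeral)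
        qed
        finally show ?thesis using v False by simp
      qed
    qed simp
  qed
  also have "\<dots> = ennreal (x\<^sup>2) * (\<integral>\<^sup>+v\<in>{0<..z}. ennreal (v powr ((2 - p) - 1)) \<partial>lborel)
      + 2 * (\<integral>\<^sup>+v\<in>{z..}. ennreal (v powr (- p - 1)) \<partial>lborel)"
    by (subst nn_integral_add) (auto simp: nn_integral_cmult)
  also have "(\<integral>\<^sup>+v\<in>{0<..z}. ennreal (v powr ((2 - p) - 1)) \<partial>lborel) = ennreal (z powr (2 - p) / (2 - p))"
    using p z by (intro nn_integral_powr_Ioc) auto
  also have "(\<integral>\<^sup>+v\<in>{z..}. ennreal (v powr (- p - 1)) \<partial>lborel) = ennreal (z powr (- p) / p)"
    using p z by (intro nn_integral_powr_Ici) auto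
  also have "ennreal (x\<^sup>2) * ennreal (z powr (2 - p) / (2 - p)) = ennreal (\<bar>x\<bar> powr p / (2 - p))"
  proof -
    have "x\<^sup>2 * z powr (2 - p) = \<bar>x\<bar> powr p"
      using False by (simp add: z_def powr_diff powr_divide powr_numeral field_simps)
    then show ?thesis using p by (subst ennreal_mult[symmetric]) auto
  qed
  also have "2 * ennreal (z powr (- p) / p) = ennreal (2 * \<bar>x\<bar> powr p / p)"
  proof -
    have "z powr (- p) = \<bar>x\<bar> powr p" using False by (simp add: z_def powr_divide powr_minus)
    then show ?thesis using p ennreal_mult[of 2 "\<bar>x\<bar> powr p / p"] by simp
  qed
  also have "ennreal (\<bar>x\<bar> powr p / (2 - p)) + ennreal (2 * \<bar>x\<bar> powr p / p)
      = ennreal ((1 / (2 - p) + 2 / p) * \<bar>x\<bar> powr p)"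
    using p by (subst ennreal_plus[symmetric]) (auto simp: algebra_simps)
  finally show ?thesis .
qed simp

text \<open>The modulus of the characteristic function of \<open>X\<^sub>1\<close> is \<open>exp (- A)\<close>, so measurability is inherited
  from the continuity of characteristic functions.\<close>

lemma borel_measurable_levy_re:
  assumes levy: "levy_process M X" and ch: "has_characteristics M X a 0 \<nu>"
  shows "levy_re \<nu> \<in> borel_measurable borel"
proof -
  interpret prob_space M using levy by (simp add: levy_process_def)
  have X1 [measurable]: "X 1 \<in> borel_measurable M" using levy by (auto simp: levy_process_def)
  interpret D: real_distribution "distr M borel (X 1)"
    by (simp add: real_distribution_def real_distribution_axioms_def prob_space_distr)
  have \<nu>: "levy_measure \<nu>" using ch by (simp add: has_characteristics_def)
  have "char (distr M borel (X 1)) v = exp (- levy_exponent a 0 \<nu> v)" for v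
    using ch by (simp add: has_characteristics_def)
  moreover have "Re (levy_exponent a 0 \<nu> v) = levy_re \<nu> v" for v
    using arg_cong[OF levy_exponent_eq[OF \<nu>, of a v 0], of Re] by simp
  ultimately have "levy_re \<nu> v = - ln (cmod (char (distr M borel (X 1)) v))" for v
    by simp
  then have "levy_re \<nu> = (\<lambda>v. - ln (cmod (char (distr M borel (X 1)) v)))" by auto
  then show ?thesis by simp
qed

text \<open>Integrating \<open>nn_integral_one_minus_cos_le\<close> over the law of \<open>X\<^sub>1\<close> shows that \<open>1 - Re char\<close> is
  integrable against \<open>v powr (-1 - p)\<close>. It dominates \<open>A\<close> near zero: with \<open>R = Re char\<close> one has
  \<open>1 - exp (- 2 A) \<le> 1 - R\<^sup>2 \<le> 2 (1 - R)\<close>, and \<open>1 - exp (- 2 A)\<close> is comparable with \<open>A\<close> because \<open>A\<close>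
  is bounded on bounded sets.\<close>

lemma levy_re_integrable_near_0:
  assumes levy: "levy_process M X" and ch: "has_characteristics M X a 0 \<nu>"
    and p: "0 < p" "p < 2" and int: "integrable M (\<lambda>\<omega>. \<bar>X 1 \<omega>\<bar> powr p)"
  shows "(\<integral>\<^sup>+v\<in>{0<..K}. ennreal (v powr (-1 - p)) * ennreal (levy_re \<nu> v) \<partial>lborel) < \<infinity>"
proof -
  interpret prob_space M using levy by (simp add: levy_process_def)
  have X1 [measurable]: "X 1 \<in> borel_measurable M" using levy by (auto simp: levy_process_def)
  interpret L: pair_sigma_finite M lborel ..
  have \<nu>: "levy_measure \<nu>" using ch by (simp add: has_characteristics_def)
  let ?R = "\<lambda>v. Re (char (distr M borel (X 1)) v)"
  define A where "A = (K\<^sup>2 + 2) * (\<integral>x. min (x\<^sup>2) 1 \<partial>\<nu>)"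
  have m0: "(\<integral>x. min (x\<^sup>2) 1 \<partial>\<nu>) \<ge> 0" by (intro Bochner_Integration.integral_nonneg) auto
  have A0: "A \<ge> 0" unfolding A_def using m0 by simp
  have le: "levy_re \<nu> v \<le> (1 + 2 * A) * (1 - ?R v)" if v: "v \<in> {0<..K}" for v
  proof -
    let ?a = "levy_re \<nu> v" and ?b = "levy_im a 0 \<nu> v"
    have R: "?R v = exp (- ?a) * cos ?b"
      using char_drift_eq[OF levy ch, of 1 0 v] by simp
    have aA: "?a \<le> A"
    proof -
      have "v\<^sup>2 \<le> K\<^sup>2" using v by (intro power_mono) auto
      then have "(v\<^sup>2 + 2) * (\<integral>x. min (x\<^sup>2) 1 \<partial>\<nu>) \<le> A"
        unfolding A_def using m0 by (intro mult_right_mono) auto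
      then show ?thesis using levy_re_le[OF \<nu>, of v] by linarith
    qed
    have a0: "0 \<le> ?a" by (rule levy_re_nonneg)
    have "\<bar>?R v\<bar> \<le> exp (- ?a) * 1" unfolding R abs_mult by (intro mult_mono) auto
    moreover have "exp (- ?a) \<le> 1" using a0 by simp
    ultimately have R1: "\<bar>?R v\<bar> \<le> exp (- ?a)" "\<bar>?R v\<bar> \<le> 1" by linarith+
    have "(?R v)\<^sup>2 \<le> (exp (- ?a))\<^sup>2" using R1(1) by (metis abs_ge_zero power2_abs power_mono)
    also have "\<dots> = exp (- (2 * ?a))" by (simp add: power2_eq_square flip: exp_add)
    finally have "1 - exp (- (2 * ?a)) \<le> 1 - (?R v)\<^sup>2" by simp
    also have "\<dots> = (1 + ?R v) * (1 - ?R v)" by (simp add: power2_eq_square algebra_simps)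
    also have "\<dots> \<le> 2 * (1 - ?R v)" using R1(2) by (intro mult_right_mono) auto
    finally have e: "1 - exp (- (2 * ?a)) \<le> 2 * (1 - ?R v)" .
    have "2 * ?a \<le> (1 + 2 * ?a) * (1 - exp (- (2 * ?a)))"
    proof -
      have "(1 + 2 * ?a) * exp (- (2 * ?a)) \<le> exp (2 * ?a) * exp (- (2 * ?a))"
        using exp_ge_add_one_self[of "2 * ?a"] by (intro mult_right_mono) auto
      then show ?thesis by (simp add: algebra_simps flip: exp_add)
    qed
    also have "\<dots> \<le> (1 + 2 * A) * (2 * (1 - ?R v))"
      using a0 aA e by (intro mult_mono) auto
    also have "\<dots> = 2 * ((1 + 2 * A) * (1 - ?R v))" by (simp add: mult.assoc mult.left_commute)
    finally show ?thesis by linarith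
  qed
  have "(\<integral>\<^sup>+v\<in>{0<..K}. ennreal (v powr (-1 - p)) * ennreal (levy_re \<nu> v) \<partial>lborel)
    \<le> (\<integral>\<^sup>+v. (\<integral>\<^sup>+\<omega>. ennreal (1 + 2 * A) * (ennreal (v powr (-1 - p)) * ennreal (1 - cos (v * X 1 \<omega>)) * indicator {0<..} v) \<partial>M) \<partial>lborel)"
  proof (intro nn_integral_mono)
    fix v :: real
    have "(\<integral>\<^sup>+\<omega>. ennreal (1 + 2 * A) * (ennreal (v powr (-1 - p)) * ennreal (1 - cos (v * X 1 \<omega>)) * indicator {0<..} v) \<partial>M)
       = (\<integral>\<^sup>+\<omega>. (ennreal (1 + 2 * A) * ennreal (v powr (-1 - p)) * indicator {0<..} v) * ennreal (1 - cos (v * X 1 \<omega>)) \<partial>M)"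
      by (intro nn_integral_cong) (simp add: ac_simps)
    also have "\<dots> = (ennreal (1 + 2 * A) * ennreal (v powr (-1 - p)) * indicator {0<..} v) * ennreal (1 - ?R v)"
      by (subst nn_integral_cmult) (auto simp: one_minus_Re_char)
    finally have eq: "(\<integral>\<^sup>+\<omega>. ennreal (1 + 2 * A) * (ennreal (v powr (-1 - p)) * ennreal (1 - cos (v * X 1 \<omega>)) * indicator {0<..} v) \<partial>M)
       = (ennreal (1 + 2 * A) * ennreal (v powr (-1 - p)) * indicator {0<..} v) * ennreal (1 - ?R v)" .
    show "ennreal (v powr (-1 - p)) * ennreal (levy_re \<nu> v) * indicator {0<..K} v
      \<le> (\<integral>\<^sup>+\<omega>. ennreal (1 + 2 * A) * (ennreal (v powr (-1 - p)) * ennreal (1 - cos (v * X 1 \<omega>)) * indicator {0<..} v) \<partial>M)"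
    proof (cases "v \<in> {0<..K}")
      case True
      have "ennreal (levy_re \<nu> v) \<le> ennreal ((1 + 2 * A) * (1 - ?R v))" by (intro ennreal_leI le True)
      also have "\<dots> = ennreal (1 + 2 * A) * ennreal (1 - ?R v)" using A0 by (intro ennreal_mult') auto
      finally have "ennreal (v powr (-1 - p)) * ennreal (levy_re \<nu> v)
          \<le> ennreal (v powr (-1 - p)) * (ennreal (1 + 2 * A) * ennreal (1 - ?R v))"
        by (intro mult_left_mono) auto
      then show ?thesis unfolding eq using True by (simp add: ac_simps)
    qed simp
  qed
  also have "\<dots> = (\<integral>\<^sup>+\<omega>. (\<integral>\<^sup>+v. ennreal (1 + 2 * A) * (ennreal (v powr (-1 - p)) * ennreal (1 - cos (v * X 1 \<omega>)) * indicator {0<..} v) \<partial>lborel) \<partial>M)"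
    by (intro L.Fubini') measurable
  also have "\<dots> \<le> (\<integral>\<^sup>+\<omega>. ennreal (1 + 2 * A) * ennreal ((1 / (2 - p) + 2 / p) * \<bar>X 1 \<omega>\<bar> powr p) \<partial>M)"
    using nn_integral_one_minus_cos_le[OF p]
    by (intro nn_integral_mono) (auto simp: nn_integral_cmult intro!: mult_left_mono)
  also have "\<dots> = (\<integral>\<^sup>+\<omega>. ennreal ((1 + 2 * A) * (1 / (2 - p) + 2 / p)) * ennreal (\<bar>X 1 \<omega>\<bar> powr p) \<partial>M)"
  proof (intro nn_integral_cong)
    fix \<omega>
    have "0 \<le> 1 + 2 * A" "0 \<le> 1 / (2 - p) + 2 / p" using A0 p by auto
    then show "ennreal (1 + 2 * A) * ennreal ((1 / (2 - p) + 2 / p) * \<bar>X 1 \<omega>\<bar> powr p)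
        = ennreal ((1 + 2 * A) * (1 / (2 - p) + 2 / p)) * ennreal (\<bar>X 1 \<omega>\<bar> powr p)"
      by (simp only: ennreal_mult mult_nonneg_nonneg powr_ge_zero mult.assoc)
  qed
  also have "\<dots> = ennreal ((1 + 2 * A) * (1 / (2 - p) + 2 / p)) * (\<integral>\<^sup>+\<omega>. ennreal (\<bar>X 1 \<omega>\<bar> powr p) \<partial>M)"
    by (intro nn_integral_cmult) auto
  also have "(\<integral>\<^sup>+\<omega>. ennreal (\<bar>X 1 \<omega>\<bar> powr p) \<partial>M) = ennreal (\<integral>\<omega>. \<bar>X 1 \<omega>\<bar> powr p \<partial>M)"
    using int by (intro nn_integral_eq_integral) auto
  finally show ?thesis by (rule le_less_trans) (simp add: ennreal_mult_less_top)
qed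

section \<open>Potter bounds for monotone slowly varying functions\<close>

text \<open>The maximum makes the bound symmetric in \<open>x\<close> and \<open>y\<close>, so that increasing and decreasing \<open>l\<close> are
  covered by one notion.\<close>

definition potter_bounds :: "real \<Rightarrow> (real \<Rightarrow> real) \<Rightarrow> bool" where
  "potter_bounds c l \<longleftrightarrow> (\<forall>\<delta>>0. \<exists>C>0. \<forall>x\<in>{0<..c}. \<forall>y\<in>{0<..c}.
     l x \<le> C * max ((x / y) powr \<delta>) ((y / x) powr \<delta>) * l y)"

text \<open>Near zero, doubling the argument increases \<open>l\<close> by at most the factor \<open>2 powr \<delta>\<close>. Iterating this
  along \<open>y, 2 y, 4 y, ...\<close> gives growth of order \<open>(x / y) powr \<delta>\<close>, and monotonicity fills the gaps
  between the dyadic multiples at the price of one more factor \<open>2 powr \<delta>\<close>. Away from zero \<open>l\<close> is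
  bounded above and below by positive constants.\<close>

lemma mono_slowly_varying_growth:
  fixes l :: "real \<Rightarrow> real"
  assumes c: "c > 0" and mono: "mono_on {0<..c} l" and pos: "\<And>x. x \<in> {0<..c} \<Longrightarrow> l x > 0"
    and slow: "((\<lambda>x. l (2 * x) / l x) \<longlongrightarrow> 1) (at_right 0)" and \<delta>: "\<delta> > 0"
  shows "\<exists>C>0. \<forall>x\<in>{0<..c}. \<forall>y\<in>{0<..x}. l x \<le> C * (x / y) powr \<delta> * l y"
proof -
  define D where "D = (2::real) powr \<delta>"
  have D: "D > 1" using \<delta> by (simp add: D_def)
  have "eventually (\<lambda>x. l (2 * x) / l x < D) (at_right 0)"
    using order_tendstoD(2)[OF slow D] .
  then obtain b where b: "b > 0" "\<forall>x>0. x < b \<longrightarrow> l (2 * x) / l x < D"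
    unfolding eventually_at_right_field by auto
  \<comment> \<open>On \<open>(0, z]\<close> the doubling estimate applies and \<open>2 x\<close> stays in the domain.\<close>
  define z where "z = min (b / 2) (c / 2)"
  have z: "z > 0" "z < b" "2 * z \<le> c" using b c by (auto simp: z_def)
  have l_mono: "l x \<le> l y" if "0 < x" "x \<le> y" "y \<le> c" for x y
    using mono that by (auto simp: mono_on_def)
  have double: "l (2 * x) \<le> D * l x" if "0 < x" "x \<le> z" for x
  proof -
    have "l x > 0" using that z by (intro pos) auto
    then show ?thesis using b(2)[rule_format, of x] that z by (simp add: field_simps)
  qed
  have dyadic: "l x \<le> D * (x / y) powr \<delta> * l y"
    if "0 < y" "y \<le> x" "x \<le> 2 ^ n * y" "x \<le> z" for n x y
    using that
  proof (induction n arbitrary: x)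
    case 0
    then have "x = y" by simp
    moreover have "1 * l y \<le> D * l y" using D 0 z by (intro mult_right_mono less_imp_le pos) auto
    ultimately show ?case using 0 by simp
  next
    case (Suc n)
    have ly: "l y > 0" using Suc.prems z by (intro pos) auto
    show ?case
    proof (cases "x \<le> 2 * y")
      case True
      have "l x \<le> l (2 * y)" using True Suc.prems z by (intro l_mono) auto
      also have "\<dots> \<le> D * l y" using Suc.prems z by (intro double) auto
      also have "\<dots> \<le> D * (x / y) powr \<delta> * l y"
        using Suc.prems \<delta> D ly by (intro mult_right_mono) (auto intro!: ge_one_powr_ge_zero)
      finally show ?thesis .
    next
      case False
      have "l x = l (2 * (x / 2))" by simp
      also have "\<dots> \<le> D * l (x / 2)" using Suc.prems by (intro double) auto
      also have "\<dots> \<le> D * (D * (x / 2 / y) powr \<delta> * l y)"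
        using Suc.prems False D by (intro mult_left_mono Suc.IH) auto
      also have "(x / 2 / y) powr \<delta> = (x / y) powr \<delta> / D"
        using Suc.prems by (simp add: D_def powr_divide powr_mult)
      finally show ?thesis using D by simp
    qed
  qed
  have below: "l x \<le> D * (x / y) powr \<delta> * l y" if "0 < y" "y \<le> x" "x \<le> z" for x y
  proof -
    obtain n where "x / y < 2 ^ n" using real_arch_pow[of 2 "x / y"] by auto
    then have "x \<le> 2 ^ n * y" using that by (simp add: field_simps)
    then show ?thesis using dyadic that by blast
  qed
  define R where "R = l c / l z"
  have lz: "l z > 0" and lcz: "l z \<le> l c" using z by (auto intro!: pos l_mono)
  have R: "R \<ge> 1" using lz lcz by (simp add: R_def)
  have lc: "l c = R * l z" using lz by (simp add: R_def)
  show ?thesis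
  proof (intro exI[of _ "R * D"] conjI ballI)
    show "R * D > 0" using R D by simp
    fix x y assume x: "x \<in> {0<..c}" and y: "y \<in> {0<..x}"
    have ly: "l y > 0" using x y by (intro pos) auto
    have one: "1 \<le> (x / y) powr \<delta>" using x y \<delta> by (intro ge_one_powr_ge_zero) auto
    have RD: "D \<le> R * D" "R \<le> R * D" using R D by (auto simp: mult_le_cancel_right1 mult_le_cancel_left1)
    consider "x \<le> z" | "z < x" "y \<le> z" | "z < y" using y by fastforce
    then show "l x \<le> R * D * (x / y) powr \<delta> * l y"
    proof cases
      case 1
      then have "l x \<le> D * (x / y) powr \<delta> * l y" using y by (intro below) auto
      also have "\<dots> \<le> R * D * (x / y) powr \<delta> * l y"
        using RD ly by (intro mult_right_mono) auto
      finally show ?thesis .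
    next
      case 2
      have "l x \<le> l c" using x by (intro l_mono) auto
      also have "\<dots> \<le> R * (D * (z / y) powr \<delta> * l y)"
        unfolding lc using 2 y R by (intro mult_left_mono below) auto
      also have "\<dots> \<le> R * (D * (x / y) powr \<delta> * l y)"
        using 2 y R D ly z \<delta> by (intro mult_left_mono mult_right_mono powr_mono2 divide_right_mono) auto
      finally show ?thesis by (simp add: mult.assoc)
    next
      case 3
      have "l x \<le> l c" using x by (intro l_mono) auto
      also have "\<dots> \<le> R * l y" unfolding lc using 3 x y z R by (intro mult_left_mono l_mono) auto
      also have "\<dots> \<le> R * D * l y" using RD ly by (intro mult_right_mono) auto
      also have "\<dots> = R * D * 1 * l y" by simp
      also have "\<dots> \<le> R * D * (x / y) powr \<delta> * l y"
        using one R D ly by (intro mult_right_mono mult_left_mono) auto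
      finally show ?thesis .
    qed
  qed
qed

lemma potter_bounds_mono:
  fixes l :: "real \<Rightarrow> real"
  assumes c: "c > 0" and mono: "mono_on {0<..c} l" and pos: "\<And>x. x \<in> {0<..c} \<Longrightarrow> l x > 0"
    and slow: "((\<lambda>x. l (2 * x) / l x) \<longlongrightarrow> 1) (at_right 0)"
  shows "potter_bounds c l"
  unfolding potter_bounds_def
proof (intro allI impI)
  fix \<delta> :: real assume \<delta>: "\<delta> > 0"
  obtain C where C: "C > 0" "\<And>x y. x \<in> {0<..c} \<Longrightarrow> y \<in> {0<..x} \<Longrightarrow> l x \<le> C * (x / y) powr \<delta> * l y"
    using mono_slowly_varying_growth[OF assms \<delta>] by blast
  have "l x \<le> (C + 1) * max ((x / y) powr \<delta>) ((y / x) powr \<delta>) * l y"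
    if x: "x \<in> {0<..c}" and y: "y \<in> {0<..c}" for x y
  proof -
    let ?m = "max ((x / y) powr \<delta>) ((y / x) powr \<delta>)"
    have ly: "l y > 0" by (rule pos[OF y])
    show ?thesis
    proof (cases "y \<le> x")
      case True
      then have "l x \<le> C * (x / y) powr \<delta> * l y" using x y by (intro C(2)) auto
      also have "\<dots> \<le> (C + 1) * ?m * l y"
        using C(1) ly by (intro mult_right_mono mult_mono) auto
      finally show ?thesis .
    next
      case False
      have "l x \<le> l y" using mono x y False by (auto simp: mono_on_def)
      also have "\<dots> = 1 * 1 * l y" by simp
      also have "\<dots> \<le> (C + 1) * ?m * l y"
        using C(1) ly False x \<delta> by (intro mult_right_mono mult_mono) (auto simp: le_max_iff_disj intro!: ge_one_powr_ge_zero)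
      finally show ?thesis .
    qed
  qed
  then show "\<exists>C>0. \<forall>x\<in>{0<..c}. \<forall>y\<in>{0<..c}. l x \<le> C * max ((x / y) powr \<delta>) ((y / x) powr \<delta>) * l y"
    using C(1) by (intro exI[of _ "C + 1"]) auto
qed

lemma potter_bounds_inverse:
  fixes l :: "real \<Rightarrow> real"
  assumes "potter_bounds c (\<lambda>x. 1 / l x)" and pos: "\<And>x. x \<in> {0<..c} \<Longrightarrow> l x > 0"
  shows "potter_bounds c l"
  unfolding potter_bounds_def
proof (intro allI impI)
  fix \<delta> :: real assume "\<delta> > 0"
  then obtain C where C: "C > 0" "\<And>x y. x \<in> {0<..c} \<Longrightarrow> y \<in> {0<..c} \<Longrightarrow>
      1 / l x \<le> C * max ((x / y) powr \<delta>) ((y / x) powr \<delta>) * (1 / l y)"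
    using assms(1) unfolding potter_bounds_def by blast
  have "l x \<le> C * max ((x / y) powr \<delta>) ((y / x) powr \<delta>) * l y"
    if x: "x \<in> {0<..c}" and y: "y \<in> {0<..c}" for x y
    using C(2)[OF y x] pos[OF x] pos[OF y] by (simp add: field_simps max.commute)
  then show "\<exists>C>0. \<forall>x\<in>{0<..c}. \<forall>y\<in>{0<..c}. l x \<le> C * max ((x / y) powr \<delta>) ((y / x) powr \<delta>) * l y"
    using C(1) by blast
qed

text \<open>The reciprocal of a decreasing slowly varying function is increasing and slowly varying, and
  two-sided Potter bounds pass to reciprocals.\<close>

lemma potter_bounds_antimono:
  fixes l :: "real \<Rightarrow> real"
  assumes c: "c > 0" and anti: "antimono_on {0<..c} l" and pos: "\<And>x. x \<in> {0<..c} \<Longrightarrow> l x > 0"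
    and slow: "((\<lambda>x. l (2 * x) / l x) \<longlongrightarrow> 1) (at_right 0)"
  shows "potter_bounds c l"
proof (rule potter_bounds_inverse[OF potter_bounds_mono[OF c] pos])
  show "mono_on {0<..c} (\<lambda>x. 1 / l x)"
    using anti pos by (auto simp: mono_on_def monotone_on_def intro!: divide_left_mono mult_pos_pos)
  have "((\<lambda>x. inverse (l (2 * x) / l x)) \<longlongrightarrow> inverse 1) (at_right 0)"
    by (intro tendsto_inverse slow) simp
  then show "((\<lambda>x. 1 / l (2 * x) / (1 / l x)) \<longlongrightarrow> 1) (at_right 0)"
    by (simp add: field_simps)
qed (use pos in auto)

lemma slowly_varying_doubling:
  assumes rv: "regularly_varying_at_0 c \<phi> (- (\<beta> + 1))" and l: "l = (\<lambda>x. x powr (\<beta> + 1) * \<phi> x)"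
  shows "((\<lambda>x. l (2 * x) / l x) \<longlongrightarrow> 1) (at_right 0)"
proof -
  have "((\<lambda>x. \<phi> (2 * x) / \<phi> x) \<longlongrightarrow> 2 powr (- (\<beta> + 1))) (at_right 0)"
    using rv unfolding regularly_varying_at_0_def by (metis zero_less_numeral)
  then have "((\<lambda>x. 2 powr (\<beta> + 1) * (\<phi> (2 * x) / \<phi> x)) \<longlongrightarrow> 2 powr (\<beta> + 1) * 2 powr (- (\<beta> + 1))) (at_right 0)"
    by (intro tendsto_intros)
  then have "((\<lambda>x. 2 powr (\<beta> + 1) * (\<phi> (2 * x) / \<phi> x)) \<longlongrightarrow> 1) (at_right 0)"
    by (simp flip: powr_add)
  moreover have "eventually (\<lambda>x. 2 powr (\<beta> + 1) * (\<phi> (2 * x) / \<phi> x) = l (2 * x) / l x) (at_right 0)"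
    using eventually_at_right_less[of 0]
    by eventually_elim (simp add: l powr_mult)
  ultimately show ?thesis by (rule Lim_transform_eventually)
qed

section \<open>The exponent near infinity and the density of small jumps\<close>

text \<open>The factor \<open>2\<close> accounts for the two half-lines, on which the dominating density \<open>\<phi> \<bar>x\<bar>\<close> agrees.\<close>

lemma nn_integral_levy_dominated_le:
  fixes f :: "real \<Rightarrow> ennreal"
  assumes sets: "sets \<nu> = sets borel"
    and dom: "levy_measure_dominated \<nu> c \<phi>"
    and \<phi>: "\<phi> \<in> borel_measurable (restrict_space borel {0<..c})"
    and f [measurable]: "f \<in> borel_measurable borel"
  shows "(\<integral>\<^sup>+x\<in>{x. 0 < \<bar>x\<bar> \<and> \<bar>x\<bar> \<le> c}. f \<bar>x\<bar> \<partial>\<nu>) \<le> 2 * (\<integral>\<^sup>+x\<in>{0<..c}. ennreal (\<phi> x) * f x \<partial>lborel)"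
proof -
  have [measurable_cong]: "sets \<nu> = sets borel" by (rule sets)
  define I where "I = {x::real. 0 < \<bar>x\<bar> \<and> \<bar>x\<bar> \<le> c}"
  have [measurable]: "I \<in> sets borel" unfolding I_def by measurable
  define g where "g x = ennreal (if x \<in> {0<..c} then \<phi> x else 0)" for x
  have [measurable]: "g \<in> borel_measurable borel"
  proof -
    have "(\<lambda>x. if x \<in> {0<..c} then \<phi> x else 0) \<in> borel_measurable borel"
      using \<phi> by (subst (asm) measurable_restrict_space_iff) auto
    then show ?thesis unfolding g_def by measurable
  qed
  let ?D = "density lborel (\<lambda>x. ennreal (\<phi> \<bar>x\<bar>) * indicator {x. 0 < \<bar>x\<bar> \<and> \<bar>x\<bar> \<le> c} x)"
  have D: "?D = density lborel (\<lambda>x. g \<bar>x\<bar>)"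
    by (intro arg_cong[where f = "density lborel"] ext) (auto simp: g_def indicator_def)
  have "(\<integral>\<^sup>+x\<in>I. f \<bar>x\<bar> \<partial>\<nu>) = (\<integral>\<^sup>+x. f \<bar>x\<bar> \<partial>density \<nu> (indicator I))"
    by (subst nn_integral_density) (auto simp: mult.commute)
  also have "\<dots> \<le> (\<integral>\<^sup>+x. f \<bar>x\<bar> \<partial>?D)"
  proof (rule nn_integral_mono_measure)
    show "density \<nu> (indicator I) \<le> ?D"
      using dom sets unfolding levy_measure_dominated_def I_def
      by (subst le_measure) auto
  qed (simp add: sets)
  also have "\<dots> = (\<integral>\<^sup>+x. g \<bar>x\<bar> * f \<bar>x\<bar> \<partial>lborel)"
    unfolding D by (intro nn_integral_density) auto
  also have "\<dots> = (\<integral>\<^sup>+x. g x * f x + g (- x) * f (- x) \<partial>lborel)"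
    by (intro nn_integral_cong) (auto simp: g_def abs_if)
  also have "\<dots> = (\<integral>\<^sup>+x. g x * f x \<partial>lborel) + (\<integral>\<^sup>+x. g (- x) * f (- x) \<partial>lborel)"
    by (intro nn_integral_add) auto
  also have "(\<integral>\<^sup>+x. g (- x) * f (- x) \<partial>lborel) = (\<integral>\<^sup>+x. g x * f x \<partial>lborel)"
    using nn_integral_real_affine[of "\<lambda>x. g x * f x" "-1" 0] by simp
  also have "(\<integral>\<^sup>+x. g x * f x \<partial>lborel) = (\<integral>\<^sup>+x\<in>{0<..c}. ennreal (\<phi> x) * f x \<partial>lborel)"
    by (intro nn_integral_cong) (auto simp: g_def indicator_def)
  finally show ?thesis unfolding I_def by (simp add: mult_2)
qed

text \<open>Potter bounds replace \<open>l x\<close> by \<open>l y\<close> up to a small power of \<open>x / y\<close>. The exponent \<open>\<delta>\<close> is chosen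
  so small that \<open>r1 + \<delta> < \<beta> < r2 - \<delta>\<close>; the remaining integrals of powers over \<open>(0, y]\<close> and
  \<open>[y, \<infinity>)\<close> then converge, and scaling shows that both are multiples of \<open>y powr (- \<beta>)\<close>.\<close>

lemma potter_kernel_integral:
  fixes l \<phi> :: "real \<Rightarrow> real"
  assumes potter: "potter_bounds c l" and pos: "\<And>x. x \<in> {0<..c} \<Longrightarrow> l x > 0"
    and \<phi>: "\<And>x. x \<in> {0<..c} \<Longrightarrow> \<phi> x = x powr (- \<beta> - 1) * l x"
    and r: "r1 < \<beta>" "\<beta> < r2"
  shows "\<exists>C>0. \<forall>y\<in>{0<..c}.
    (\<integral>\<^sup>+x\<in>{0<..c}. ennreal (\<phi> x) * ennreal (min ((x / y) powr r1) ((x / y) powr r2)) \<partial>lborel)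
      \<le> ennreal (C * (y powr (- \<beta>) * l y))"
proof -
  define \<delta> where "\<delta> = min (\<beta> - r1) (r2 - \<beta>) / 2"
  have \<delta>: "\<delta> > 0" using r by (simp add: \<delta>_def)
  \<comment> \<open>The integrands on the two pieces are \<open>x powr (- e1 - 1)\<close> and \<open>x powr (e2 - 1)\<close>.\<close>
  define e1 where "e1 = \<beta> - r1 - \<delta>"
  define e2 where "e2 = r2 - \<beta> - \<delta>"
  have e: "e1 > 0" "e2 > 0" using r by (auto simp: e1_def e2_def \<delta>_def min_def)
  obtain C where C: "C > 0" and P: "\<And>x y. x \<in> {0<..c} \<Longrightarrow> y \<in> {0<..c} \<Longrightarrow>
      l x \<le> C * max ((x / y) powr \<delta>) ((y / x) powr \<delta>) * l y"
    using potter \<delta> unfolding potter_bounds_def by blast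
  show ?thesis
  proof (intro exI[of _ "C * (1 / e2 + 1 / e1)"] conjI ballI)
    show "C * (1 / e2 + 1 / e1) > 0" using C e by (simp add: add_pos_pos)
    fix y assume y: "y \<in> {0<..c}"
    have ly: "l y > 0" by (rule pos[OF y])
    define K1 where "K1 = C * l y * y powr (- r1 - \<delta>)"
    define K2 where "K2 = C * l y * y powr (\<delta> - r2)"
    have K: "K1 \<ge> 0" "K2 \<ge> 0" using C ly by (auto simp: K1_def K2_def)
    have small: "\<phi> x * min ((x / y) powr r1) ((x / y) powr r2) \<le> K2 * x powr (e2 - 1)"
      if x: "x \<in> {0<..c}" "x \<le> y" for x
    proof -
      have "x / y \<le> y / x" using x by (simp add: frac_le_eq divide_le_eq field_simps mult_mono)
      then have "(x / y) powr \<delta> \<le> (y / x) powr \<delta>" using x \<delta> by (intro powr_mono2) auto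
      then have "l x \<le> C * (y / x) powr \<delta> * l y" using P[OF x(1) y] by (simp add: max_def)
      then have "\<phi> x * min ((x / y) powr r1) ((x / y) powr r2)
          \<le> (x powr (- \<beta> - 1) * (C * (y / x) powr \<delta> * l y)) * (x / y) powr r2"
        using \<phi>[OF x(1)] pos[OF x(1)] by (intro mult_mono) (auto intro: mult_left_mono)
      also have "\<dots> = K2 * (x powr (- \<beta> - 1) * x powr (- \<delta>) * x powr r2)"
        using x y by (simp add: K2_def powr_divide powr_diff powr_minus field_simps)
      also have "x powr (- \<beta> - 1) * x powr (- \<delta>) * x powr r2 = x powr (e2 - 1)"
        by (simp add: e2_def powr_add[symmetric] algebra_simps)
      finally show ?thesis .
    qed
    have large: "\<phi> x * min ((x / y) powr r1) ((x / y) powr r2) \<le> K1 * x powr (- e1 - 1)"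
      if x: "x \<in> {0<..c}" "y \<le> x" for x
    proof -
      have "y / x \<le> x / y" using x y by (simp add: field_simps mult_mono)
      then have "(y / x) powr \<delta> \<le> (x / y) powr \<delta>" using x y \<delta> by (intro powr_mono2) auto
      then have "l x \<le> C * (x / y) powr \<delta> * l y" using P[OF x(1) y] by (simp add: max_def)
      then have "\<phi> x * min ((x / y) powr r1) ((x / y) powr r2)
          \<le> (x powr (- \<beta> - 1) * (C * (x / y) powr \<delta> * l y)) * (x / y) powr r1"
        using \<phi>[OF x(1)] pos[OF x(1)] by (intro mult_mono) (auto intro: mult_left_mono)
      also have "\<dots> = K1 * (x powr (- \<beta> - 1) * x powr \<delta> * x powr r1)"
        using x y by (simp add: K1_def powr_divide powr_diff powr_minus field_simps)
      also have "x powr (- \<beta> - 1) * x powr \<delta> * x powr r1 = x powr (- e1 - 1)"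
        by (simp add: e1_def powr_add[symmetric] algebra_simps)
      finally show ?thesis .
    qed
    have "(\<integral>\<^sup>+x\<in>{0<..c}. ennreal (\<phi> x) * ennreal (min ((x / y) powr r1) ((x / y) powr r2)) \<partial>lborel)
      \<le> (\<integral>\<^sup>+x. ennreal K2 * (ennreal (x powr (e2 - 1)) * indicator {0<..y} x)
           + ennreal K1 * (ennreal (x powr (- e1 - 1)) * indicator {y..} x) \<partial>lborel)"
    proof (intro nn_integral_mono)
      fix x :: real
      show "ennreal (\<phi> x) * ennreal (min ((x / y) powr r1) ((x / y) powr r2)) * indicator {0<..c} x
        \<le> ennreal K2 * (ennreal (x powr (e2 - 1)) * indicator {0<..y} x)
           + ennreal K1 * (ennreal (x powr (- e1 - 1)) * indicator {y..} x)"
      proof (cases "x \<in> {0<..c}")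
        case x: True
        have lhs: "ennreal (\<phi> x) * ennreal (min ((x / y) powr r1) ((x / y) powr r2)) * indicator {0<..c} x
          = ennreal (\<phi> x * min ((x / y) powr r1) ((x / y) powr r2))"
          using x pos[OF x] \<phi>[OF x] by (subst ennreal_mult) auto
        show ?thesis
        proof (cases "x \<le> y")
          case True
          have "ennreal (\<phi> x * min ((x / y) powr r1) ((x / y) powr r2)) \<le> ennreal (K2 * x powr (e2 - 1))"
            by (intro ennreal_leI small x True)
          also have "\<dots> = ennreal K2 * (ennreal (x powr (e2 - 1)) * indicator {0<..y} x)"
            using x True K by (simp add: ennreal_mult)
          finally show ?thesis unfolding lhs by (rule order_trans) simp
        next
          case False
          then have "ennreal (\<phi> x * min ((x / y) powr r1) ((x / y) powr r2)) \<le> ennreal (K1 * x powr (- e1 - 1))"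
            by (intro ennreal_leI large x) auto
          also have "\<dots> = ennreal K1 * (ennreal (x powr (- e1 - 1)) * indicator {y..} x)"
            using x False K by (simp add: ennreal_mult)
          finally show ?thesis unfolding lhs by (rule order_trans) simp
        qed
      qed auto
    qed
    also have "\<dots> = ennreal K2 * (\<integral>\<^sup>+x\<in>{0<..y}. ennreal (x powr (e2 - 1)) \<partial>lborel)
        + ennreal K1 * (\<integral>\<^sup>+x\<in>{y..}. ennreal (x powr (- e1 - 1)) \<partial>lborel)"
      by (subst nn_integral_add) (auto simp: nn_integral_cmult)
    also have "\<dots> = ennreal K2 * ennreal (y powr e2 / e2) + ennreal K1 * ennreal (y powr (- e1) / e1)"
      using y e by (subst nn_integral_powr_Ioc, simp, simp, subst nn_integral_powr_Ici) auto
    also have "\<dots> = ennreal (K2 * (y powr e2 / e2) + K1 * (y powr (- e1) / e1))"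
    proof -
      have "0 \<le> y powr e2 / e2" "0 \<le> y powr (- e1) / e1" using e by auto
      with K show ?thesis by (simp only: ennreal_mult ennreal_plus mult_nonneg_nonneg)
    qed
    also have "K2 * (y powr e2 / e2) + K1 * (y powr (- e1) / e1)
      = C * l y * ((y powr (\<delta> - r2) * y powr e2) / e2 + (y powr (- r1 - \<delta>) * y powr (- e1)) / e1)"
      by (simp add: K1_def K2_def algebra_simps)
    also have "y powr (\<delta> - r2) * y powr e2 = y powr (- \<beta>)"
      by (simp add: e2_def flip: powr_add)
    also have "y powr (- r1 - \<delta>) * y powr (- e1) = y powr (- \<beta>)"
      by (simp add: e1_def flip: powr_add)
    also have "C * l y * (y powr (- \<beta>) / e2 + y powr (- \<beta>) / e1) = C * (1 / e2 + 1 / e1) * (y powr (- \<beta>) * l y)"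
      by (simp add: algebra_simps)
    finally show "(\<integral>\<^sup>+x\<in>{0<..c}. ennreal (\<phi> x) * ennreal (min ((x / y) powr r1) ((x / y) powr r2)) \<partial>lborel)
      \<le> ennreal (C * (1 / e2 + 1 / e1) * (y powr (- \<beta>) * l y))" .
  qed
qed

text \<open>A Potter bound with exponent \<open>\<beta> - s\<close> between \<open>c\<close> and \<open>y\<close>: a slowly varying factor cannot
  compensate a difference in the powers.\<close>

lemma powr_le_regularly_varying:
  fixes l :: "real \<Rightarrow> real"
  assumes potter: "potter_bounds c l" and pos: "\<And>x. x \<in> {0<..c} \<Longrightarrow> l x > 0"
    and c: "0 < c" "c \<le> 1" and s: "s < \<beta>"
  shows "\<exists>C>0. \<forall>y\<in>{0<..c}. y powr (- s) \<le> C * (y powr (- \<beta>) * l y)"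
proof -
  have "\<beta> - s > 0" using s by simp
  then obtain C where C: "C > 0" and P: "\<And>x y. x \<in> {0<..c} \<Longrightarrow> y \<in> {0<..c} \<Longrightarrow>
      l x \<le> C * max ((x / y) powr (\<beta> - s)) ((y / x) powr (\<beta> - s)) * l y"
    using potter unfolding potter_bounds_def by blast
  have lc: "l c > 0" using c by (intro pos) auto
  show ?thesis
  proof (intro exI[of _ "C / l c"] conjI ballI)
    show "C / l c > 0" using C lc by simp
    fix y assume y: "y \<in> {0<..c}"
    have ly: "l y > 0" by (rule pos[OF y])
    have "y / c \<le> 1" "1 \<le> 1 / y" using y c by auto
    then have "y / c \<le> 1 / y" by linarith
    then have "(c / y) powr (\<beta> - s) \<le> (1 / y) powr (\<beta> - s)" "(y / c) powr (\<beta> - s) \<le> (1 / y) powr (\<beta> - s)"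
      using y c s by (auto intro!: powr_mono2 divide_right_mono)
    then have "max ((c / y) powr (\<beta> - s)) ((y / c) powr (\<beta> - s)) \<le> y powr (s - \<beta>)"
      using y by (simp add: powr_divide powr_diff)
    then have "C * max ((c / y) powr (\<beta> - s)) ((y / c) powr (\<beta> - s)) * l y \<le> C * y powr (s - \<beta>) * l y"
      using C ly by (intro mult_right_mono mult_left_mono) auto
    then have "l c \<le> C * y powr (s - \<beta>) * l y" using P[of c y] y c by auto
    then have "y powr (- s) * l c \<le> y powr (- s) * (C * y powr (s - \<beta>) * l y)"
      by (intro mult_left_mono) auto
    also have "\<dots> = C * (y powr (- \<beta>) * l y)"
      using y by (simp add: powr_diff powr_minus field_simps)
    finally show "y powr (- s) \<le> C / l c * (y powr (- \<beta>) * l y)"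
      using lc by (simp add: field_simps)
  qed
qed

text \<open>The exponents \<open>r1\<close> and \<open>r2\<close> describe the growth in \<open>\<bar>x\<bar> / y\<close> for jumps larger and smaller than
  \<open>y\<close>, respectively. The value \<open>0\<close> at \<open>x = 0\<close> reflects that the integrands vanish there.\<close>

definition levy_majorant :: "real \<Rightarrow> real \<Rightarrow> real \<Rightarrow> real \<Rightarrow> real \<Rightarrow> real \<Rightarrow> real" where
  "levy_majorant c r1 r2 s y x =
     (if x = 0 then 0
      else if \<bar>x\<bar> \<le> c then 4 * min ((\<bar>x\<bar> / y) powr r1) ((\<bar>x\<bar> / y) powr r2)
      else 4 * y powr (- s))"

lemma levy_majorantI:
  assumes "f 0 \<le> 0"
    and "\<And>x. 0 < \<bar>x\<bar> \<Longrightarrow> \<bar>x\<bar> \<le> c \<Longrightarrow> f x \<le> 4 * min ((\<bar>x\<bar> / y) powr r1) ((\<bar>x\<bar> / y) powr r2)"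
    and "\<And>x. c < \<bar>x\<bar> \<Longrightarrow> f x \<le> 4 * y powr (- s)"
  shows "\<forall>x. f x \<le> levy_majorant c r1 r2 s y x"
  using assms by (auto simp: levy_majorant_def)

text \<open>The jumps of size at most \<open>c\<close> are handled by \<open>potter_kernel_integral\<close>. The set of larger jumps
  has finite measure, and there the majorant is of lower order by \<open>powr_le_regularly_varying\<close>.\<close>

lemma levy_integral_le_of_majorant:
  fixes l \<phi> :: "real \<Rightarrow> real"
  assumes \<nu>: "levy_measure \<nu>" and dom: "levy_measure_dominated \<nu> c \<phi>"
    and \<phi>m: "\<phi> \<in> borel_measurable (restrict_space borel {0<..c})"
    and \<phi>: "\<And>x. x \<in> {0<..c} \<Longrightarrow> \<phi> x = x powr (- \<beta> - 1) * l x"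
    and potter: "potter_bounds c l" and pos: "\<And>x. x \<in> {0<..c} \<Longrightarrow> l x > 0"
    and c: "0 < c" "c \<le> 1" and r: "r1 < \<beta>" "\<beta> < r2" and s: "s < \<beta>"
  shows "\<exists>C>0. \<forall>y\<in>{0<..c}. \<forall>f. (\<forall>x. f x \<le> levy_majorant c r1 r2 s y x) \<longrightarrow>
     (\<integral>x. f x \<partial>\<nu>) \<le> C * (y powr (- \<beta>) * l y)"
proof -
  have sets: "sets \<nu> = sets borel" using \<nu> by (simp add: levy_measure_def)
  have [measurable_cong]: "sets \<nu> = sets borel" by (rule sets)
  obtain C1 where C1: "C1 > 0" "\<And>y. y \<in> {0<..c} \<Longrightarrow>
      (\<integral>\<^sup>+x\<in>{0<..c}. ennreal (\<phi> x) * ennreal (min ((x / y) powr r1) ((x / y) powr r2)) \<partial>lborel)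
      \<le> ennreal (C1 * (y powr (- \<beta>) * l y))"
    using potter_kernel_integral[OF potter pos \<phi> r] by blast
  obtain C2 where C2: "C2 > 0" "\<And>y. y \<in> {0<..c} \<Longrightarrow> y powr (- s) \<le> C2 * (y powr (- \<beta>) * l y)"
    using powr_le_regularly_varying[OF potter pos c s] by blast
  define m where "m = (\<integral>x. min (x\<^sup>2) 1 \<partial>\<nu>)"
  have m0: "m \<ge> 0" unfolding m_def by (intro Bochner_Integration.integral_nonneg) auto
  have m: "(\<integral>\<^sup>+x. ennreal (min (x\<^sup>2) 1) \<partial>\<nu>) = ennreal m"
    unfolding m_def by (intro nn_integral_eq_integral integrable_levy_min[OF \<nu>]) auto
  show ?thesis
  proof (intro exI[of _ "8 * C1 + 4 * C2 * (m / c\<^sup>2)"] conjI ballI allI impI)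
    show "8 * C1 + 4 * C2 * (m / c\<^sup>2) > 0" using C1 C2 m0 by (simp add: add_pos_nonneg)
    fix y and f :: "real \<Rightarrow> real"
    assume y: "y \<in> {0<..c}" and f: "\<forall>x. f x \<le> levy_majorant c r1 r2 s y x"
    define h where "h = y powr (- \<beta>) * l y"
    have h: "h > 0" using y pos[OF y] by (simp add: h_def)
    let ?k = "\<lambda>x. ennreal (min ((x / y) powr r1) ((x / y) powr r2))"
    let ?I = "{x. 0 < \<bar>x\<bar> \<and> \<bar>x\<bar> \<le> c} :: real set"
    have "(\<integral>\<^sup>+x. ennreal (f x) \<partial>\<nu>)
        \<le> (\<integral>\<^sup>+x. 4 * (?k \<bar>x\<bar> * indicator ?I x) + ennreal (4 * y powr (- s) / c\<^sup>2) * ennreal (min (x\<^sup>2) 1) \<partial>\<nu>)"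
    proof (intro nn_integral_mono)
      fix x :: real
      consider "x = 0" | "x \<in> ?I" | "c < \<bar>x\<bar>" by fastforce
      then show "ennreal (f x) \<le> 4 * (?k \<bar>x\<bar> * indicator ?I x)
          + ennreal (4 * y powr (- s) / c\<^sup>2) * ennreal (min (x\<^sup>2) 1)"
      proof cases
        case 1
        then have "f x \<le> 0" using f[rule_format, of x] by (simp add: levy_majorant_def)
        then show ?thesis by (simp add: ennreal_neg)
      next
        case 2
        then have "ennreal (f x) \<le> ennreal (4 * min ((\<bar>x\<bar> / y) powr r1) ((\<bar>x\<bar> / y) powr r2))"
          using f[rule_format, of x] c by (intro ennreal_leI) (auto simp: levy_majorant_def)
        also have "\<dots> = 4 * (?k \<bar>x\<bar> * indicator ?I x)"
          using 2 by (subst ennreal_mult) auto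
        finally show ?thesis by (rule order_trans) simp
      next
        case 3
        have "c\<^sup>2 \<le> min (x\<^sup>2) 1"
          using 3 c by (auto simp: abs_square_le_1 intro: abs_le_square_iff[THEN iffD1] )
        then have "4 * y powr (- s) * 1 \<le> 4 * y powr (- s) * (min (x\<^sup>2) 1 / c\<^sup>2)"
          using c by (intro mult_left_mono) auto
        moreover have "f x \<le> 4 * y powr (- s)"
          using f[rule_format, of x] 3 c by (auto simp: levy_majorant_def split: if_splits)
        ultimately have "ennreal (f x) \<le> ennreal (4 * y powr (- s) / c\<^sup>2 * min (x\<^sup>2) 1)"
          by (intro ennreal_leI) simp
        also have "\<dots> = ennreal (4 * y powr (- s) / c\<^sup>2) * ennreal (min (x\<^sup>2) 1)"
          by (rule ennreal_mult) auto
        finally show ?thesis by (rule order_trans) simp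
      qed
    qed
    also have "\<dots> = 4 * (\<integral>\<^sup>+x\<in>?I. ?k \<bar>x\<bar> \<partial>\<nu>) + ennreal (4 * y powr (- s) / c\<^sup>2) * ennreal m"
      by (subst nn_integral_add) (auto simp: nn_integral_cmult m)
    also have "\<dots> \<le> 4 * (2 * ennreal (C1 * h)) + ennreal (4 * (C2 * h) / c\<^sup>2) * ennreal m"
    proof (intro add_mono mult_left_mono mult_right_mono)
      have "(\<integral>\<^sup>+x\<in>?I. ?k \<bar>x\<bar> \<partial>\<nu>) \<le> 2 * (\<integral>\<^sup>+x\<in>{0<..c}. ennreal (\<phi> x) * ?k x \<partial>lborel)"
        by (rule nn_integral_levy_dominated_le[OF sets dom \<phi>m]) simp
      also have "\<dots> \<le> 2 * ennreal (C1 * h)"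
        unfolding h_def by (intro mult_left_mono C1(2) y) auto
      finally show "(\<integral>\<^sup>+x\<in>?I. ?k \<bar>x\<bar> \<partial>\<nu>) \<le> 2 * ennreal (C1 * h)" .
      show "ennreal (4 * y powr (- s) / c\<^sup>2) \<le> ennreal (4 * (C2 * h) / c\<^sup>2)"
        using C2(2)[OF y] by (intro ennreal_leI divide_right_mono) (auto simp: h_def)
    qed auto
    also have "\<dots> = ennreal ((8 * C1 + 4 * C2 * (m / c\<^sup>2)) * h)"
    proof -
      have "4 * (2 * ennreal (C1 * h)) = ennreal (8 * (C1 * h))"
        using C1 h by (subst ennreal_mult) (auto simp: mult.assoc[symmetric])
      moreover have "ennreal (4 * (C2 * h) / c\<^sup>2) * ennreal m = ennreal (4 * (C2 * h) / c\<^sup>2 * m)"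
        using C2 h m0 by (intro ennreal_mult[symmetric]) auto
      moreover have "ennreal (8 * (C1 * h)) + ennreal (4 * (C2 * h) / c\<^sup>2 * m)
          = ennreal (8 * (C1 * h) + 4 * (C2 * h) / c\<^sup>2 * m)"
        using C1 C2 h m0 by (intro ennreal_plus[symmetric]) auto
      ultimately show ?thesis by (simp add: algebra_simps)
    qed
    finally have "(\<integral>\<^sup>+x. ennreal (f x) \<partial>\<nu>) \<le> ennreal ((8 * C1 + 4 * C2 * (m / c\<^sup>2)) * h)" .
    then show "(\<integral>x. f x \<partial>\<nu>) \<le> (8 * C1 + 4 * C2 * (m / c\<^sup>2)) * (y powr (- \<beta>) * l y)"
      using C1 C2 h m0 unfolding h_def[symmetric] by (intro integral_real_bounded) auto
  qed
qed

text \<open>The frequency is written as \<open>1 / y\<close>, so that \<open>y\<close> is the size of the jumps that it resolves. The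
  three drifts reduce the integrand to one of the combinations in \<open>kernel_bounds\<close>: compensated jumps
  for \<open>\<beta> > 1\<close>, plain jumps for \<open>\<beta> < 1\<close>, and complete cancellation by symmetry for \<open>\<beta> = 1\<close>. For
  \<open>\<beta> > 1\<close> the drift \<open>a\<close> and the compensator of the jumps between \<open>c\<close> and \<open>1\<close> leave a term of order
  \<open>1 / y\<close>, which is of lower order than \<open>y powr (- \<beta>) * l y\<close>.\<close>

lemma levy_exponent_le_near_infinity:
  fixes l \<phi> :: "real \<Rightarrow> real"
  assumes \<nu>: "levy_measure \<nu>" and dom: "levy_measure_dominated \<nu> c \<phi>"
    and \<phi>m: "\<phi> \<in> borel_measurable (restrict_space borel {0<..c})"
    and \<phi>: "\<And>x. x \<in> {0<..c} \<Longrightarrow> \<phi> x = x powr (- \<beta> - 1) * l x"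
    and potter: "potter_bounds c l" and pos: "\<And>x. x \<in> {0<..c} \<Longrightarrow> l x > 0"
    and c: "0 < c" "c \<le> 1" and \<beta>: "0 < \<beta>" "\<beta> < 2" and d: "drift_case a \<beta> \<nu> d"
  shows "\<exists>C>0. \<forall>y\<in>{0<..c}. levy_re \<nu> (1 / y) + \<bar>levy_im a d \<nu> (1 / y)\<bar> \<le> C * (y powr (- \<beta>) * l y)"
proof -
  note kernel = levy_integral_le_of_majorant[where \<phi> = \<phi> and l = l, OF \<nu> dom \<phi>m \<phi> potter pos c]
  have sym: "cos (x / y) = cos (\<bar>x\<bar> / y)" "\<bar>sin (x / y)\<bar> = \<bar>sin (\<bar>x\<bar> / y)\<bar>"
    "\<bar>sin (x / y) - x / y\<bar> = \<bar>sin (\<bar>x\<bar> / y) - \<bar>x\<bar> / y\<bar>" for x y :: real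
    by (auto simp: abs_if)
  have two: "1 - cos z \<le> 2" for z :: real using cos_ge_minus_one[of z] by linarith
  have ic: "integrable \<nu> (\<lambda>x. 1 - cos (x / y))" for y
    using integrable_one_minus_cos[OF \<nu>, of "1 / y"] by simp
  have one: "1 \<le> 1 / y" if "y \<in> {0<..c}" for y using that c by simp
  consider (gt) "\<beta> > 1" "d = 0" | (lt) "\<beta> < 1" "set_integrable \<nu> {-1..1} (\<lambda>x. x)" "d = a - (LINT x:{-1..1}|\<nu>. x)"
    | (eq) "\<beta> = 1" "symmetric_measure \<nu>" "d = a"
    using d by (auto simp: drift_case_def)
  then show ?thesis
  proof cases
    case gt
    obtain C where C: "C > 0" and K: "\<And>y f. y \<in> {0<..c} \<Longrightarrow> \<forall>x. f x \<le> levy_majorant c 1 2 1 y x \<Longrightarrow>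
        (\<integral>x. f x \<partial>\<nu>) \<le> C * (y powr (- \<beta>) * l y)"
      using kernel[OF _ _ gt(1) \<beta>(2) gt(1)] by blast
    obtain C2 where C2: "C2 > 0" "\<And>y. y \<in> {0<..c} \<Longrightarrow> y powr (- 1) \<le> C2 * (y powr (- \<beta>) * l y)"
      using powr_le_regularly_varying[OF potter pos c gt(1)] by blast
    show ?thesis
    proof (intro exI[of _ "C + \<bar>a\<bar> * C2"] conjI ballI)
      show "C + \<bar>a\<bar> * C2 > 0" using C C2 by (simp add: add_pos_nonneg)
      fix y assume y: "y \<in> {0<..c}"
      let ?g = "\<lambda>x. sin (x / y) - x / y * indicator {-1..1} x"
      have ig: "integrable \<nu> ?g" using integrable_sin_compensated[OF \<nu>, of "1 / y"] by simp
      have "\<bar>\<integral>x. ?g x \<partial>\<nu>\<bar> \<le> (\<integral>x. \<bar>?g x\<bar> \<partial>\<nu>)"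
        using ig by (intro abs_integral_le) auto
      moreover have "\<bar>levy_im a d \<nu> (1 / y)\<bar> \<le> \<bar>a\<bar> / y + \<bar>\<integral>x. ?g x \<partial>\<nu>\<bar>"
        using abs_triangle_ineq4[of "- (a / y)" "\<integral>x. ?g x \<partial>\<nu>"] y gt by (simp add: levy_im_def)
      moreover have "levy_re \<nu> (1 / y) = (\<integral>x. 1 - cos (x / y) \<partial>\<nu>)" by (simp add: levy_re_def)
      ultimately have "levy_re \<nu> (1 / y) + \<bar>levy_im a d \<nu> (1 / y)\<bar>
          \<le> (\<integral>x. 1 - cos (x / y) \<partial>\<nu>) + ((\<integral>x. \<bar>?g x\<bar> \<partial>\<nu>) + \<bar>a\<bar> / y)"
        by linarith
      also have "\<dots> = (\<integral>x. 1 - cos (x / y) + \<bar>?g x\<bar> \<partial>\<nu>) + \<bar>a\<bar> / y"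
        using ic ig by (subst Bochner_Integration.integral_add) auto
      also have "(\<integral>x. 1 - cos (x / y) + \<bar>?g x\<bar> \<partial>\<nu>) \<le> C * (y powr (- \<beta>) * l y)"
      proof (rule K[OF y], rule levy_majorantI)
        fix x :: real assume "0 < \<bar>x\<bar>" "\<bar>x\<bar> \<le> c"
        then show "1 - cos (x / y) + \<bar>?g x\<bar> \<le> 4 * min ((\<bar>x\<bar> / y) powr 1) ((\<bar>x\<bar> / y) powr 2)"
          using kernel_bounds(1)[of "\<bar>x\<bar> / y"] y c sym[of x y] by (auto simp: indicator_def abs_le_iff)
      next
        fix x :: real assume "c < \<bar>x\<bar>"
        have "\<bar>x / y * indicator {-1..1} x\<bar> \<le> 1 / y"
          using y by (auto simp: indicator_def abs_le_iff divide_right_mono)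
        then have "\<bar>?g x\<bar> \<le> 1 + 1 / y"
          by (intro order_trans[OF abs_triangle_ineq4 add_mono[OF abs_sin_le_one]])
        then have "1 - cos (x / y) + \<bar>?g x\<bar> \<le> 2 + (1 + 1 / y)"
          by (intro add_mono two)
        also have "\<dots> \<le> 4 * (1 / y)" using one[OF y] by linarith
        finally have "1 - cos (x / y) + \<bar>?g x\<bar> \<le> 4 * (1 / y)" .
        then show "1 - cos (x / y) + \<bar>?g x\<bar> \<le> 4 * y powr (- 1)"
          using y by (simp add: powr_minus_divide)
      qed auto
      also have "\<bar>a\<bar> / y \<le> \<bar>a\<bar> * (C2 * (y powr (- \<beta>) * l y))"
        using mult_left_mono[OF C2(2)[OF y], of "\<bar>a\<bar>"] y by (simp add: powr_minus_divide)
      finally show "levy_re \<nu> (1 / y) + \<bar>levy_im a d \<nu> (1 / y)\<bar> \<le> (C + \<bar>a\<bar> * C2) * (y powr (- \<beta>) * l y)"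
        by (simp add: algebra_simps)
    qed
  next
    case lt
    obtain C where C: "C > 0" and K: "\<And>y f. y \<in> {0<..c} \<Longrightarrow> \<forall>x. f x \<le> levy_majorant c 0 1 0 y x \<Longrightarrow>
        (\<integral>x. f x \<partial>\<nu>) \<le> C * (y powr (- \<beta>) * l y)"
      using kernel[OF _ _ \<beta>(1) lt(1) \<beta>(1)] by blast
    show ?thesis
    proof (intro exI[of _ C] conjI ballI C)
      fix y assume y: "y \<in> {0<..c}"
      have ig: "integrable \<nu> (\<lambda>x. sin (x / y))"
        using levy_im_finite_variation(1)[OF \<nu> lt(2), of "1 / y"] by simp
      have "\<bar>\<integral>x. sin (x / y) \<partial>\<nu>\<bar> \<le> (\<integral>x. \<bar>sin (x / y)\<bar> \<partial>\<nu>)"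
        using ig by (intro abs_integral_le) auto
      then have "levy_re \<nu> (1 / y) + \<bar>levy_im a d \<nu> (1 / y)\<bar>
          \<le> (\<integral>x. 1 - cos (x / y) \<partial>\<nu>) + (\<integral>x. \<bar>sin (x / y)\<bar> \<partial>\<nu>)"
        using levy_im_finite_variation(2)[OF \<nu> lt(2), of a "1 / y"] lt(3) by (simp add: levy_re_def)
      also have "\<dots> = (\<integral>x. 1 - cos (x / y) + \<bar>sin (x / y)\<bar> \<partial>\<nu>)"
        using ic ig by (subst Bochner_Integration.integral_add) auto
      also have "\<dots> \<le> C * (y powr (- \<beta>) * l y)"
      proof (rule K[OF y], rule levy_majorantI)
        fix x :: real assume "0 < \<bar>x\<bar>" "\<bar>x\<bar> \<le> c"
        then show "1 - cos (x / y) + \<bar>sin (x / y)\<bar> \<le> 4 * min ((\<bar>x\<bar> / y) powr 0) ((\<bar>x\<bar> / y) powr 1)"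
          using kernel_bounds(2)[of "\<bar>x\<bar> / y"] y sym[of x y] by simp
      next
        fix x :: real
        have "1 - cos (x / y) + \<bar>sin (x / y)\<bar> \<le> 2 + 1"
          by (intro add_mono two abs_sin_le_one)
        then show "1 - cos (x / y) + \<bar>sin (x / y)\<bar> \<le> 4 * y powr (- 0)"
          using y by simp
      qed auto
      finally show "levy_re \<nu> (1 / y) + \<bar>levy_im a d \<nu> (1 / y)\<bar> \<le> C * (y powr (- \<beta>) * l y)" .
    qed
  next
    case eq
    obtain C where C: "C > 0" and K: "\<And>y f. y \<in> {0<..c} \<Longrightarrow> \<forall>x. f x \<le> levy_majorant c 0 2 0 y x \<Longrightarrow>
        (\<integral>x. f x \<partial>\<nu>) \<le> C * (y powr (- \<beta>) * l y)"
      using kernel[OF _ _ \<beta>(1) \<beta>(2) \<beta>(1)] by blast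
    show ?thesis
    proof (intro exI[of _ C] conjI ballI C)
      fix y assume y: "y \<in> {0<..c}"
      have "levy_re \<nu> (1 / y) + \<bar>levy_im a d \<nu> (1 / y)\<bar> = (\<integral>x. 1 - cos (x / y) \<partial>\<nu>)"
        using levy_im_symmetric[OF \<nu> eq(2)] eq(3) by (simp add: levy_re_def)
      also have "\<dots> \<le> C * (y powr (- \<beta>) * l y)"
      proof (rule K[OF y], rule levy_majorantI)
        fix x :: real assume "0 < \<bar>x\<bar>" "\<bar>x\<bar> \<le> c"
        then show "1 - cos (x / y) \<le> 4 * min ((\<bar>x\<bar> / y) powr 0) ((\<bar>x\<bar> / y) powr 2)"
          using kernel_bounds(3)[of "\<bar>x\<bar> / y"] y sym[of x y] by simp
      next
        fix x :: real assume "c < \<bar>x\<bar>"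
        then show "1 - cos (x / y) \<le> 4 * y powr (- 0)"
          using order_trans[OF two, of 4 "x / y"] y by simp
      qed auto
      finally show "levy_re \<nu> (1 / y) + \<bar>levy_im a d \<nu> (1 / y)\<bar> \<le> C * (y powr (- \<beta>) * l y)" .
    qed
  qed
qed

text \<open>The case \<open>\<beta> = 2\<close>, in which the bound by \<open>\<phi>\<close> may fail to be integrable against \<open>x\<^sup>2\<close> at zero; the
  integrability condition in the definition of a Levy measure takes its place.\<close>

lemma levy_exponent_le_square:
  assumes \<nu>: "levy_measure \<nu>" and y: "0 < y" "y \<le> 1"
  shows "levy_re \<nu> (1 / y) + \<bar>levy_im a 0 \<nu> (1 / y)\<bar> \<le> (5 * (\<integral>x. min (x\<^sup>2) 1 \<partial>\<nu>) + \<bar>a\<bar>) * y powr (- 2)"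
proof -
  define m where "m = (\<integral>x. min (x\<^sup>2) 1 \<partial>\<nu>)"
  define V where "V = 1 / y"
  have V: "1 \<le> V" using y by (simp add: V_def)
  then have V2: "1 \<le> V\<^sup>2" "V \<le> V\<^sup>2" by (auto intro: one_le_power self_le_power)
  have m0: "m \<ge> 0" unfolding m_def by (intro Bochner_Integration.integral_nonneg) auto
  let ?g = "\<lambda>x. sin (V * x) - V * x * indicator {-1..1} x"
  have "\<bar>\<integral>x. ?g x \<partial>\<nu>\<bar> \<le> (\<integral>x. (V\<^sup>2 + 1) * min (x\<^sup>2) 1 \<partial>\<nu>)"
    using integrable_levy_min[OF \<nu>]
    by (intro abs_integral_le integrable_sin_compensated[OF \<nu>] abs_sin_compensated_le_min) auto
  then have "\<bar>\<integral>x. ?g x \<partial>\<nu>\<bar> \<le> (V\<^sup>2 + 1) * m" by (simp add: m_def)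
  moreover have "(V\<^sup>2 + 1) * m \<le> (2 * V\<^sup>2) * m" using V2 m0 by (intro mult_right_mono) auto
  moreover have "\<bar>V * a\<bar> \<le> V\<^sup>2 * \<bar>a\<bar>" using V V2 by (simp add: abs_mult mult_right_mono)
  moreover have "levy_re \<nu> V \<le> (V\<^sup>2 + 2) * m" unfolding m_def by (rule levy_re_le[OF \<nu>])
  moreover have "(V\<^sup>2 + 2) * m \<le> (3 * V\<^sup>2) * m" using V2 m0 by (intro mult_right_mono) auto
  moreover have "\<bar>levy_im a 0 \<nu> V\<bar> \<le> \<bar>V * a\<bar> + \<bar>\<integral>x. ?g x \<partial>\<nu>\<bar>"
    using abs_triangle_ineq4[of "V * (0 - a)" "\<integral>x. ?g x \<partial>\<nu>"] by (simp add: levy_im_def)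
  ultimately have "levy_re \<nu> V + \<bar>levy_im a 0 \<nu> V\<bar> \<le> (3 * V\<^sup>2) * m + ((2 * V\<^sup>2) * m + V\<^sup>2 * \<bar>a\<bar>)"
    by linarith
  also have "\<dots> = (5 * m + \<bar>a\<bar>) * V\<^sup>2" by (simp add: algebra_simps)
  also have "V\<^sup>2 = y powr (- 2)" using y by (simp add: V_def powr_minus_divide powr_numeral power_divide)
  finally show ?thesis by (simp add: V_def m_def)
qed

section \<open>The moment bound and the choice of the cut-off\<close>

text \<open>The function \<open>G\<close> below is the sum of the bounds \<open>g1\<close>, \<open>g2\<close> and \<open>2\<close> for \<open>1 - Re char\<close> on the three
  ranges of frequencies, where \<open>l (1 / v)\<close> has already been replaced by a power of \<open>v\<close> times \<open>l y\<close>.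
  The exponent \<open>\<delta> = (\<beta> - p) / 2\<close> leaves the integrable power \<open>v powr (\<delta> - 1)\<close> in the middle range.\<close>

lemma sup_moment_le_powr:
  fixes l :: "real \<Rightarrow> real"
  assumes levy: "levy_process M X" and ch: "has_characteristics M X a 0 \<nu>"
    and p: "0 < p" "p < \<beta>" and \<beta>: "\<beta> \<le> 2"
    and int: "integrable M (\<lambda>\<omega>. \<bar>X 1 \<omega>\<bar> powr p)"
    and d: "drift_case a \<beta> \<nu> d"
    and potter: "potter_bounds c l" and pos: "\<And>x. x \<in> {0<..c} \<Longrightarrow> l x > 0"
    and c: "0 < c" "c \<le> 1"
    and large: "\<exists>C>0. \<forall>y\<in>{0<..c}. levy_re \<nu> (1 / y) + \<bar>levy_im a d \<nu> (1 / y)\<bar> \<le> C * (y powr (- \<beta>) * l y)"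
  shows "\<exists>C>0. \<forall>t\<in>{0<..1}. \<forall>y\<in>{0<..c}. t * l y \<le> y powr \<beta> \<longrightarrow>
    sup_moment M (\<lambda>s \<omega>. X s \<omega> - s * d) p t \<le> ennreal (C * y powr p)"
proof -
  have \<nu>: "levy_measure \<nu>" using ch by (simp add: has_characteristics_def)
  have p2: "p < 2" using p \<beta> by simp
  have [measurable]: "levy_re \<nu> \<in> borel_measurable borel" by (rule borel_measurable_levy_re[OF levy ch])
  define K where "K = 1 / c"
  define \<delta> where "\<delta> = (\<beta> - p) / 2"
  have K: "K > 0" and \<delta>: "\<delta> > 0" using c p by (auto simp: K_def \<delta>_def)
  obtain C0 where C0: "C0 \<ge> 0" "\<And>v. v \<in> {0<..K} \<Longrightarrow> (levy_im a d \<nu> v)\<^sup>2 \<le> C0 * (levy_re \<nu> v + v\<^sup>2)"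
    using levy_im_le_near_0[OF \<nu> d] by blast
  obtain C1 where C1: "C1 > 0" "\<And>y. y \<in> {0<..c} \<Longrightarrow>
      levy_re \<nu> (1 / y) + \<bar>levy_im a d \<nu> (1 / y)\<bar> \<le> C1 * (y powr (- \<beta>) * l y)"
    using large by blast
  obtain C2 where C2: "C2 > 0" "\<And>x y. x \<in> {0<..c} \<Longrightarrow> y \<in> {0<..c} \<Longrightarrow>
      l x \<le> C2 * max ((x / y) powr \<delta>) ((y / x) powr \<delta>) * l y"
    using potter \<delta> unfolding potter_bounds_def by blast
  obtain C3 where C3: "C3 > 0" "\<And>y. y \<in> {0<..c} \<Longrightarrow> y powr (- p) \<le> C3 * (y powr (- \<beta>) * l y)"
    using powr_le_regularly_varying[OF potter pos c p(2)] by blast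
  define i0 where "i0 = enn2real (\<integral>\<^sup>+v\<in>{0<..K}. ennreal (v powr (-1 - p)) * ennreal (levy_re \<nu> v) \<partial>lborel)"
  have i0: "(\<integral>\<^sup>+v\<in>{0<..K}. ennreal (v powr (-1 - p)) * ennreal (levy_re \<nu> v) \<partial>lborel) = ennreal i0" "i0 \<ge> 0"
    using levy_re_integrable_near_0[OF levy ch p(1) p2 int, of K] by (auto simp: i0_def less_top)
  define k where "k = (1 + C0) * (i0 + K powr (2 - p) / (2 - p))"
  have k: "k \<ge> 0" using C0 i0 p2 by (simp add: k_def)
  define C where "C = max_moment_const p * (k * C3 + C1 * C2 / \<delta> + 2 / p)"
  have mc: "max_moment_const p > 0" using p by (simp add: max_moment_const_def)
  have C: "C > 0" unfolding C_def using mc k C3 C1 C2 \<delta> p by (intro mult_pos_pos add_nonneg_pos) auto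
  have "sup_moment M (\<lambda>s \<omega>. X s \<omega> - s * d) p t \<le> ennreal (C * y powr p)"
    if t: "t \<in> {0<..1}" and y: "y \<in> {0<..c}" and ty: "t * l y \<le> y powr \<beta>" for t y
  proof -
    have ly: "l y > 0" by (rule pos[OF y])
    define V where "V = 1 / y"
    have V: "V > 0" using y by (simp add: V_def)
    have Vp: "V powr (- p) = y powr p" "V powr \<beta> * y powr \<beta> = 1"
      using y by (simp_all add: V_def powr_divide powr_minus)
    \<comment> \<open>The contribution \<open>O(t)\<close> of the low frequencies is absorbed by \<open>O(y powr p)\<close>.\<close>
    have tp: "t \<le> C3 * y powr p"
    proof -
      have "t * y powr (- p) \<le> t * (C3 * (y powr (- \<beta>) * l y))"
        using t by (intro mult_left_mono C3 y) auto
      also have "\<dots> = C3 * y powr (- \<beta>) * (t * l y)" by simp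
      also have "\<dots> \<le> C3 * y powr (- \<beta>) * y powr \<beta>"
        using C3 ty by (intro mult_left_mono) auto
      also have "\<dots> = C3" using y by (simp add: powr_minus)
      finally show ?thesis using y by (simp add: powr_minus field_simps)
    qed
    define g1 where "g1 v = t * (1 + C0) * (levy_re \<nu> v + v powr 2)" for v
    define g2 where "g2 v = t * C1 * C2 * l y * V powr \<delta> * v powr (\<beta> - \<delta>)" for v
    define G where "G v = ennreal (g1 v) * indicator {0<..K} v + ennreal (g2 v) * indicator {0<..V} v
        + 2 * indicator {V..} v" for v
    have [measurable]: "G \<in> borel_measurable borel"
      unfolding G_def g1_def g2_def by measurable
    have "sup_moment M (\<lambda>s \<omega>. X s \<omega> - s * d) p t
      \<le> ennreal (max_moment_const p) * (\<integral>\<^sup>+v\<in>{0<..}. ennreal (v powr (-1 - p)) * G v \<partial>lborel)"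
    proof (rule sup_moment_le_char_integral[OF levy p(1)])
      fix h v :: real assume h: "0 \<le> h" "h \<le> t" and v: "v > 0"
      let ?A = "levy_re \<nu> v" and ?B = "levy_im a d \<nu> v"
      have A0: "0 \<le> ?A" by (rule levy_re_nonneg)
      let ?q = "1 - Re (char (distr M borel (\<lambda>\<omega>. X h \<omega> - h * d)) v)"
      have q: "?q = 1 - exp (- (h * ?A)) * cos (h * ?B)"
        using char_drift_eq[OF levy ch h(1), of d v] by simp
      consider "v \<le> K" | "K < v" "v \<le> V" | "V \<le> v" by linarith
      then show "ennreal ?q \<le> G v"
      proof cases
        case 1
        have "1 - cos (h * ?B) \<le> (h * ?B)\<^sup>2"
          using one_minus_cos_le[of "h * ?B"] zero_le_power2[of "h * ?B"] by linarith
        then have "?q \<le> h * ?A + (h * ?B)\<^sup>2"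
          unfolding q using h A0 by (intro one_minus_exp_cos_le) auto
        also have "(h * ?B)\<^sup>2 = h\<^sup>2 * ?B\<^sup>2" by (simp add: power_mult_distrib)
        also have "h\<^sup>2 * ?B\<^sup>2 \<le> t * (C0 * (?A + v\<^sup>2))"
        proof (intro mult_mono)
          have "h\<^sup>2 \<le> h * 1" unfolding power2_eq_square using h t by (intro mult_left_mono) auto
          then show "h\<^sup>2 \<le> t" using h by simp
        qed (use C0 v 1 t in auto)
        also have "h * ?A \<le> t * (?A + v\<^sup>2)" using h A0 t by (intro mult_mono) auto
        finally have "?q \<le> g1 v"
          using v by (simp add: g1_def powr_numeral algebra_simps)
        then have "ennreal ?q \<le> ennreal (g1 v)" by (rule ennreal_leI)
        then show ?thesis using 1 v by (simp add: G_def add_increasing2)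
      next
        case 2
        define x where "x = 1 / v"
        \<comment> \<open>In this range \<open>x = 1 / v\<close> lies in \<open>[y, c]\<close>, where \<open>l\<close> is controlled.\<close>
        have vK: "1 < v * c" using 2(1) c by (simp add: K_def field_simps)
        have x: "x \<in> {0<..c}" "y \<le> x" "v = 1 / x"
          using v vK 2 y by (auto simp: x_def V_def field_simps)
        have "?q \<le> h * ?A + \<bar>h * ?B\<bar>"
          unfolding q using h A0 by (intro one_minus_exp_cos_le one_minus_cos_le_abs) auto
        also have "\<dots> = h * (?A + \<bar>?B\<bar>)" using h by (simp add: abs_mult algebra_simps)
        also have "\<dots> \<le> t * (C1 * (x powr (- \<beta>) * l x))"
          using h t A0 C1(2)[OF x(1)] x(3) by (intro mult_mono) auto
        also have "\<dots> \<le> t * (C1 * (x powr (- \<beta>) * (C2 * (x / y) powr \<delta> * l y)))"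
        proof -
          have "y / x \<le> 1" "1 \<le> x / y" using x y by auto
          then have "y / x \<le> x / y" by linarith
          then have "(y / x) powr \<delta> \<le> (x / y) powr \<delta>" using x y \<delta> by (intro powr_mono2) auto
          then have "l x \<le> C2 * (x / y) powr \<delta> * l y" using C2(2)[OF x(1) y] by (simp add: max_def)
          then show ?thesis using t C1(1) by (intro mult_left_mono) auto
        qed
        also have "x powr (- \<beta>) * (C2 * (x / y) powr \<delta> * l y) = C2 * l y * V powr \<delta> * v powr (\<beta> - \<delta>)"
          using v y by (simp add: x_def V_def powr_divide powr_minus powr_diff powr_mult field_simps)
        finally have "?q \<le> g2 v" by (simp add: g2_def mult.assoc)
        then have "ennreal ?q \<le> ennreal (g2 v)" by (rule ennreal_leI)
        then show ?thesis using 2 v by (simp add: G_def add_increasing add_increasing2)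
      next
        case 3
        have "\<bar>exp (- (h * ?A)) * cos (h * ?B)\<bar> \<le> 1 * 1"
          unfolding abs_mult using h A0 by (intro mult_mono) auto
        then have "?q \<le> 2" unfolding q by linarith
        then have "ennreal ?q \<le> 2" using ennreal_leI[of ?q 2] by simp
        then show ?thesis using 3 v by (simp add: G_def add_increasing)
      qed
    qed (use t in auto)
    also have "(\<integral>\<^sup>+v\<in>{0<..}. ennreal (v powr (-1 - p)) * G v \<partial>lborel) \<le> ennreal ((k * C3 + C1 * C2 / \<delta> + 2 / p) * y powr p)"
    proof -
      let ?w = "\<lambda>v. ennreal (v powr (-1 - p))"
      have "(\<integral>\<^sup>+v\<in>{0<..}. ?w v * G v \<partial>lborel)
         = (\<integral>\<^sup>+v. (ennreal (t * (1 + C0)) * ((?w v * ennreal (levy_re \<nu> v)) * indicator {0<..K} v)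
              + ennreal (t * (1 + C0)) * (ennreal (v powr ((2 - p) - 1)) * indicator {0<..K} v))
              + ennreal (t * C1 * C2 * l y * V powr \<delta>) * (ennreal (v powr (\<delta> - 1)) * indicator {0<..V} v)
              + 2 * (ennreal (v powr (- p - 1)) * indicator {V..} v) \<partial>lborel)"
      proof (intro nn_integral_cong)
        fix v :: real
        show "?w v * G v * indicator {0<..} v
         = (ennreal (t * (1 + C0)) * ((?w v * ennreal (levy_re \<nu> v)) * indicator {0<..K} v)
              + ennreal (t * (1 + C0)) * (ennreal (v powr ((2 - p) - 1)) * indicator {0<..K} v))
              + ennreal (t * C1 * C2 * l y * V powr \<delta>) * (ennreal (v powr (\<delta> - 1)) * indicator {0<..V} v)
              + 2 * (ennreal (v powr (- p - 1)) * indicator {V..} v)"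
        proof (cases "v > 0")
          case True
          have e1: "?w v * ennreal (g1 v) = ennreal (t * (1 + C0)) * (?w v * ennreal (levy_re \<nu> v))
              + ennreal (t * (1 + C0)) * ennreal (v powr ((2 - p) - 1))"
          proof -
            have "v powr (-1 - p) * g1 v = t * (1 + C0) * (v powr (-1 - p) * levy_re \<nu> v)
                + t * (1 + C0) * (v powr (-1 - p) * v powr 2)"
              by (simp add: g1_def algebra_simps)
            also have "v powr (-1 - p) * v powr 2 = v powr ((2 - p) - 1)" by (simp flip: powr_add)
            finally have e: "v powr (-1 - p) * g1 v = t * (1 + C0) * (v powr (-1 - p) * levy_re \<nu> v)
                + t * (1 + C0) * v powr ((2 - p) - 1)" .
            have nn: "0 \<le> t * (1 + C0)" "0 \<le> levy_re \<nu> v" "0 \<le> g1 v"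
              using t C0 by (auto simp: levy_re_nonneg g1_def)
            have "?w v * ennreal (g1 v) = ennreal (v powr (-1 - p) * g1 v)"
              using nn by (intro ennreal_mult[symmetric]) auto
            also have "\<dots> = ennreal (t * (1 + C0) * (v powr (-1 - p) * levy_re \<nu> v)) + ennreal (t * (1 + C0) * v powr ((2 - p) - 1))"
              unfolding e using nn by (intro ennreal_plus) auto
            finally show ?thesis using nn by (simp only: ennreal_mult mult_nonneg_nonneg powr_ge_zero)
          qed
          have e2: "?w v * ennreal (g2 v) = ennreal (t * C1 * C2 * l y * V powr \<delta>) * ennreal (v powr (\<delta> - 1))"
          proof -
            have nn: "0 \<le> t * C1 * C2 * l y * V powr \<delta>" using t C1 C2 ly by auto
            have "v powr (-1 - p) * g2 v = t * C1 * C2 * l y * V powr \<delta> * (v powr (-1 - p) * v powr (\<beta> - \<delta>))"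
              by (simp add: g2_def)
            also have "v powr (-1 - p) * v powr (\<beta> - \<delta>) = v powr (\<delta> - 1)"
              by (simp add: \<delta>_def field_simps flip: powr_add)
            finally have e: "v powr (-1 - p) * g2 v = t * C1 * C2 * l y * V powr \<delta> * v powr (\<delta> - 1)" .
            have "?w v * ennreal (g2 v) = ennreal (v powr (-1 - p) * g2 v)"
              using nn by (intro ennreal_mult[symmetric]) (auto simp: g2_def)
            then show ?thesis unfolding e using nn by (simp only: ennreal_mult powr_ge_zero)
          qed
          have e3: "v powr (-1 - p) = v powr (- p - 1)" by (rule arg_cong[where f = "\<lambda>e. v powr e"]) simp
          show ?thesis
            using True e1 e2 e3 unfolding G_def
            by (simp add: distrib_left indicator_def mult.commute[of _ 2] ac_simps)
        qed (auto simp: V less_le_trans indicator_def dest: order_trans[OF less_imp_le[OF V]])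
      qed
      also have "\<dots> = ennreal (t * (1 + C0)) * ennreal i0
          + ennreal (t * (1 + C0)) * (\<integral>\<^sup>+v\<in>{0<..K}. ennreal (v powr ((2 - p) - 1)) \<partial>lborel)
          + ennreal (t * C1 * C2 * l y * V powr \<delta>) * (\<integral>\<^sup>+v\<in>{0<..V}. ennreal (v powr (\<delta> - 1)) \<partial>lborel)
          + 2 * (\<integral>\<^sup>+v\<in>{V..}. ennreal (v powr (- p - 1)) \<partial>lborel)"
        by (simp add: nn_integral_add nn_integral_cmult i0)
      also have "\<dots> = ennreal (t * (1 + C0)) * ennreal i0
          + ennreal (t * (1 + C0)) * ennreal (K powr (2 - p) / (2 - p))
          + ennreal (t * C1 * C2 * l y * V powr \<delta>) * ennreal (V powr \<delta> / \<delta>)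
          + ennreal 2 * ennreal (V powr (- p) / p)"
        using p p2 K V \<delta> nn_integral_powr_Ioc[of "2 - p" K] nn_integral_powr_Ioc[of \<delta> V] nn_integral_powr_Ici[of p V]
        by simp
      also have "\<dots> = ennreal (t * (1 + C0) * i0 + t * (1 + C0) * (K powr (2 - p) / (2 - p))
          + t * C1 * C2 * l y * V powr \<delta> * (V powr \<delta> / \<delta>) + 2 * (V powr (- p) / p))"
      proof -
        have "0 \<le> t * (1 + C0)" "0 \<le> K powr (2 - p) / (2 - p)" "0 \<le> t * C1 * C2 * l y * V powr \<delta>"
          "0 \<le> V powr \<delta> / \<delta>" "0 \<le> V powr (- p) / p" "(0::real) \<le> 2"
          using t C0 C1 C2 ly p p2 \<delta> by auto
        with i0(2) show ?thesis by (simp only: ennreal_mult ennreal_plus mult_nonneg_nonneg add_nonneg_nonneg)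
      qed
      also have "\<dots> \<le> ennreal ((k * C3 + C1 * C2 / \<delta> + 2 / p) * y powr p)"
      proof (rule ennreal_leI)
        have "t * (1 + C0) * i0 + t * (1 + C0) * (K powr (2 - p) / (2 - p)) = k * t"
          by (simp add: k_def algebra_simps)
        also have "\<dots> \<le> k * (C3 * y powr p)" using k tp by (intro mult_left_mono) auto
        finally have a: "t * (1 + C0) * i0 + t * (1 + C0) * (K powr (2 - p) / (2 - p)) \<le> k * C3 * y powr p" by simp
        have "V powr \<delta> * V powr \<delta> = V powr \<beta> * y powr p"
        proof -
          have "V powr \<delta> * V powr \<delta> = V powr (\<beta> + (- p))" by (simp add: \<delta>_def flip: powr_add)
          also have "\<dots> = V powr \<beta> * V powr (- p)" by (rule powr_add)
          finally show ?thesis by (simp add: Vp)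
        qed
        then have "t * C1 * C2 * l y * V powr \<delta> * (V powr \<delta> / \<delta>) = C1 * C2 / \<delta> * y powr p * V powr \<beta> * (t * l y)"
          by (simp add: mult.assoc)
        also have "\<dots> \<le> C1 * C2 / \<delta> * y powr p * V powr \<beta> * y powr \<beta>"
          using ty C1 C2 \<delta> by (intro mult_left_mono) auto
        also have "\<dots> = C1 * C2 / \<delta> * y powr p" using Vp(2) by (simp add: mult.assoc)
        finally have b: "t * C1 * C2 * l y * V powr \<delta> * (V powr \<delta> / \<delta>) \<le> C1 * C2 / \<delta> * y powr p" .
        show "t * (1 + C0) * i0 + t * (1 + C0) * (K powr (2 - p) / (2 - p))
          + t * C1 * C2 * l y * V powr \<delta> * (V powr \<delta> / \<delta>) + 2 * (V powr (- p) / p)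
          \<le> (k * C3 + C1 * C2 / \<delta> + 2 / p) * y powr p"
          using add_mono[OF a b] by (simp add: Vp algebra_simps)
      qed
      finally show ?thesis .
    qed
    also have "ennreal (max_moment_const p) * ennreal ((k * C3 + C1 * C2 / \<delta> + 2 / p) * y powr p) = ennreal (C * y powr p)"
      using mc unfolding C_def by (subst ennreal_mult'[symmetric]) (auto simp: mult.assoc)
    finally show ?thesis by (simp add: mult_left_mono)
  qed
  then show ?thesis using C by blast
qed

lemma bigo_at_0I:
  assumes "C > 0" and "eventually (\<lambda>t. F t \<le> ennreal (C * g t)) (at_right 0)"
    and "\<And>t. 0 \<le> g t"
  shows "bigo_at_0 F g"
  unfolding bigo_at_0_def
proof
  show "\<forall>\<^sub>F t in at_right 0. F t < \<infinity>"
    using assms(2) by eventually_elim (auto intro: le_less_trans)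
  show "(\<lambda>t. enn2real (F t)) \<in> O[at_right 0](g)"
  proof (rule bigoI)
    show "\<forall>\<^sub>F t in at_right 0. norm (enn2real (F t)) \<le> C * norm (g t)"
      using assms(2)
    proof eventually_elim
      case (elim t)
      then have "enn2real (F t) \<le> enn2real (ennreal (C * g t))" by (intro enn2real_mono) auto
      then show ?case using assms(1,3) by simp
    qed
  qed
qed

lemma eventually_powr_less:
  fixes b \<beta> :: real
  assumes "b > 0" and "\<beta> > 0"
  shows "eventually (\<lambda>t. 0 < t \<and> t \<le> 1 \<and> t powr (1 / \<beta>) < b) (at_right 0)"
  unfolding eventually_at_right_field
proof (intro exI[of _ "min 1 (b powr \<beta>)"] conjI allI impI)
  show "0 < min 1 (b powr \<beta>)" using assms by simp
  fix t :: real assume t: "0 < t" "t < min 1 (b powr \<beta>)"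
  then show "0 < t" "t \<le> 1" by auto
  have "t powr (1 / \<beta>) < (b powr \<beta>) powr (1 / \<beta>)" using t assms by (intro powr_less_mono2) auto
  then show "t powr (1 / \<beta>) < b" using assms by (simp add: powr_powr)
qed

text \<open>The cut-off \<open>x * l x powr (1 / q)\<close> tends to zero with \<open>x\<close>, since a Potter bound with exponent
  \<open>q / 2\<close> makes it \<open>O(sqrt x)\<close>.\<close>

lemma potter_scaled_le:
  fixes l :: "real \<Rightarrow> real"
  assumes potter: "potter_bounds c l" and pos: "\<And>x. x \<in> {0<..c} \<Longrightarrow> l x > 0"
    and c: "c > 0" and q: "q > 0"
  shows "\<exists>b>0. \<forall>x. 0 < x \<longrightarrow> x < b \<longrightarrow> x * l x powr (1 / q) \<le> c"
proof -
  define \<delta> where "\<delta> = q / 2"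
  have \<delta>: "\<delta> > 0" using q by (simp add: \<delta>_def)
  obtain C where C: "C > 0" "\<And>x y. x \<in> {0<..c} \<Longrightarrow> y \<in> {0<..c} \<Longrightarrow>
      l x \<le> C * max ((x / y) powr \<delta>) ((y / x) powr \<delta>) * l y"
    using potter \<delta> unfolding potter_bounds_def by blast
  have lc: "l c > 0" using c by (intro pos) auto
  define D where "D = (C * c powr \<delta> * l c) powr (1 / q)"
  have D: "D > 0" using C lc c by (simp add: D_def)
  show ?thesis
  proof (intro exI[of _ "min c ((c / D)\<^sup>2)"] conjI allI impI)
    show "0 < min c ((c / D)\<^sup>2)" using c D by simp
    fix x assume x: "0 < x" "x < min c ((c / D)\<^sup>2)"
    have "x / c \<le> 1" "1 \<le> c / x" using x by auto
    then have "x / c \<le> c / x" by linarith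
    then have "(x / c) powr \<delta> \<le> (c / x) powr \<delta>" using x c \<delta> by (intro powr_mono2) auto
    then have "l x \<le> C * (c / x) powr \<delta> * l c" using C(2)[of x c] x c by (simp add: max_def)
    also have "\<dots> = (C * c powr \<delta> * l c) * x powr (- \<delta>)"
      using x c by (simp add: powr_divide powr_minus field_simps)
    finally have "l x powr (1 / q) \<le> ((C * c powr \<delta> * l c) * x powr (- \<delta>)) powr (1 / q)"
      using x q by (intro powr_mono2 less_imp_le[OF pos]) auto
    also have "\<dots> = D * x powr (- 1 / 2)"
      using q C lc by (simp add: D_def powr_mult powr_powr \<delta>_def)
    finally have "x * l x powr (1 / q) \<le> x powr 1 * (D * x powr (- 1 / 2))"
      using x by (simp add: mult_left_mono)
    also have "\<dots> = D * (x powr 1 * x powr (- 1 / 2))" by simp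
    also have "x powr 1 * x powr (- 1 / 2) = sqrt x"
    proof -
      have "x powr 1 * x powr (- 1 / 2) = x powr (1 + - 1 / 2)" by (rule powr_add[symmetric])
      then show ?thesis using x by (simp add: powr_half_sqrt)
    qed
    also have "sqrt x \<le> sqrt ((c / D)\<^sup>2)" using x by (intro real_sqrt_le_mono) auto
    also have "\<dots> = c / D" using c D by simp
    finally show "x * l x powr (1 / q) \<le> c" using D by (simp add: mult_left_mono)
  qed
qed

theorem corollary1p1:
  fixes M :: "'a measure" and X :: "real \<Rightarrow> 'a \<Rightarrow> real"
    and \<nu> :: "real measure" and \<phi> l :: "real \<Rightarrow> real" and a \<beta> p c :: real
  assumes "levy_process M X"
    and "has_characteristics M X a 0 \<nu>"
    and "\<beta> = levy_index \<nu>" and "\<beta> > 0"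
    and "0 < p" and "p < \<beta>"
    and "integrable M (\<lambda>\<omega>. \<bar>X 1 \<omega>\<bar> powr p)"
    and "\<beta> = 1 \<Longrightarrow> symmetric_measure \<nu>"
    and "0 < c" and "c \<le> 1"
    and "regularly_varying_at_0 c \<phi> (- (\<beta> + 1))"
    and "levy_measure_dominated \<nu> c \<phi>"
    and "l = (\<lambda>x. x powr (\<beta> + 1) * \<phi> x)"
    and "locally_bounded_on {1 / c..} (\<lambda>x. l (1 / x))"
  shows "(antimono_on {0<..c} l \<and> \<not> bounded (l ` {0<..c}) \<longrightarrow>
           (\<forall>\<epsilon>. 0 < \<epsilon> \<and> \<epsilon> < \<beta> \<longrightarrow>
              bigo_at_0 (sup_moment M (compensated_process a \<nu> X) p)
                (\<lambda>t. t powr (p / \<beta>) * l (t powr (1 / \<beta>)) powr (p / (\<beta> - \<epsilon>)))))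
       \<and> (mono_on {0<..c} l \<and> (l \<longlongrightarrow> 0) (at_right 0) \<and> \<beta> < 2 \<longrightarrow>
           (\<forall>\<epsilon>>0.
              bigo_at_0 (sup_moment M (compensated_process a \<nu> X) p)
                (\<lambda>t. t powr (p / \<beta>) * l (t powr (1 / \<beta>)) powr (p / (\<beta> + \<epsilon>)))))"
proof -
  note levy = assms(1) and ch = assms(2) and index = assms(3) and \<beta> = assms(4)
    and p = assms(5,6) and int = assms(7) and sym = assms(8) and c = assms(9,10)
    and rv = assms(11) and dom = assms(12) and l = assms(13)
  have \<nu>: "levy_measure \<nu>" using ch by (simp add: has_characteristics_def)
  have \<beta>2: "\<beta> \<le> 2" using levy_index_le_2[OF \<nu>] index by simp
  have \<phi>m: "\<phi> \<in> borel_measurable (restrict_space borel {0<..c})" and \<phi>pos: "\<And>x. x \<in> {0<..c} \<Longrightarrow> \<phi> x > 0"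
    using rv by (auto simp: regularly_varying_at_0_def)
  have pos: "l x > 0" if "x \<in> {0<..c}" for x using \<phi>pos[OF that] that by (simp add: l)
  have \<phi>: "\<phi> x = x powr (- \<beta> - 1) * l x" if "x \<in> {0<..c}" for x
    using that by (simp add: l powr_minus powr_add powr_diff field_simps)
  have slow: "((\<lambda>x. l (2 * x) / l x) \<longlongrightarrow> 1) (at_right 0)"
    by (rule slowly_varying_doubling[OF rv l])
  define d where "d = (if \<beta> > 1 then 0 else if \<beta> < 1 then a - (LINT x:{-1..1}|\<nu>. x) else a)"
  have d: "drift_case a \<beta> \<nu> d"
    using sym integrable_small_jumps[OF \<nu>] index by (auto simp: drift_case_def d_def)
  have U: "compensated_process a \<nu> X = (\<lambda>s \<omega>. X s \<omega> - s * d)"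
    by (auto simp: fun_eq_iff compensated_process_def d_def index)
  define F where "F = sup_moment M (compensated_process a \<nu> X) p"
  have bound: "\<exists>C>0. \<forall>t\<in>{0<..1}. \<forall>y\<in>{0<..c}. t * l y \<le> y powr \<beta> \<longrightarrow> F t \<le> ennreal (C * y powr p)"
    if potter: "potter_bounds c l" and side: "\<beta> < 2 \<or> antimono_on {0<..c} l"
  proof -
    have large: "\<exists>C>0. \<forall>y\<in>{0<..c}. levy_re \<nu> (1 / y) + \<bar>levy_im a d \<nu> (1 / y)\<bar> \<le> C * (y powr (- \<beta>) * l y)"
    proof (cases "\<beta> < 2")
      case True
      show ?thesis
        by (rule levy_exponent_le_near_infinity[OF \<nu> dom \<phi>m \<phi> potter pos c \<beta> _ d]) (use True in auto)
    next
      case False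
      then have \<beta>_eq: "\<beta> = 2" and anti: "antimono_on {0<..c} l" using \<beta>2 side by auto
      have d0: "d = 0" using \<beta>_eq by (simp add: d_def)
      have lc: "l c > 0" using c by (intro pos) auto
      define B where "B = 5 * (\<integral>x. min (x\<^sup>2) 1 \<partial>\<nu>) + \<bar>a\<bar>"
      have B: "B \<ge> 0" unfolding B_def by (intro add_nonneg_nonneg mult_nonneg_nonneg Bochner_Integration.integral_nonneg) auto
      show ?thesis
      proof (intro exI[of _ "(B + 1) / l c"] conjI ballI)
        show "(B + 1) / l c > 0" using B lc by simp
        fix y assume y: "y \<in> {0<..c}"
        have "l c \<le> l y" using anti y c by (auto simp: monotone_on_def)
        have "levy_re \<nu> (1 / y) + \<bar>levy_im a d \<nu> (1 / y)\<bar> \<le> B * y powr (- 2)"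
          unfolding d0 B_def using y c by (intro levy_exponent_le_square[OF \<nu>]) auto
        also have "\<dots> \<le> (B + 1) * y powr (- 2) * 1" by (simp add: mult_right_mono)
        also have "\<dots> \<le> (B + 1) * y powr (- 2) * (l y / l c)"
          using B lc \<open>l c \<le> l y\<close> by (intro mult_left_mono) auto
        finally show "levy_re \<nu> (1 / y) + \<bar>levy_im a d \<nu> (1 / y)\<bar> \<le> (B + 1) / l c * (y powr (- \<beta>) * l y)"
          by (simp add: \<beta>_eq field_simps)
      qed
    qed
    show ?thesis
      unfolding F_def U by (rule sup_moment_le_powr[OF levy ch p \<beta>2 int d potter pos c large])
  qed
  have conclude: "bigo_at_0 F (\<lambda>t. t powr (p / \<beta>) * l (t powr (1 / \<beta>)) powr (p / q))"
    if potter: "potter_bounds c l" and side: "\<beta> < 2 \<or> antimono_on {0<..c} l"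
      and q: "q > 0" and b: "b > 0" "b \<le> c"
      and good: "\<And>x. 0 < x \<Longrightarrow> x < b \<Longrightarrow> x * l x powr (1 / q) \<le> c \<and> l (x * l x powr (1 / q)) \<le> l x powr (\<beta> / q)"
    for q b
  proof -
    obtain C where C: "C > 0" "\<And>t y. t \<in> {0<..1} \<Longrightarrow> y \<in> {0<..c} \<Longrightarrow> t * l y \<le> y powr \<beta> \<Longrightarrow> F t \<le> ennreal (C * y powr p)"
      using bound[OF potter side] by blast
    show ?thesis
    proof (rule bigo_at_0I[OF C(1)])
      show "eventually (\<lambda>t. F t \<le> ennreal (C * (t powr (p / \<beta>) * l (t powr (1 / \<beta>)) powr (p / q)))) (at_right 0)"
        using eventually_powr_less[OF b(1) \<beta>]
      proof eventually_elim
        case (elim t)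
        \<comment> \<open>The cut-off \<open>y\<close> is chosen such that its \<open>p\<close>-th power is the asserted rate.\<close>
        define x where "x = t powr (1 / \<beta>)"
        define y where "y = x * l x powr (1 / q)"
        have x: "0 < x" "x < b" using elim by (auto simp: x_def)
        have lx: "l x > 0" using x b by (intro pos) auto
        have y: "y \<in> {0<..c}" using x lx good[OF x] by (simp add: y_def)
        have xb: "x powr \<beta> = t" "x powr p = t powr (p / \<beta>)" using elim \<beta> by (simp_all add: x_def powr_powr)
        have "t * l y \<le> t * l x powr (\<beta> / q)" using elim good[OF x] by (intro mult_left_mono) (auto simp: y_def)
        also have "\<dots> = y powr \<beta>" using x lx by (simp add: y_def powr_mult powr_powr xb)
        finally have "F t \<le> ennreal (C * y powr p)" using elim y by (intro C(2)) auto
        also have "y powr p = t powr (p / \<beta>) * l x powr (p / q)" using x lx by (simp add: y_def powr_mult powr_powr xb)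
        finally show ?case by (simp add: x_def)
      qed
    qed simp
  qed
  have "bigo_at_0 F (\<lambda>t. t powr (p / \<beta>) * l (t powr (1 / \<beta>)) powr (p / (\<beta> - \<epsilon>)))"
    if anti: "antimono_on {0<..c} l" and unb: "\<not> bounded (l ` {0<..c})" and \<epsilon>: "0 < \<epsilon>" "\<epsilon> < \<beta>" for \<epsilon>
  proof -
    have potter: "potter_bounds c l" by (rule potter_bounds_antimono[OF c(1) anti pos slow])
    have q: "\<beta> - \<epsilon> > 0" using \<epsilon> by simp
    obtain b1 where b1: "b1 > 0" "\<And>x. 0 < x \<Longrightarrow> x < b1 \<Longrightarrow> x * l x powr (1 / (\<beta> - \<epsilon>)) \<le> c"
      using potter_scaled_le[OF potter pos c(1) q] by blast
    have "\<exists>z\<in>{0<..c}. 1 \<le> l z"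
    proof (rule ccontr)
      assume "\<not> (\<exists>z\<in>{0<..c}. 1 \<le> l z)"
      then have "\<bar>l z\<bar> \<le> 1" if "z \<in> {0<..c}" for z using pos[OF that] that by force
      then have "bounded (l ` {0<..c})" by (auto simp: bounded_iff intro!: exI[of _ 1])
      then show False using unb by simp
    qed
    then obtain z where z: "z \<in> {0<..c}" "1 \<le> l z" by blast
    show ?thesis
    proof (rule conclude[OF potter _ q])
      show "0 < min b1 z" "min b1 z \<le> c" using b1 z by auto
      fix x assume x: "0 < x" "x < min b1 z"
      let ?y = "x * l x powr (1 / (\<beta> - \<epsilon>))"
      have "l z \<le> l x" using anti x z by (auto simp: monotone_on_def)
      then have L: "1 \<le> l x" using z by simp
      have yc: "?y \<le> c" using b1 x by simp
      have "1 \<le> l x powr (1 / (\<beta> - \<epsilon>))" using L q by (intro ge_one_powr_ge_zero) auto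
      then have "x \<le> ?y" using x by simp
      moreover have "x \<in> {0<..c}" "?y \<in> {0<..c}"
        using x z yc less_le_trans[OF x(1) \<open>x \<le> ?y\<close>] by auto
      ultimately have "l ?y \<le> l x" using monotone_onD[OF anti] by blast
      also have "\<dots> = l x powr 1" using L by simp
      also have "\<dots> \<le> l x powr (\<beta> / (\<beta> - \<epsilon>))" using L q \<epsilon> by (intro powr_mono) auto
      finally show "?y \<le> c \<and> l ?y \<le> l x powr (\<beta> / (\<beta> - \<epsilon>))" using yc by simp
    qed (use anti in simp)
  qed
  moreover have "bigo_at_0 F (\<lambda>t. t powr (p / \<beta>) * l (t powr (1 / \<beta>)) powr (p / (\<beta> + \<epsilon>)))"
    if mono: "mono_on {0<..c} l" and lim: "(l \<longlongrightarrow> 0) (at_right 0)" and "\<beta> < 2" and \<epsilon>: "0 < \<epsilon>" for \<epsilon>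
  proof -
    have potter: "potter_bounds c l" by (rule potter_bounds_mono[OF c(1) mono pos slow])
    have q: "\<beta> + \<epsilon> > 0" using \<epsilon> \<beta> by simp
    have "eventually (\<lambda>x. l x < 1) (at_right 0)" using order_tendstoD(2)[OF lim, of 1] by simp
    then obtain b where b: "b > 0" "\<forall>x>0. x < b \<longrightarrow> l x < 1" unfolding eventually_at_right_field by auto
    show ?thesis
    proof (rule conclude[OF potter _ q])
      show "0 < min b c" "min b c \<le> c" using b c by auto
      fix x assume x: "0 < x" "x < min b c"
      let ?y = "x * l x powr (1 / (\<beta> + \<epsilon>))"
      have L: "l x \<le> 1" "0 < l x" using b x by (auto intro!: pos less_imp_le)
      have "l x powr (1 / (\<beta> + \<epsilon>)) \<le> 1" using L q by (intro powr_le1) auto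
      then have y: "?y \<le> x" "0 < ?y" using x L by auto
      have "?y \<le> c" using y(1) x by linarith
      then have "x \<in> {0<..c}" "?y \<in> {0<..c}" using x y(2) by auto
      then have "l ?y \<le> l x" using mono_onD[OF mono] y(1) by blast
      also have "\<dots> = l x powr 1" using L by simp
      also have "\<dots> \<le> l x powr (\<beta> / (\<beta> + \<epsilon>))" using L q \<epsilon> by (intro powr_mono') auto
      finally show "?y \<le> c \<and> l ?y \<le> l x powr (\<beta> / (\<beta> + \<epsilon>))" using \<open>?y \<le> c\<close> by simp
    qed (use \<open>\<beta> < 2\<close> in simp)
  qed
  ultimately show ?thesis unfolding F_def by blast
qed

end
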